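(* Assume that there is $\rho>0$, the same for all meshes $\Omega_h$, such that each element $E\in\Omega_h$ is star-shaped with respect to a ball of radius $\ge\rho h_E$ and each edge of $E$ has length $\ge\rho h_E$. Then $$\|\mathbf v_h\|_{\mathcal K}^2\lesssim\mathcal K_h(\mathbf v_h,\mathbf v_h)\qquad\text{for all }\mathbf v_h\in\mathbf V_h.$$
   Context: Data. $\Omega\subset\mathbb R^2$ is a polygonal simply connected domain with boundary $\Gamma$; $\nu,\sigma>0$ are constants; $\boldsymbol\beta\in[W^3_\infty(\Omega)]^2$ with $\operatorname{div}\boldsymbol\beta=0$. $\boldsymbol\varepsilon(\mathbf u)=\frac12(\nabla\mathbf u+\nabla\mathbf u^T)$, $((\nabla\mathbf u)\boldsymbol\beta)_i=\sum_j\beta_j\partial_ju_i$. Mesh. $\{\Omega_h\}_h$ is a sequence of decompositions of $\Omega$ into non-overlapping open polygons $E$ of diameter $h_E$, $h=\max_Eh_E$. Mesh assumption: there is $\rho>0$, the same for all meshes, such that each $E$ is star-shaped with respect to a ball of radius $\ge\rho h_E$ and each edge of $E$ has length $\ge\rho h_E$. $\|\cdot\|_{0,E}$ is the $L^2(E)$ norm. $\mathbb P_n(E)$ are polynomials of degree $\le n$, $\mathbb P_{-1}=\{0\}$. For an interior edge $e\subset\partial E\cap\partial K$, $[\![w]\!]=w|_E-w|_K$ on $e$ (sign irrelevant); $\mathbf t^e$ is a unit tangent to $e$. Projections. $\Pi_n^{0,E}$ is the $L^2(E)$ projection onto polynomials of degree $\le n$ (vectors), $\boldsymbol\Pi^{0,E}_n$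 its tensor version; $\Pi^0_k$ is the global elementwise version. $\Pi_k^{\nabla,E}:[H^1(E)]^2\to[\mathbb P_k(E)]^2$ satisfies $\int_E\nabla\mathbf q:\nabla(\mathbf v-\Pi_k^{\nabla,E}\mathbf v)=0$ for all $\mathbf q\in[\mathbb P_k(E)]^2$ and $P_0(\mathbf v-\Pi_k^{\nabla,E}\mathbf v)=0$ with $P_0$ a projection onto constants. Discrete space ($k\ge2$ integer). $\mathbf x^\perp=(x_2,-x_1)^T$; $\hat{\mathbb P}_{k-1/k-3}(E)$ is the span of the scaled monomials of degree $k-2$ and $k-1$. $\mathbf V_h^k(E)$ is the set of $\mathbf v_h\in[H^1(E)]^2$ with: $\Delta\mathbf v_h+\nabla s\in\mathbf x^\perp\mathbb P_{k-1}(E)$ for some $s\in L^2_0(E)$; $\operatorname{div}\mathbf v_h\in\mathbb P_{k-1}(E)$; $\mathbf v_h|_e\in[\mathbb P_k(e)]^2$ on each edge and $\mathbf v_h|_{\partial E}$ continuous; $(\mathbf v_h-\Pi_k^{\nabla,E}\mathbf v_h,\mathbf x^\perp\hat p)_{0,E}=0$ for all $\hat p\in\hat{\mathbb P}_{k-1/k-3}(E)$. $\mathbf V_h=\{\mathbf v_h\in[H^1_0(\Omega)]^2:\mathbf v_h|_E\in\mathbf V_h^k(E)\ \forall E\}$. Stabilization. $S_h^E$ is a symmetric bilinear form on $\mathbf V_h^k(E)$ with $\alpha_*\|\nabla\mathbf v\|_{0,E}^2\le S_h^E(\mathbf v,\mathbf v)\le\alpha^*\|\nabla\mathbf v\|_{0,E}^2$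 for all $\mathbf v\in\mathbf V_h^k(E)$ with $\Pi_k^{0,E}\mathbf v=0$, with uniform constants $\alpha_*,\alpha^*>0$. Discrete forms (sums over $E$ of local forms; write $\mathbf v^\circ=(I-\Pi_k^{0,E})\mathbf v$). $A_h^E(\mathbf u,\mathbf v)=\nu\int_E\boldsymbol\Pi^{0,E}_{k-1}\boldsymbol\varepsilon(\mathbf u):\boldsymbol\Pi^{0,E}_{k-1}\boldsymbol\varepsilon(\mathbf v)+\sigma\int_E\Pi^{0,E}_k\mathbf u\cdot\Pi_k^{0,E}\mathbf v+(\nu+\sigma h_E^2)S_h^E(\mathbf u^\circ,\mathbf v^\circ)$; $c_h^E(\mathbf u,\mathbf v)=\int_E[(\boldsymbol\Pi^{0,E}_k\nabla\mathbf u)\boldsymbol\beta]\cdot\Pi_k^{0,E}\mathbf v$, $c_h^{{\rm skew},E}(\mathbf u,\mathbf v)=\frac12(c_h^E(\mathbf u,\mathbf v)-c_h^E(\mathbf v,\mathbf u))$; with $\mathcal B\mathbf v|_E=\operatorname{curl}((\nabla\mathbf v)\boldsymbol\beta)$, $\operatorname{curl}\mathbf w=\partial_xw_2-\partial_yw_1$, $J_h^{E,1}(\mathbf u,\mathbf v)=\frac12\int_{\partial E\setminus\Gamma}h_E^2[\![(\nabla\Pi_k^0\mathbf u)\boldsymbol\beta\cdot\mathbf t^e]\!][\![(\nabla\Pi_k^0\mathbf v)\boldsymbol\beta\cdot\mathbf t^e]\!]$, $J_h^{E,2}(\mathbf u,\mathbf v)=\frac12\int_{\partial E\setminus\Gamma}h_E^4[\![\mathcal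 B\Pi_k^0\mathbf u]\!][\![\mathcal B\Pi_k^0\mathbf v]\!]$, $J_h^{E,3}(\mathbf u,\mathbf v)=\frac12\int_{\partial E\setminus\Gamma}h_E^6[\![\nabla\mathcal B\Pi_k^0\mathbf u]\!]\cdot[\![\nabla\mathcal B\Pi_k^0\mathbf v]\!]$, and $J_h^E(\mathbf u,\mathbf v)=\sum_{i=1}^3\delta_iJ_h^{E,i}(\mathbf u,\mathbf v)+\delta h_ES_h^E(\mathbf u^\circ,\mathbf v^\circ)$, where $\delta_i>0$ are parameters and $\delta=\max\{\delta_1,\delta_2,\delta_3\}$. $\mathcal K_h=\sum_E(A_h^E+c_h^{{\rm skew},E}+J_h^E)$. Norm: $\|\mathbf v\|_{\mathcal K,E}^2=\nu\|\nabla\mathbf v\|_{0,E}^2+\sigma\|\mathbf v\|_{0,E}^2+J_h^E(\mathbf v,\mathbf v)$, $\|\mathbf v\|_{\mathcal K}=(\sum_E\|\mathbf v\|_{\mathcal K,E}^2)^{1/2}$. Convention: $X\lesssim Y$ means $X\le CY$ with $C>0$ independent of $h$, of the mesh, of $\nu,\sigma,\boldsymbol\beta,\delta_i$ and of $\mathbf v_h$; $C$ may depend on $k$, $\Omega$, $\rho$, $\alpha_*,\alpha^*$. *)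

theory Defs
  imports "HOL-Analysis.Analysis"
begin

section \<open>Function spaces on open subsets of the plane\<close>

text \<open>
  Elements of Lebesgue and Sobolev spaces on a set \<open>U\<close> are represented by functions on the whole
  plane; only their values almost everywhere on \<open>U\<close> are relevant.
\<close>

definition square_integrable :: "(real^2) set \<Rightarrow> (real^2 \<Rightarrow> 'a::euclidean_space) \<Rightarrow> bool" where
  "square_integrable U f \<longleftrightarrow>
     f \<in> borel_measurable (lebesgue_on U) \<and> integrable (lebesgue_on U) (\<lambda>x. (norm (f x))\<^sup>2)"

definition l2_inner :: "(real^2) set \<Rightarrow> (real^2 \<Rightarrow> 'a::euclidean_space) \<Rightarrow> (real^2 \<Rightarrow> 'a) \<Rightarrow> real" where
  "l2_inner U f g = (\<integral>x. f x \<bullet> g x \<partial>(lebesgue_on U))"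

definition l2_norm :: "(real^2) set \<Rightarrow> (real^2 \<Rightarrow> 'a::euclidean_space) \<Rightarrow> real" where
  "l2_norm U f = sqrt (l2_inner U f f)"

definition partial_deriv :: "2 \<Rightarrow> (real^2 \<Rightarrow> 'a::real_normed_vector) \<Rightarrow> real^2 \<Rightarrow> 'a" where
  "partial_deriv j f x = frechet_derivative f (at x) (axis j 1)"

primrec C_diff :: "nat \<Rightarrow> (real^2 \<Rightarrow> 'a::real_normed_vector) \<Rightarrow> bool" where
  "C_diff 0 = (\<lambda>f. continuous_on UNIV f)"
| "C_diff (Suc m) = (\<lambda>f. f differentiable_on UNIV \<and> (\<forall>j. C_diff m (partial_deriv j f)))"

definition smooth :: "(real^2 \<Rightarrow> 'a::real_normed_vector) \<Rightarrow> bool" where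
  "smooth f \<longleftrightarrow> (\<forall>m. C_diff m f)"

definition test_function :: "(real^2) set \<Rightarrow> (real^2 \<Rightarrow> 'a::real_normed_vector) \<Rightarrow> bool" where
  "test_function U \<phi> \<longleftrightarrow>
     smooth \<phi> \<and> compact (closure {x. \<phi> x \<noteq> 0}) \<and> closure {x. \<phi> x \<noteq> 0} \<subseteq> U"

definition locally_integrable :: "(real^2) set \<Rightarrow> (real^2 \<Rightarrow> 'a::euclidean_space) \<Rightarrow> bool" where
  "locally_integrable U f \<longleftrightarrow> (\<forall>K. compact K \<and> K \<subseteq> U \<longrightarrow> integrable (lebesgue_on K) f)"

definition has_weak_partial ::
  "(real^2) set \<Rightarrow> 2 \<Rightarrow> (real^2 \<Rightarrow> 'a::euclidean_space) \<Rightarrow> (real^2 \<Rightarrow> 'a) \<Rightarrow> bool" where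
  "has_weak_partial U j f g \<longleftrightarrow>
     locally_integrable U f \<and> locally_integrable U g \<and>
     (\<forall>\<phi>::real^2 \<Rightarrow> real. test_function U \<phi> \<longrightarrow>
        (\<integral>x. partial_deriv j \<phi> x *\<^sub>R f x \<partial>(lebesgue_on U)) = - (\<integral>x. \<phi> x *\<^sub>R g x \<partial>(lebesgue_on U)))"

text \<open>Gradient convention (also for the library's classical \<^const>\<open>jacobian\<close>): entry \<open>$ i $ j\<close> is \<open>\<partial>\<^sub>j u\<^sub>i\<close>.\<close>

definition has_weak_grad :: "(real^2) set \<Rightarrow> (real^2 \<Rightarrow> real^2) \<Rightarrow> (real^2 \<Rightarrow> real^2^2) \<Rightarrow> bool" where
  "has_weak_grad U u G \<longleftrightarrow> (\<forall>j. has_weak_partial U j u (\<lambda>x. column j (G x)))"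

text \<open>The weak gradient is unique up to null sets, so the choice of representative is immaterial.\<close>

definition weak_grad :: "(real^2) set \<Rightarrow> (real^2 \<Rightarrow> real^2) \<Rightarrow> real^2 \<Rightarrow> real^2^2" where
  "weak_grad U u = (SOME G. has_weak_grad U u G)"

definition H1 :: "(real^2) set \<Rightarrow> (real^2 \<Rightarrow> real^2) set" where
  "H1 U = {u. square_integrable U u \<and> (\<exists>G. has_weak_grad U u G \<and> square_integrable U G)}"

definition H1_converges :: "(real^2) set \<Rightarrow> (nat \<Rightarrow> real^2 \<Rightarrow> real^2) \<Rightarrow> (real^2 \<Rightarrow> real^2) \<Rightarrow> bool" where
  "H1_converges U \<phi> u \<longleftrightarrow>
     (\<forall>n. \<phi> n \<in> H1 U) \<and> u \<in> H1 U \<and>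
     (\<lambda>n. l2_norm U (\<lambda>x. \<phi> n x - u x)) \<longlonglongrightarrow> 0 \<and>
     (\<lambda>n. l2_norm U (\<lambda>x. jacobian (\<phi> n) (at x) - weak_grad U u x)) \<longlonglongrightarrow> 0"

definition H10 :: "(real^2) set \<Rightarrow> (real^2 \<Rightarrow> real^2) set" where
  "H10 U = {u. \<exists>\<phi>. (\<forall>n. test_function U (\<phi> n)) \<and> H1_converges U \<phi> u}"

definition ess_bounded :: "(real^2) set \<Rightarrow> (real^2 \<Rightarrow> 'a::euclidean_space) \<Rightarrow> bool" where
  "ess_bounded U f \<longleftrightarrow>
     f \<in> borel_measurable (lebesgue_on U) \<and> (\<exists>B. AE x in lebesgue_on U. norm (f x) \<le> B)"

primrec W_inf :: "nat \<Rightarrow> (real^2) set \<Rightarrow> (real^2 \<Rightarrow> 'a::euclidean_space) \<Rightarrow> bool" where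
  "W_inf 0 = (\<lambda>U f. ess_bounded U f)"
| "W_inf (Suc m) =
     (\<lambda>U f. ess_bounded U f \<and> (\<forall>j. \<exists>g. has_weak_partial U j f g \<and> W_inf m U g))"

text \<open>
  Advection fields in \<open>W\<^sup>3\<^sub>\<infinity>\<close>. Continuity selects the continuous representative, which is
  automatically twice continuously differentiable on the open set \<open>U\<close>, so that the field and its
  first and second classical derivatives have values on mesh edges.
\<close>

definition advection_field :: "(real^2) set \<Rightarrow> (real^2 \<Rightarrow> real^2) \<Rightarrow> bool" where
  "advection_field U \<beta> \<longleftrightarrow>
     W_inf 3 U \<beta> \<and> continuous_on U \<beta> \<and> (AE x in lebesgue_on U. trace (weak_grad U \<beta> x) = 0)"


section \<open>Polygons and meshes\<close>

text \<open>
  A mesh element is given by the cyclic list of its vertices. Angles equal to \<open>\<pi>\<close> are allowed, so a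
  straight side may consist of several edges (hanging nodes).
\<close>

type_synonym element = "(real^2) list"

definition edges :: "element \<Rightarrow> ((real^2) \<times> (real^2)) set" where
  "edges P = set (zip P (rotate1 P))"

definition edge_union :: "element \<Rightarrow> (real^2) set" where
  "edge_union P = (\<Union>(a, b)\<in>edges P. closed_segment a b)"

definition region :: "element \<Rightarrow> (real^2) set" where
  "region P = inside (edge_union P)"

definition simple_polygon :: "element \<Rightarrow> bool" where
  "simple_polygon P \<longleftrightarrow>
     length P \<ge> 3 \<and> distinct P \<and>
     (\<forall>(a, b)\<in>edges P. \<forall>(c, d)\<in>edges P.
        (a, b) \<noteq> (c, d) \<longrightarrow> closed_segment a b \<inter> closed_segment c d \<subseteq> {a, b} \<inter> {c, d})"

definition elem_diam :: "element \<Rightarrow> real" where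
  "elem_diam P = diameter (region P)"

definition polygonal_domain :: "(real^2) set \<Rightarrow> bool" where
  "polygonal_domain \<Omega> \<longleftrightarrow>
     \<Omega> \<noteq> {} \<and> open \<Omega> \<and> connected \<Omega> \<and> bounded \<Omega> \<and>
     (\<exists>s. finite s \<and> frontier \<Omega> = (\<Union>(a, b)\<in>s. closed_segment a b))"

definition polygonal_mesh :: "(real^2) set \<Rightarrow> element set \<Rightarrow> bool" where
  "polygonal_mesh \<Omega> M \<longleftrightarrow>
     finite M \<and> (\<forall>P\<in>M. simple_polygon P \<and> region P \<subseteq> \<Omega>) \<and>
     (\<forall>P\<in>M. \<forall>Q\<in>M. P \<noteq> Q \<longrightarrow> region P \<inter> region Q = {}) \<and>
     closure \<Omega> = (\<Union>P\<in>M. closure (region P))"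

definition star_shaped_wrt_ball :: "(real^2) set \<Rightarrow> real^2 \<Rightarrow> real \<Rightarrow> bool" where
  "star_shaped_wrt_ball U c r \<longleftrightarrow>
     ball c r \<subseteq> U \<and> (\<forall>y\<in>ball c r. \<forall>z\<in>U. closed_segment y z \<subseteq> U)"

definition mesh_regular :: "real \<Rightarrow> element set \<Rightarrow> bool" where
  "mesh_regular \<rho> M \<longleftrightarrow>
     (\<forall>P\<in>M. (\<exists>c r. r \<ge> \<rho> * elem_diam P \<and> star_shaped_wrt_ball (region P) c r) \<and>
             (\<forall>(a, b)\<in>edges P. dist a b \<ge> \<rho> * elem_diam P))"

definition edge_integral :: "real^2 \<Rightarrow> real^2 \<Rightarrow> (real^2 \<Rightarrow> real) \<Rightarrow> real" where
  "edge_integral a b f = dist a b * (\<integral>t. f (linepath a b t) \<partial>(lebesgue_on {0..1}))"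


section \<open>Polynomials and projections\<close>

definition polys :: "nat \<Rightarrow> (real^2 \<Rightarrow> 'a::real_vector) set" where
  "polys n = {p. \<exists>c. p = (\<lambda>x. \<Sum>(i, j)\<in>{(i, j). i + j \<le> n}. (x $ 1 ^ i * x $ 2 ^ j) *\<^sub>R c i j)}"

text \<open>Used at scalar, vector and matrix type; the inner product of matrices is the Frobenius one.\<close>

definition l2_proj :: "nat \<Rightarrow> (real^2) set \<Rightarrow> (real^2 \<Rightarrow> 'a::euclidean_space) \<Rightarrow> real^2 \<Rightarrow> 'a" where
  "l2_proj n U f =
     (THE p. p \<in> polys n \<and> (\<forall>q\<in>polys n. l2_inner U (\<lambda>x. f x - p x) q = 0))"

definition const_projection :: "(real^2) set \<Rightarrow> ((real^2 \<Rightarrow> real^2) \<Rightarrow> real^2) \<Rightarrow> bool" where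
  "const_projection U P0 \<longleftrightarrow>
     (\<forall>u\<in>H1 U. \<forall>v\<in>H1 U. \<forall>a b. P0 (\<lambda>x. a *\<^sub>R u x + b *\<^sub>R v x) = a *\<^sub>R P0 u + b *\<^sub>R P0 v) \<and>
     (\<forall>c. P0 (\<lambda>x. c) = c) \<and>
     (\<forall>u\<in>H1 U. \<forall>v\<in>H1 U. (AE x in lebesgue_on U. u x = v x) \<longrightarrow> P0 u = P0 v)"

definition grad_proj ::
  "nat \<Rightarrow> (real^2) set \<Rightarrow> ((real^2 \<Rightarrow> real^2) \<Rightarrow> real^2) \<Rightarrow> (real^2 \<Rightarrow> real^2) \<Rightarrow> real^2 \<Rightarrow> real^2" where
  "grad_proj k U P0 v =
     (THE p. p \<in> polys k \<and>
        (\<forall>q\<in>polys k. l2_inner U (\<lambda>x. jacobian q (at x)) (weak_grad U (\<lambda>x. v x - p x)) = 0) \<and>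
        P0 (\<lambda>x. v x - p x) = 0)"


section \<open>The virtual element space\<close>

definition perp :: "real^2 \<Rightarrow> real^2" where
  "perp x = vector [x $ 2, - (x $ 1)]"

definition barycenter :: "(real^2) set \<Rightarrow> real^2" where
  "barycenter U = (1 / measure lebesgue U) *\<^sub>R (\<integral>x. x \<partial>(lebesgue_on U))"

definition scaled_monomial :: "element \<Rightarrow> nat \<Rightarrow> nat \<Rightarrow> real^2 \<Rightarrow> real" where
  "scaled_monomial P i j x =
     (let y = (1 / elem_diam P) *\<^sub>R (x - barycenter (region P)) in y $ 1 ^ i * y $ 2 ^ j)"

definition hat_polys :: "nat \<Rightarrow> element \<Rightarrow> (real^2 \<Rightarrow> real) set" where
  "hat_polys k P =
     {p. \<exists>c. p = (\<lambda>x. \<Sum>(i, j)\<in>{(i, j). i + j = k - 2 \<or> i + j = k - 1}. c i j * scaled_monomial P i j x)}"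

text \<open>
  A continuous function \<open>g\<close> on the boundary is the trace of \<open>v \<in> H\<^sup>1\<close> if functions that are smooth up
  to the boundary converge to \<open>v\<close> in \<open>H\<^sup>1\<close> while their restrictions converge to \<open>g\<close> in \<open>L\<^sup>2\<close> of the
  boundary.
\<close>

definition has_continuous_trace :: "element \<Rightarrow> (real^2 \<Rightarrow> real^2) \<Rightarrow> (real^2 \<Rightarrow> real^2) \<Rightarrow> bool" where
  "has_continuous_trace P v g \<longleftrightarrow>
     continuous_on (edge_union P) g \<and>
     (\<exists>\<phi>. (\<forall>n. smooth (\<phi> n)) \<and> H1_converges (region P) \<phi> v \<and>
        (\<lambda>n. \<Sum>(a, b)\<in>edges P. edge_integral a b (\<lambda>x. (norm (\<phi> n x - g x))\<^sup>2)) \<longlonglongrightarrow> 0)"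

text \<open>
  \<open>\<Delta>v + \<nabla>s \<in> x\<^sup>\<bottom> \<bbbP>\<^sub>k\<^sub>-\<^sub>1\<close> in the sense of distributions, for some \<open>s\<close> in \<open>L\<^sup>2\<close> with mean zero.
\<close>

definition stokes_condition :: "nat \<Rightarrow> (real^2) set \<Rightarrow> (real^2 \<Rightarrow> real^2) \<Rightarrow> bool" where
  "stokes_condition k U v \<longleftrightarrow>
     (\<exists>s p. square_integrable U s \<and> (\<integral>x. s x \<partial>(lebesgue_on U)) = 0 \<and> p \<in> polys (k - 1) \<and>
        (\<forall>\<phi>. test_function U \<phi> \<longrightarrow>
           - l2_inner U (weak_grad U v) (\<lambda>x. jacobian \<phi> (at x))
             - l2_inner U s (\<lambda>x. trace (jacobian \<phi> (at x)))
           = l2_inner U (\<lambda>x. p x *\<^sub>R perp x) \<phi>))"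

definition Vloc ::
  "nat \<Rightarrow> (element \<Rightarrow> (real^2 \<Rightarrow> real^2) \<Rightarrow> real^2) \<Rightarrow> element \<Rightarrow> (real^2 \<Rightarrow> real^2) set" where
  "Vloc k P0 P =
     {v. v \<in> H1 (region P) \<and>
         stokes_condition k (region P) v \<and>
         (\<exists>p\<in>polys (k - 1). AE x in lebesgue_on (region P). trace (weak_grad (region P) v x) = p x) \<and>
         (\<exists>g. has_continuous_trace P v g \<and>
              (\<forall>(a, b)\<in>edges P. \<exists>p\<in>polys k. \<forall>x\<in>closed_segment a b. g x = p x)) \<and>
         (\<forall>p\<in>hat_polys k P.
              l2_inner (region P) (\<lambda>x. v x - grad_proj k (region P) (P0 P) v x) (\<lambda>x. p x *\<^sub>R perp x) = 0)}"

definition Vh ::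
  "nat \<Rightarrow> (element \<Rightarrow> (real^2 \<Rightarrow> real^2) \<Rightarrow> real^2) \<Rightarrow> (real^2) set \<Rightarrow> element set
     \<Rightarrow> (real^2 \<Rightarrow> real^2) set" where
  "Vh k P0 \<Omega> M = {v. v \<in> H10 \<Omega> \<and> (\<forall>P\<in>M. v \<in> Vloc k P0 P)}"


section \<open>Discrete forms\<close>

definition residual :: "nat \<Rightarrow> element \<Rightarrow> (real^2 \<Rightarrow> real^2) \<Rightarrow> real^2 \<Rightarrow> real^2" where
  "residual k P v = (\<lambda>x. v x - l2_proj k (region P) v x)"

type_synonym local_form = "(real^2 \<Rightarrow> real^2) \<Rightarrow> (real^2 \<Rightarrow> real^2) \<Rightarrow> real"

text \<open>
  The almost-everywhere clause says that \<open>S\<close> is defined on elements of the Sobolev space, not on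
  individual representatives.
\<close>

definition stabilization ::
  "nat \<Rightarrow> (element \<Rightarrow> (real^2 \<Rightarrow> real^2) \<Rightarrow> real^2) \<Rightarrow> real \<Rightarrow> real \<Rightarrow> element \<Rightarrow> local_form \<Rightarrow> bool" where
  "stabilization k P0 alo ahi P S \<longleftrightarrow>
     (\<forall>u\<in>Vloc k P0 P. \<forall>v\<in>Vloc k P0 P. S u v = S v u) \<and>
     (\<forall>u\<in>Vloc k P0 P. \<forall>v\<in>Vloc k P0 P. \<forall>w\<in>Vloc k P0 P. \<forall>a b.
        S (\<lambda>x. a *\<^sub>R u x + b *\<^sub>R v x) w = a * S u w + b * S v w) \<and>
     (\<forall>u\<in>Vloc k P0 P. \<forall>v\<in>Vloc k P0 P. \<forall>w\<in>Vloc k P0 P.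
        (AE x in lebesgue_on (region P). u x = v x) \<longrightarrow> S u w = S v w) \<and>
     (\<forall>v\<in>Vloc k P0 P. l2_proj k (region P) v = (\<lambda>x. 0) \<longrightarrow>
        alo * (l2_norm (region P) (weak_grad (region P) v))\<^sup>2 \<le> S v v \<and>
        S v v \<le> ahi * (l2_norm (region P) (weak_grad (region P) v))\<^sup>2)"

definition sym_grad :: "(real^2) set \<Rightarrow> (real^2 \<Rightarrow> real^2) \<Rightarrow> real^2 \<Rightarrow> real^2^2" where
  "sym_grad U u x = (1 / 2) *\<^sub>R (weak_grad U u x + Finite_Cartesian_Product.transpose (weak_grad U u x))"

definition A_loc :: "nat \<Rightarrow> real \<Rightarrow> real \<Rightarrow> (element \<Rightarrow> local_form) \<Rightarrow> element \<Rightarrow> local_form" where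
  "A_loc k \<nu> \<sigma> S P u v =
     \<nu> * l2_inner (region P) (l2_proj (k - 1) (region P) (sym_grad (region P) u))
                            (l2_proj (k - 1) (region P) (sym_grad (region P) v)) +
     \<sigma> * l2_inner (region P) (l2_proj k (region P) u) (l2_proj k (region P) v) +
     (\<nu> + \<sigma> * (elem_diam P)\<^sup>2) * S P (residual k P u) (residual k P v)"

definition c_loc :: "nat \<Rightarrow> (real^2 \<Rightarrow> real^2) \<Rightarrow> element \<Rightarrow> local_form" where
  "c_loc k \<beta> P u v =
     l2_inner (region P) (\<lambda>x. l2_proj k (region P) (weak_grad (region P) u) x *v \<beta> x)
                         (l2_proj k (region P) v)"

definition c_skew_loc :: "nat \<Rightarrow> (real^2 \<Rightarrow> real^2) \<Rightarrow> element \<Rightarrow> local_form" where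
  "c_skew_loc k \<beta> P u v = (c_loc k \<beta> P u v - c_loc k \<beta> P v u) / 2"

text \<open>
  Jump at \<open>x \<in> \<partial>P\<close> of the piecewise function equal to \<open>w Q\<close> on each element \<open>Q\<close>. The element across is
  unique for all but finitely many points of \<open>\<partial>P\<close> off the domain boundary; on an interior edge
  contained in \<open>\<partial>P \<inter> \<partial>K\<close> it is \<open>K\<close>. Below, \<open>w Q\<close> is an expression that makes sense in a neighbourhood
  of every such point, so evaluating it at \<open>x\<close> gives the one-sided limit from \<open>Q\<close>.
\<close>

definition jump ::
  "element set \<Rightarrow> element \<Rightarrow> (element \<Rightarrow> real^2 \<Rightarrow> 'a::ab_group_add) \<Rightarrow> real^2 \<Rightarrow> 'a" where
  "jump M P w x = w P x - w (THE Q. Q \<in> M \<and> Q \<noteq> P \<and> x \<in> edge_union Q) x"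

text \<open>Integral over \<open>\<partial>P\<close> without \<open>\<Gamma>\<close>; the first argument of the integrand is the unit tangent of the edge.\<close>

definition interior_bdry_integral ::
  "(real^2) set \<Rightarrow> element \<Rightarrow> (real^2 \<Rightarrow> real^2 \<Rightarrow> real) \<Rightarrow> real" where
  "interior_bdry_integral \<Gamma> P f =
     (\<Sum>(a, b)\<in>edges P. edge_integral a b (\<lambda>x. indicator (- \<Gamma>) x * f (sgn (b - a)) x))"

definition curl2 :: "(real^2 \<Rightarrow> real^2) \<Rightarrow> real^2 \<Rightarrow> real" where
  "curl2 w x = partial_deriv 1 (\<lambda>y. w y $ 2) x - partial_deriv 2 (\<lambda>y. w y $ 1) x"

definition scalar_grad :: "(real^2 \<Rightarrow> real) \<Rightarrow> real^2 \<Rightarrow> real^2" where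
  "scalar_grad f x = (\<chi> j. partial_deriv j f x)"

definition advect :: "nat \<Rightarrow> (real^2 \<Rightarrow> real^2) \<Rightarrow> (real^2 \<Rightarrow> real^2) \<Rightarrow> element \<Rightarrow> real^2 \<Rightarrow> real^2" where
  "advect k \<beta> u Q = (\<lambda>x. jacobian (l2_proj k (region Q) u) (at x) *v \<beta> x)"

definition curl_advect :: "nat \<Rightarrow> (real^2 \<Rightarrow> real^2) \<Rightarrow> (real^2 \<Rightarrow> real^2) \<Rightarrow> element \<Rightarrow> real^2 \<Rightarrow> real" where
  "curl_advect k \<beta> u Q = curl2 (advect k \<beta> u Q)"

definition J1_loc ::
  "nat \<Rightarrow> (real^2) set \<Rightarrow> element set \<Rightarrow> (real^2 \<Rightarrow> real^2) \<Rightarrow> element \<Rightarrow> local_form" where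
  "J1_loc k \<Omega> M \<beta> P u v =
     (1 / 2) * interior_bdry_integral (frontier \<Omega>) P (\<lambda>t x. (elem_diam P) ^ 2 *
        (jump M P (\<lambda>Q y. advect k \<beta> u Q y \<bullet> t) x * jump M P (\<lambda>Q y. advect k \<beta> v Q y \<bullet> t) x))"

definition J2_loc ::
  "nat \<Rightarrow> (real^2) set \<Rightarrow> element set \<Rightarrow> (real^2 \<Rightarrow> real^2) \<Rightarrow> element \<Rightarrow> local_form" where
  "J2_loc k \<Omega> M \<beta> P u v =
     (1 / 2) * interior_bdry_integral (frontier \<Omega>) P (\<lambda>t x. (elem_diam P) ^ 4 *
        (jump M P (curl_advect k \<beta> u) x * jump M P (curl_advect k \<beta> v) x))"

definition J3_loc ::
  "nat \<Rightarrow> (real^2) set \<Rightarrow> element set \<Rightarrow> (real^2 \<Rightarrow> real^2) \<Rightarrow> element \<Rightarrow> local_form" where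
  "J3_loc k \<Omega> M \<beta> P u v =
     (1 / 2) * interior_bdry_integral (frontier \<Omega>) P (\<lambda>t x. (elem_diam P) ^ 6 *
        (jump M P (\<lambda>Q. scalar_grad (curl_advect k \<beta> u Q)) x \<bullet>
         jump M P (\<lambda>Q. scalar_grad (curl_advect k \<beta> v Q)) x))"

definition J_loc ::
  "nat \<Rightarrow> (real^2) set \<Rightarrow> element set \<Rightarrow> (real^2 \<Rightarrow> real^2) \<Rightarrow> real \<Rightarrow> real \<Rightarrow> real
     \<Rightarrow> (element \<Rightarrow> local_form) \<Rightarrow> element \<Rightarrow> local_form" where
  "J_loc k \<Omega> M \<beta> \<delta>1 \<delta>2 \<delta>3 S P u v =
     \<delta>1 * J1_loc k \<Omega> M \<beta> P u v + \<delta>2 * J2_loc k \<Omega> M \<beta> P u v + \<delta>3 * J3_loc k \<Omega> M \<beta> P u v +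
     Max {\<delta>1, \<delta>2, \<delta>3} * elem_diam P * S P (residual k P u) (residual k P v)"

definition Kh ::
  "nat \<Rightarrow> (real^2) set \<Rightarrow> element set \<Rightarrow> real \<Rightarrow> real \<Rightarrow> (real^2 \<Rightarrow> real^2) \<Rightarrow> real \<Rightarrow> real \<Rightarrow> real
     \<Rightarrow> (element \<Rightarrow> local_form) \<Rightarrow> local_form" where
  "Kh k \<Omega> M \<nu> \<sigma> \<beta> \<delta>1 \<delta>2 \<delta>3 S u v =
     (\<Sum>P\<in>M. A_loc k \<nu> \<sigma> S P u v + c_skew_loc k \<beta> P u v + J_loc k \<Omega> M \<beta> \<delta>1 \<delta>2 \<delta>3 S P u v)"

definition K_norm ::
  "nat \<Rightarrow> (real^2) set \<Rightarrow> element set \<Rightarrow> real \<Rightarrow> real \<Rightarrow> (real^2 \<Rightarrow> real^2) \<Rightarrow> real \<Rightarrow> real \<Rightarrow> real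
     \<Rightarrow> (element \<Rightarrow> local_form) \<Rightarrow> (real^2 \<Rightarrow> real^2) \<Rightarrow> real" where
  "K_norm k \<Omega> M \<nu> \<sigma> \<beta> \<delta>1 \<delta>2 \<delta>3 S v =
     sqrt (\<Sum>P\<in>M. \<nu> * (l2_norm (region P) (weak_grad (region P) v))\<^sup>2 +
                  \<sigma> * (l2_norm (region P) v)\<^sup>2 + J_loc k \<Omega> M \<beta> \<delta>1 \<delta>2 \<delta>3 S P v v)"

end

theory Submission
  imports Defs
begin

text \<open>
  On the diagonal the skew-symmetric form vanishes, and the jump form is nonnegative and occurs on both sides.
  What remains is to bound \<open>\<nu> \<parallel>\<nabla>v\<parallel>\<^sup>2 + \<sigma> \<parallel>v\<parallel>\<^sup>2\<close> by the sum of the local forms \<open>A\<close>, which contain only projections of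
  \<open>v\<close> and of its strain \<open>\<epsilon>(v)\<close>. The residual \<open>v\<^sup>o = v - \<Pi>\<^sub>k v\<close> has to be recovered from the stabilization, by
  \<open>alo \<parallel>\<nabla>v\<^sup>o\<parallel>\<^sup>2 \<le> S(v\<^sup>o, v\<^sup>o)\<close>.

  For the viscous term, Korn's inequality on the whole domain (\<open>korn_H10\<close>) replaces \<open>\<nabla>v\<close> by \<open>\<epsilon>(v)\<close>; it holds with an
  absolute constant because \<open>v\<close> vanishes on the boundary. On each element \<open>\<epsilon>(\<Pi>\<^sub>k v)\<close> is a polynomial of degree
  \<open>k - 1\<close>, so the best approximation property of the projection bounds the part of \<open>\<epsilon>(v)\<close> that the form does not
  see by \<open>\<parallel>\<nabla>v\<^sup>o\<parallel>\<close> (\<open>strain_projection_estimate\<close>). For the mass term, \<open>\<parallel>v\<parallel>\<^sup>2 = \<parallel>\<Pi>\<^sub>k v\<parallel>\<^sup>2 + \<parallel>v\<^sup>o\<parallel>\<^sup>2\<close>, and since \<open>v\<^sup>o\<close> has mean zero, a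
  Poincare inequality gives \<open>\<parallel>v\<^sup>o\<parallel>\<^sup>2 \<le> (16 / \<rho>\<^sup>2) h\<^sup>2 \<parallel>\<nabla>v\<^sup>o\<parallel>\<^sup>2\<close> (\<open>poincare_mean_zero\<close>). The constant depends on the shape of the
  element only through \<open>\<rho>\<close>, because the proof integrates along the segments that join a point of the element with a
  point of the ball. This is where the mesh assumption enters, and the factor \<open>h\<^sup>2\<close> is
  the one in front of the stabilization. Altogether \<open>C = 8 + 8/alo + 16/(\<rho>\<^sup>2 alo)\<close> works.

  The stabilization is coercive on the local virtual element space only, so \<open>v\<^sup>o\<close> has to belong to it
  (\<open>residual_in_Vloc\<close>): the space is closed under subtraction and contains the polynomials of degree \<open>k\<close>. For the
  Stokes condition this rests on the decomposition of polynomial vector fields into a gradient and a multiple of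
  \<open>x\<^sup>\<bottom>\<close> (\<open>polys_perp_decomposition\<close>).

  The analytic foundation is proved along the way. Weak gradients are selected by choice, and their uniqueness
  is the fundamental lemma of the calculus of variations (\<open>fundamental_lemma\<close>). Korn's and Poincare's inequalities are first
  shown for smooth functions, and the definitions of \<open>H\<^sup>1\<^sub>0\<close> and of traces supply the smooth approximations.
  That the projections are well defined requires every element to have an interior, which is the Jordan-Brouwer
  separation theorem (\<open>simple_polygon_region_nonempty\<close>).
\<close>

section \<open>Smooth functions on the plane\<close>

lemma partial_deriv_eq: "(f has_derivative f') (at x) \<Longrightarrow> partial_deriv j f x = f' (axis j 1)"
  unfolding partial_deriv_def using frechet_derivative_at by metis

lemma C_diff_differentiable: "C_diff (Suc m) f \<Longrightarrow> f differentiable (at x)"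
  by (simp add: differentiable_on_def)

lemma C_diff_has_derivative: "C_diff (Suc m) f \<Longrightarrow> (f has_derivative frechet_derivative f (at x)) (at x)"
  using C_diff_differentiable frechet_derivative_works by blast

lemma C_diff_partial: "C_diff (Suc m) f \<Longrightarrow> C_diff m (partial_deriv j f)"
  by simp

lemma C_diff_decrease: "C_diff (Suc m) f \<Longrightarrow> C_diff m f"
proof (induction m arbitrary: f)
  case 0
  then show ?case by (simp add: differentiable_imp_continuous_on)
next
  case (Suc m)
  have "f differentiable_on UNIV" using Suc.prems by simp
  moreover have "C_diff m (partial_deriv j f)" for j
    using Suc.IH[OF C_diff_partial[OF Suc.prems]] .
  ultimately show ?case by simp
qed

lemma C_diff_continuous: "C_diff m f \<Longrightarrow> continuous_on S f"
proof (induction m)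
  case 0
  then show ?case using continuous_on_subset by auto
next
  case (Suc m)
  then show ?case using C_diff_decrease by blast
qed

lemma C_diff_add: "C_diff m f \<Longrightarrow> C_diff m g \<Longrightarrow> C_diff m (\<lambda>x. f x + g x)"
proof (induction m arbitrary: f g)
  case 0
  then show ?case by (simp add: continuous_on_add)
next
  case (Suc m)
  have "partial_deriv j (\<lambda>x. f x + g x) = (\<lambda>x. partial_deriv j f x + partial_deriv j g x)" for j
    by (rule ext, subst partial_deriv_eq[OF has_derivative_add[OF C_diff_has_derivative[OF Suc.prems(1)]
              C_diff_has_derivative[OF Suc.prems(2)]]]) (simp add: partial_deriv_def)
  moreover have "C_diff m (\<lambda>x. partial_deriv j f x + partial_deriv j g x)" for j
    by (intro Suc.IH C_diff_partial[OF Suc.prems(1)] C_diff_partial[OF Suc.prems(2)])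
  moreover have "(\<lambda>x. f x + g x) differentiable_on UNIV"
    using Suc.prems by (simp add: differentiable_on_add)
  ultimately show ?case by simp
qed

lemma C_diff_bounded_linear:
  assumes "bounded_linear L"
  shows "C_diff m f \<Longrightarrow> C_diff m (\<lambda>x. L (f x))"
proof (induction m arbitrary: f)
  case 0
  then show ?case using assms by (simp add: bounded_linear.continuous_on)
next
  case (Suc m)
  have d: "((\<lambda>x. L (f x)) has_derivative (\<lambda>h. L (frechet_derivative f (at x) h))) (at x)" for x
    using bounded_linear.has_derivative[OF assms C_diff_has_derivative[OF Suc.prems]] .
  have "partial_deriv j (\<lambda>x. L (f x)) = (\<lambda>x. L (partial_deriv j f x))" for j
    by (rule ext, subst partial_deriv_eq[OF d]) (simp add: partial_deriv_def)
  moreover have "(\<lambda>x. L (f x)) differentiable_on UNIV"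
    using d differentiableI by (auto simp: differentiable_on_def)
  moreover have "C_diff m (\<lambda>x. L (partial_deriv j f x))" for j
    by (intro Suc.IH C_diff_partial[OF Suc.prems])
  ultimately show ?case by simp
qed

lemma partial_deriv_scaleR:
  fixes f :: "real^2 \<Rightarrow> real"
  assumes "f differentiable at x" "g differentiable at x"
  shows "partial_deriv j (\<lambda>x. f x *\<^sub>R g x) x = partial_deriv j f x *\<^sub>R g x + f x *\<^sub>R partial_deriv j g x"
proof -
  have "((\<lambda>x. f x *\<^sub>R g x) has_derivative (\<lambda>h. f x *\<^sub>R frechet_derivative g (at x) h + frechet_derivative f (at x) h *\<^sub>R g x)) (at x)"
    using assms by (intro has_derivative_scaleR) (simp_all add: frechet_derivative_works)
  from partial_deriv_eq[OF this, of j] show ?thesis by (simp add: partial_deriv_def)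
qed

lemma C_diff_scaleR:
  fixes f :: "real^2 \<Rightarrow> real"
  shows "C_diff m f \<Longrightarrow> C_diff m g \<Longrightarrow> C_diff m (\<lambda>x. f x *\<^sub>R g x)"
proof (induction m arbitrary: f g)
  case 0
  then show ?case by (simp add: continuous_on_scaleR)
next
  case (Suc m)
  have "partial_deriv j (\<lambda>x. f x *\<^sub>R g x) = (\<lambda>x. partial_deriv j f x *\<^sub>R g x + f x *\<^sub>R partial_deriv j g x)" for j
    by (rule ext, rule partial_deriv_scaleR[OF C_diff_differentiable[OF Suc.prems(1)] C_diff_differentiable[OF Suc.prems(2)]])
  moreover have "C_diff m (\<lambda>x. partial_deriv j f x *\<^sub>R g x + f x *\<^sub>R partial_deriv j g x)" for j
    by (intro C_diff_add Suc.IH C_diff_partial[OF Suc.prems(1)] C_diff_partial[OF Suc.prems(2)]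
        C_diff_decrease[OF Suc.prems(1)] C_diff_decrease[OF Suc.prems(2)])
  moreover have "(\<lambda>x. f x *\<^sub>R g x) differentiable_on UNIV"
    using Suc.prems by (simp add: differentiable_on_scaleR)
  ultimately show ?case by simp
qed

lemma C_diff_const: "C_diff m (\<lambda>x. c)"
proof (induction m arbitrary: c)
  case (Suc m)
  have "partial_deriv j (\<lambda>x. c) = (\<lambda>x. 0)" for j
    by (rule ext, subst partial_deriv_eq[OF has_derivative_const]) simp
  with Suc.IH show ?case by simp
qed simp

lemma partial_deriv_component:
  assumes "(f has_real_derivative f') (at (x $ i))"
  shows "partial_deriv j (\<lambda>x. f (x $ i)) x = f' * axis j 1 $ i"
proof -
  have "((\<lambda>x. f (x $ i)) has_derivative (\<lambda>h. f' * (h $ i))) (at x)"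
    using has_derivative_compose[OF bounded_linear_imp_has_derivative[OF bounded_linear_vec_nth]
        assms[unfolded has_field_derivative_def]] .
  from partial_deriv_eq[OF this] show ?thesis .
qed

lemma C_diff_component:
  assumes "\<And>n x. (F n has_real_derivative F (Suc n) x) (at x)"
  shows "C_diff m (\<lambda>x. F n (x $ i))"
proof (induction m arbitrary: n)
  case 0
  have "continuous_on UNIV (F n)"
    by (intro continuous_at_imp_continuous_on ballI DERIV_isCont[OF assms])
  then have "continuous_on UNIV (\<lambda>x::real^2. F n (x $ i))"
    by (rule continuous_on_compose2) (auto intro!: continuous_intros)
  then show ?case by simp
next
  case (Suc m)
  have "partial_deriv j (\<lambda>x. F n (x $ i)) = (\<lambda>x. (axis j 1 $ i) *\<^sub>R F (Suc n) (x $ i))" for j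
    by (rule ext, subst partial_deriv_component[OF assms]) simp
  moreover have "C_diff m (\<lambda>x. (axis j 1 $ i) *\<^sub>R F (Suc n) (x $ i))" for j
    by (rule C_diff_bounded_linear[OF bounded_linear_scaleR_right Suc.IH])
  moreover have "(\<lambda>x. F n (x $ i)) differentiable_on UNIV"
  proof (clarsimp simp: differentiable_on_def)
    fix x :: "real^2"
    show "(\<lambda>x. F n (x $ i)) differentiable at x"
      using has_derivative_compose[OF bounded_linear_imp_has_derivative[OF bounded_linear_vec_nth]
          assms[of n, unfolded has_field_derivative_def]] by (rule differentiableI)
  qed
  ultimately show ?case by simp
qed

lemma smooth_C_diff: "smooth f \<Longrightarrow> C_diff m f"
  by (simp add: smooth_def)

lemma smooth_differentiable: "smooth f \<Longrightarrow> f differentiable (at x)"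
  using C_diff_differentiable smooth_C_diff by blast

lemma smooth_partial: "smooth f \<Longrightarrow> smooth (partial_deriv j f)"
  unfolding smooth_def by (blast intro: C_diff_partial)

lemma smooth_const [intro]: "smooth (\<lambda>x. c)"
  by (auto simp: smooth_def C_diff_const)

lemma smooth_add [intro]: "smooth f \<Longrightarrow> smooth g \<Longrightarrow> smooth (\<lambda>x. f x + g x)"
  by (auto simp: smooth_def C_diff_add)

lemma smooth_scaleR [intro]:
  fixes f :: "real^2 \<Rightarrow> real"
  shows "smooth f \<Longrightarrow> smooth g \<Longrightarrow> smooth (\<lambda>x. f x *\<^sub>R g x)"
  by (auto simp: smooth_def C_diff_scaleR)

lemma smooth_mult [intro]:
  fixes f :: "real^2 \<Rightarrow> real"
  shows "smooth f \<Longrightarrow> smooth g \<Longrightarrow> smooth (\<lambda>x. f x * g x)"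
  using smooth_scaleR[of f g] by simp

lemma smooth_bounded_linear: "bounded_linear L \<Longrightarrow> smooth f \<Longrightarrow> smooth (\<lambda>x. L (f x))"
  by (auto simp: smooth_def C_diff_bounded_linear)

lemma smooth_diff [intro]: "smooth f \<Longrightarrow> smooth g \<Longrightarrow> smooth (\<lambda>x. f x - g x)"
  using smooth_add[of f "\<lambda>x. - g x"] smooth_bounded_linear[OF bounded_linear_minus[OF bounded_linear_ident], of g]
  by simp

lemma smooth_sum [intro]: "(\<And>i. i \<in> I \<Longrightarrow> smooth (f i)) \<Longrightarrow> smooth (\<lambda>x. \<Sum>i\<in>I. f i x)"
  by (induction I rule: infinite_finite_induct) auto

lemma smooth_nth [intro]: "smooth (\<lambda>x::real^2. x $ i)"
proof -
  define F :: "nat \<Rightarrow> real \<Rightarrow> real" where "F n x = (if n = 0 then x else if n = 1 then 1 else 0)" for n x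
  have "(F n has_real_derivative F (Suc n) x) (at x)" for n x
    unfolding F_def by (cases "n = 0"; cases "n = 1") (auto intro!: derivative_eq_intros)
  from C_diff_component[of F, OF this, of _ 0 i] show ?thesis
    by (simp add: smooth_def F_def)
qed

lemma smooth_power [intro]:
  fixes f :: "real^2 \<Rightarrow> real"
  shows "smooth f \<Longrightarrow> smooth (\<lambda>x. f x ^ n)"
  by (induction n) auto

lemma smooth_continuous_on: "smooth f \<Longrightarrow> continuous_on S f"
  using C_diff_continuous smooth_C_diff by blast

section \<open>Bump functions\<close>

text \<open>
  The functions \<open>p(1/x) exp(-1/x)\<close> on the positive half-line, extended by zero. The family is closed
  under differentiation, so \<open>exp(-1/x)\<close>, which is the case \<open>p = 1\<close>, is infinitely differentiable.
\<close>

definition exp_recip :: "real poly \<Rightarrow> real \<Rightarrow> real" where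
  "exp_recip p x = (if x > 0 then poly p (inverse x) * exp (- inverse x) else 0)"

lemma poly_exp_tendsto_0: "((\<lambda>x::real. poly p x * exp (- x)) \<longlongrightarrow> 0) at_top"
proof -
  have "((\<lambda>x. \<Sum>i\<le>degree p. coeff p i * (x ^ i / exp x)) \<longlongrightarrow> (\<Sum>i\<le>degree p. coeff p i * 0)) at_top"
    by (intro tendsto_intros tendsto_power_div_exp_0)
  then show ?thesis
    by (simp add: poly_altdef sum_distrib_right exp_minus divide_inverse mult.assoc)
qed

lemma exp_recip_tendsto_0: "(exp_recip p \<longlongrightarrow> 0) (at 0)"
proof -
  have "((\<lambda>x. poly p (inverse x) * exp (- inverse x)) \<longlongrightarrow> 0) (at_right 0)"
    using filterlim_compose[OF poly_exp_tendsto_0 filterlim_inverse_at_top_right] .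
  moreover have "\<forall>\<^sub>F x in at_right 0. poly p (inverse x) * exp (- inverse x) = exp_recip p x"
    by (auto simp: exp_recip_def eventually_at intro!: exI[of _ 1])
  ultimately have r: "(exp_recip p \<longlongrightarrow> 0) (at_right 0)"
    using tendsto_cong by force
  have "\<forall>\<^sub>F x in at_left 0. exp_recip p x = 0"
    by (auto simp: exp_recip_def eventually_at intro!: exI[of _ 1])
  then have l: "(exp_recip p \<longlongrightarrow> 0) (at_left 0)"
    using tendsto_eventually by blast
  show ?thesis using l r filterlim_split_at by blast
qed

text \<open>
  For positive \<open>x\<close> the derivative is \<open>(p - p')(1/x) / x\<^sup>2 exp(-1/x)\<close>. At the origin the difference
  quotient of \<open>exp_recip p\<close> is again a member of the family, with \<open>x p\<close> in place of \<open>p\<close>, and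
  exponential decay beats every polynomial.
\<close>

lemma exp_recip_deriv:
  "(exp_recip p has_real_derivative exp_recip ([:0,0,1:] * (p - pderiv p)) x) (at x)"
proof -
  consider "x > 0" | "x < 0" | "x = 0" by linarith
  then show ?thesis
  proof cases
    case 1
    have i: "(inverse has_real_derivative - (inverse x)\<^sup>2) (at x)"
      using DERIV_inverse[of x] 1 by (simp add: power2_eq_square)
    have e: "((\<lambda>x. exp (- inverse x)) has_real_derivative exp (- inverse x) * (- (- (inverse x)\<^sup>2))) (at x)"
      by (rule DERIV_chain2[OF DERIV_exp DERIV_minus[OF i]])
    have "((\<lambda>x. poly p (inverse x) * exp (- inverse x)) has_real_derivative
        exp_recip ([:0,0,1:] * (p - pderiv p)) x) (at x)"
      using DERIV_mult[OF DERIV_chain2[OF poly_DERIV i] e, of p] 1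
      by (simp add: exp_recip_def algebra_simps power2_eq_square)
    moreover have "\<forall>\<^sub>F y in nhds x. poly p (inverse y) * exp (- inverse y) = exp_recip p y"
      using eventually_nhds_in_open[of "{0<..}" x] 1
      by (auto elim!: eventually_mono simp: exp_recip_def)
    ultimately show ?thesis by (rule DERIV_cong_ev[OF refl _ refl, THEN iffD1, rotated])
  next
    case 2
    have "\<forall>\<^sub>F y in nhds x. 0 = exp_recip p y"
      using eventually_nhds_in_open[of "{..<0}" x] 2
      by (auto elim!: eventually_mono simp: exp_recip_def)
    then have "(exp_recip p has_real_derivative 0) (at x)"
      by (rule DERIV_cong_ev[OF refl _ refl, THEN iffD1]) simp
    then show ?thesis using 2 by (simp add: exp_recip_def)
  next
    case 3
    have "exp_recip ([:0,1:] * p) = (\<lambda>y. (exp_recip p (0 + y) - exp_recip p 0) / y)"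
      by (auto simp: exp_recip_def field_simps)
    note q = this
    have "(exp_recip p has_real_derivative 0) (at 0)"
      unfolding DERIV_def q[symmetric] by (rule exp_recip_tendsto_0)
    then show ?thesis using 3 by (simp add: exp_recip_def)
  qed
qed

definition bump :: "real \<Rightarrow> real" where "bump x = (if x > 0 then exp (- inverse x) else 0)"

lemma bump_0: "bump x = 0 \<longleftrightarrow> x \<le> 0" and bump_ge0: "bump x \<ge> 0" and bump_le1: "bump x \<le> 1"
  by (auto simp: bump_def)

lemma smooth_bump_component: "smooth (\<lambda>x. bump (c * x $ i + d))"
proof -
  define P :: "nat \<Rightarrow> real poly" where "P = rec_nat [:1:] (\<lambda>_ p. [:0,0,1:] * (p - pderiv p))"
  define F where "F n x = c ^ n * exp_recip (P n) (c * x + d)" for n x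
  have "(F n has_real_derivative F (Suc n) x) (at x)" for n x
  proof -
    have a: "((\<lambda>x. c * x + d) has_real_derivative c) (at x)"
      by (auto intro!: derivative_eq_intros)
    have "P (Suc n) = [:0,0,1:] * (P n - pderiv (P n))" by (simp add: P_def)
    then show ?thesis
      unfolding F_def using DERIV_cmult[OF DERIV_chain2[OF exp_recip_deriv[of "P n"] a], of "c^n"]
      by (simp add: ac_simps)
  qed
  from C_diff_component[of F, OF this, of _ 0 i] have "smooth (\<lambda>x. F 0 (x $ i))" by (simp add: smooth_def)
  then show ?thesis by (simp add: F_def P_def bump_def exp_recip_def cong: if_cong)
qed

text \<open>
  Smooth, between zero and one, positive exactly on the open box. The factor \<open>n + 1\<close> steepens the
  flanks: for \<open>n \<rightarrow> \<infinity>\<close> the functions tend to the indicator of the open box.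
\<close>

definition box_bump :: "real^2 \<Rightarrow> real^2 \<Rightarrow> nat \<Rightarrow> real^2 \<Rightarrow> real" where
  "box_bump a b n x = (\<Prod>i\<in>UNIV. bump (real (Suc n) * (x $ i - a $ i)) * bump (real (Suc n) * (b $ i - x $ i)))"

lemma box_bump_support: "{x. box_bump a b n x \<noteq> 0} = box a b"
  by (auto simp: box_bump_def bump_0 mem_box_cart zero_less_mult_iff not_le)

lemma smooth_box_bump: "smooth (box_bump a b n)"
proof -
  have 1: "smooth (\<lambda>x. bump (real (Suc n) * (x $ i - a $ i)) * bump (real (Suc n) * (b $ i - x $ i)))" for i
    using smooth_mult[OF smooth_bump_component[of "real (Suc n)" i "- (real (Suc n) * a $ i)"]
                     smooth_bump_component[of "- real (Suc n)" i "real (Suc n) * b $ i"]]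
    by (simp add: algebra_simps)
  show ?thesis unfolding box_bump_def[abs_def] UNIV_2 using smooth_mult[OF 1[of 1] 1[of 2]] by simp
qed

lemma box_bump_01: "0 \<le> box_bump a b n x \<and> box_bump a b n x \<le> 1"
  unfolding box_bump_def by (auto intro!: prod_nonneg prod_le_1 mult_le_one mult_nonneg_nonneg bump_ge0 bump_le1)

lemma bump_tendsto: "x > 0 \<Longrightarrow> (\<lambda>n. bump (real (Suc n) * x)) \<longlonglongrightarrow> 1"
proof -
  assume x: "x > 0"
  have "(\<lambda>n. exp (- (inverse x * inverse (real (Suc n))))) \<longlonglongrightarrow> exp (- (inverse x * 0))"
    by (intro tendsto_intros LIMSEQ_inverse_real_of_nat)
  then show ?thesis using x by (simp add: bump_def inverse_mult_distrib mult.commute del: of_nat_Suc)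
qed

lemma box_bump_tendsto: "(\<lambda>n. box_bump a b n x) \<longlonglongrightarrow> indicator (box a b) x"
proof (cases "x \<in> box a b")
  case True
  then have "(\<lambda>n. box_bump a b n x) \<longlonglongrightarrow> (\<Prod>i\<in>(UNIV::2 set). 1 * 1)"
    unfolding box_bump_def by (intro tendsto_intros bump_tendsto) (auto simp: mem_box_cart)
  then show ?thesis using True by simp
next
  case False
  then have "box_bump a b n x = 0" for n using box_bump_support[of a b n] by blast
  then show ?thesis using False by simp
qed

lemma test_function_box_bump: "cbox a b \<subseteq> U \<Longrightarrow> test_function U (box_bump a b n)"
proof -
  assume a: "cbox a b \<subseteq> U"
  have "closure (box a b) \<subseteq> cbox a b" by (rule closure_minimal[OF box_subset_cbox closed_cbox])
  then show ?thesis
    using a bounded_box bounded_closure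
    unfolding test_function_def box_bump_support by (auto simp: smooth_box_bump compact_eq_bounded_closed)
qed

section \<open>Integration by parts\<close>

lemma continuous_bounded_support:
  fixes f :: "'b::euclidean_space \<Rightarrow> 'a::euclidean_space"
  assumes "continuous_on UNIV f" "bounded {x. f x \<noteq> 0}"
  shows "integrable lborel f" and "\<exists>B. \<forall>x. norm (f x) \<le> B"
proof -
  obtain R where R: "\<And>x. f x \<noteq> 0 \<Longrightarrow> norm x \<le> R"
    using assms(2) by (auto simp: bounded_iff)
  have c: "compact (cball (0::'b) R)" and f: "continuous_on (cball 0 R) f"
    using assms(1) continuous_on_subset by auto
  have *: "f = (\<lambda>x. indicator (cball 0 R) x *\<^sub>R f x)"
    using R by (auto simp: fun_eq_iff indicator_def)
  show "integrable lborel f"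
    by (subst *) (rule borel_integrable_compact[OF c f])
  obtain B where B: "\<And>x. x \<in> cball 0 R \<Longrightarrow> norm (f x) \<le> B"
    using compact_imp_bounded[OF compact_continuous_image[OF f c]] unfolding bounded_iff by blast
  have "norm (f x) \<le> max B 0" for x
    using B[of x] R[of x] by (cases "f x = 0") auto
  then show "\<exists>B. \<forall>x. norm (f x) \<le> B" by blast
qed

lemma partial_deriv_support:
  assumes "closure {x. f x \<noteq> 0} \<subseteq> K" "x \<notin> K"
  shows "partial_deriv j f x = 0"
proof -
  let ?N = "- closure {x. f x \<noteq> 0}"
  have "x \<in> ?N" using assms by blast
  moreover have "0 = f y" if "y \<in> ?N" for y using that closure_subset by force
  ultimately have "(f has_derivative (\<lambda>h. 0)) (at x)"
    by (intro has_derivative_transform_within_open[OF has_derivative_const, of ?N x 0 f] open_Compl closed_closure)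
  then show ?thesis by (rule partial_deriv_eq)
qed

lemma bounded_partial_deriv_support:
  assumes "bounded {x. f x \<noteq> 0}"
  shows "bounded {x. partial_deriv j f x \<noteq> 0}"
  by (rule bounded_subset[OF bounded_closure[OF assms]]) (use partial_deriv_support[OF order_refl] in blast)

lemma has_derivative_along_line:
  assumes "C_diff (Suc m) f"
  shows "((\<lambda>s. f (x + s *\<^sub>R axis j 1)) has_derivative (\<lambda>h. h *\<^sub>R partial_deriv j f (x + s *\<^sub>R axis j 1))) (at s within S)"
proof -
  have 1: "((\<lambda>s. x + s *\<^sub>R axis j 1) has_derivative (\<lambda>h. h *\<^sub>R axis j 1)) (at s within S)"
    by (auto intro!: derivative_eq_intros)
  have "((\<lambda>s. f (x + s *\<^sub>R axis j 1)) has_derivative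
      (\<lambda>h. frechet_derivative f (at (x + s *\<^sub>R axis j 1)) (h *\<^sub>R axis j 1))) (at s within S)"
    by (rule has_derivative_compose[OF 1 C_diff_has_derivative[OF assms]])
  moreover have "frechet_derivative f (at (x + s *\<^sub>R axis j 1)) (h *\<^sub>R axis j 1) = h *\<^sub>R partial_deriv j f (x + s *\<^sub>R axis j 1)" for h
    using linear_frechet_derivative[OF C_diff_differentiable[OF assms]]
    by (simp add: partial_deriv_def linear_cmul)
  ultimately show ?thesis by simp
qed

definition diff_quotient :: "2 \<Rightarrow> real \<Rightarrow> (real^2 \<Rightarrow> 'a::real_vector) \<Rightarrow> real^2 \<Rightarrow> 'a" where
  "diff_quotient j t f x = (1 / t) *\<^sub>R (f (x + t *\<^sub>R axis j 1) - f x)"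

lemma diff_quotient_bound:
  assumes "C_diff (Suc m) f" "\<And>x. norm (partial_deriv j f x) \<le> B"
  shows "norm (diff_quotient j t f x) \<le> B"
proof (cases "t = 0")
  case True
  then show ?thesis using order_trans[OF norm_ge_zero assms(2)] by (simp add: diff_quotient_def)
next
  case False
  have "norm (f (x + t *\<^sub>R axis j 1) - f (x + 0 *\<^sub>R axis j 1)) \<le> B * norm (t - 0)"
  proof (rule differentiable_bound[OF convex_UNIV has_derivative_along_line[OF assms(1)]])
    show "onorm (\<lambda>h. h *\<^sub>R partial_deriv j f (x + s *\<^sub>R axis j 1)) \<le> B" for s
      by (intro onorm_le) (simp add: mult.commute[of B] mult_left_mono assms(2))
  qed auto
  then show ?thesis using False by (simp add: diff_quotient_def pos_divide_le_eq)
qed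

lemma diff_quotient_tendsto:
  assumes "C_diff (Suc m) f" "t \<longlonglongrightarrow> 0" "\<And>n. t n \<noteq> 0"
  shows "(\<lambda>n. diff_quotient j (t n) f x) \<longlonglongrightarrow> partial_deriv j f x"
proof -
  let ?g = "\<lambda>h. norm (f (x + h *\<^sub>R axis j 1) - f x - h *\<^sub>R partial_deriv j f x) / norm h"
  have "(?g \<longlongrightarrow> 0) (at 0)"
    using has_derivative_along_line[OF assms(1), of x j 0 UNIV] by (simp add: has_derivative_at)
  then have "(\<lambda>n. ?g (t n)) \<longlonglongrightarrow> 0"
    by (rule filterlim_compose) (use assms(2,3) in \<open>simp add: filterlim_at\<close>)
  moreover have "?g (t n) = norm (diff_quotient j (t n) f x - partial_deriv j f x)" for n
  proof -
    have "diff_quotient j (t n) f x - partial_deriv j f x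
        = (1 / t n) *\<^sub>R (f (x + t n *\<^sub>R axis j 1) - f x - t n *\<^sub>R partial_deriv j f x)"
      using assms(3)[of n] by (simp add: diff_quotient_def scaleR_diff_right)
    then show ?thesis by simp
  qed
  ultimately show ?thesis by (simp add: tendsto_norm_zero_iff LIM_zero_iff)
qed

lemma integral_lborel_translate:
  fixes f :: "real^2 \<Rightarrow> 'a::euclidean_space"
  assumes "f \<in> borel_measurable borel"
  shows "(\<integral>x. f (c + x) \<partial>lborel) = (\<integral>x. f x \<partial>lborel)"
proof -
  have "(\<integral>x. f x \<partial>lborel) = (\<integral>x. f x \<partial>(distr lborel borel ((+) c)))"
    by (simp add: lborel_distr_plus)
  also have "\<dots> = (\<integral>x. f (c + x) \<partial>lborel)"
    using assms by (subst integral_distr) auto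
  finally show ?thesis by simp
qed

text \<open>
  Dominated convergence: by the mean value theorem the difference quotients are bounded by the maximum of
  the partial derivative, and for steps of length at most one they are supported in a fixed ball. Integrals
  of derivatives can thus be treated through difference quotients, where integration by parts is
  translation invariance of Lebesgue measure.
\<close>

lemma integral_diff_quotient_tendsto:
  fixes f :: "real^2 \<Rightarrow> 'a::euclidean_space" and w :: "real^2 \<Rightarrow> real"
  assumes f: "C_diff 1 f" "bounded {x. f x \<noteq> 0}" and w: "continuous_on UNIV w"
    and t: "t \<longlonglongrightarrow> 0" "\<And>n. t n \<noteq> 0" "\<And>n. \<bar>t n\<bar> \<le> 1"
  shows "(\<lambda>n. \<integral>x. w x *\<^sub>R diff_quotient j (t n) f x \<partial>lborel) \<longlonglongrightarrow> (\<integral>x. w x *\<^sub>R partial_deriv j f x \<partial>lborel)"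
proof -
  have c0: "continuous_on UNIV f" and c1: "continuous_on UNIV (partial_deriv j f)"
    using f(1) C_diff_continuous C_diff_partial[of 0 f j] by (simp_all add: C_diff_continuous del: C_diff.simps)
  obtain B where B: "\<And>x. norm (partial_deriv j f x) \<le> B"
    using continuous_bounded_support(2)[OF c1 bounded_partial_deriv_support[OF f(2)]] by blast
  obtain R where R: "\<And>x. f x \<noteq> 0 \<Longrightarrow> norm x \<le> R"
    using f(2) by (auto simp: bounded_iff)
  let ?K = "cball (0::real^2) (R + 1)"
  show ?thesis
  proof (rule integral_dominated_convergence)
    show "integrable lborel (\<lambda>x. indicator ?K x *\<^sub>R (B * \<bar>w x\<bar>))"
      by (intro borel_integrable_compact continuous_intros continuous_on_subset[OF w]) auto
    show "(\<lambda>x. w x *\<^sub>R partial_deriv j f x) \<in> borel_measurable lborel"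
      using w c1 by (simp add: borel_measurable_continuous_onI continuous_on_scaleR)
    show "(\<lambda>x. w x *\<^sub>R diff_quotient j (t n) f x) \<in> borel_measurable lborel" for n
    proof -
      have "(\<lambda>x. w x *\<^sub>R diff_quotient j (t n) f x) \<in> borel_measurable borel"
        unfolding diff_quotient_def
        by (intro borel_measurable_continuous_onI continuous_intros w continuous_on_compose2[OF c0]) auto
      then show ?thesis by simp
    qed
    show "AE x in lborel. (\<lambda>n. w x *\<^sub>R diff_quotient j (t n) f x) \<longlonglongrightarrow> w x *\<^sub>R partial_deriv j f x"
      using diff_quotient_tendsto[of 0 f t j] f t by (intro AE_I2 tendsto_intros) simp
    show "AE x in lborel. norm (w x *\<^sub>R diff_quotient j (t n) f x) \<le> indicator ?K x *\<^sub>R (B * \<bar>w x\<bar>)" for n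
    proof (intro AE_I2)
      fix x :: "real^2"
      show "norm (w x *\<^sub>R diff_quotient j (t n) f x) \<le> indicator ?K x *\<^sub>R (B * \<bar>w x\<bar>)"
      proof (cases "x \<in> ?K")
        case True
        then show ?thesis
          using mult_left_mono[OF diff_quotient_bound[of 0 f j B "t n" x], of "\<bar>w x\<bar>"] f(1) B
          by (simp add: mult.commute)
      next
        case False
        have "norm x \<le> norm (x + t n *\<^sub>R axis j 1) + norm (t n *\<^sub>R axis j (1::real))"
          by (metis add_diff_cancel_right' norm_triangle_ineq4)
        moreover have "norm (t n *\<^sub>R axis j (1::real)) \<le> 1" using t(3) by simp
        ultimately have "f (x + t n *\<^sub>R axis j 1) = 0" "f x = 0"
          using False R[of x] R[of "x + t n *\<^sub>R axis j 1"] by auto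
        then show ?thesis by (simp add: diff_quotient_def indicator_simps(2)[OF False])
      qed
    qed
  qed
qed

lemma integral_partial_deriv_zero:
  fixes f :: "real^2 \<Rightarrow> 'a::euclidean_space"
  assumes f: "C_diff 1 f" "bounded {x. f x \<noteq> 0}"
  shows "(\<integral>x. partial_deriv j f x \<partial>lborel) = 0"
proof -
  let ?t = "\<lambda>n. inverse (real (Suc n))"
  have c0: "continuous_on UNIV f" using f(1) C_diff_continuous by blast
  have i: "integrable lborel f" using continuous_bounded_support(1)[OF c0 f(2)] .
  have z: "(\<integral>x. diff_quotient j t f x \<partial>lborel) = 0" for t
  proof -
    have m: "f \<in> borel_measurable borel" using c0 by (rule borel_measurable_continuous_onI)
    have "integrable lborel (\<lambda>x. f (x + t *\<^sub>R axis j 1))"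
    proof (rule continuous_bounded_support(1))
      show "continuous_on UNIV (\<lambda>x. f (x + t *\<^sub>R axis j 1))"
        by (rule continuous_on_compose2[OF c0]) (auto intro!: continuous_intros)
      have "{x. f (x + t *\<^sub>R axis j 1) \<noteq> 0} \<subseteq> (\<lambda>y. y - t *\<^sub>R axis j 1) ` {x. f x \<noteq> 0}"
        by force
      then show "bounded {x. f (x + t *\<^sub>R axis j 1) \<noteq> 0}"
        using bounded_translation_minus[OF f(2)] bounded_subset by blast
    qed
    then show ?thesis
      using i integral_lborel_translate[OF m, of "t *\<^sub>R axis j 1"]
      by (simp add: diff_quotient_def add.commute)
  qed
  have "(\<lambda>n. \<integral>x. 1 *\<^sub>R diff_quotient j (?t n) f x \<partial>lborel) \<longlonglongrightarrow> (\<integral>x. 1 *\<^sub>R partial_deriv j f x \<partial>lborel)"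
    by (rule integral_diff_quotient_tendsto[OF f])
       (use LIMSEQ_inverse_real_of_nat in \<open>auto simp: inverse_le_1_iff\<close>)
  then show ?thesis using z LIMSEQ_unique[OF _ tendsto_const] by simp
qed

lemma integration_by_parts:
  fixes f :: "real^2 \<Rightarrow> real" and g :: "real^2 \<Rightarrow> 'a::euclidean_space"
  assumes f: "C_diff 1 f" "bounded {x. f x \<noteq> 0}" and g: "C_diff 1 g"
  shows "(\<integral>x. partial_deriv j f x *\<^sub>R g x \<partial>lborel) = - (\<integral>x. f x *\<^sub>R partial_deriv j g x \<partial>lborel)"
    and "integrable lborel (\<lambda>x. partial_deriv j f x *\<^sub>R g x)" "integrable lborel (\<lambda>x. f x *\<^sub>R partial_deriv j g x)"
proof -
  have c: "continuous_on UNIV f" "continuous_on UNIV (partial_deriv j f)"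
    "continuous_on UNIV g" "continuous_on UNIV (partial_deriv j g)"
    using C_diff_continuous[OF f(1)] C_diff_continuous[OF g] f(1) g by simp_all
  show i: "integrable lborel (\<lambda>x. partial_deriv j f x *\<^sub>R g x)" "integrable lborel (\<lambda>x. f x *\<^sub>R partial_deriv j g x)"
    by (auto intro!: continuous_bounded_support c continuous_intros
       intro: bounded_subset[OF f(2)] bounded_subset[OF bounded_partial_deriv_support[OF f(2), of j]])
  have "(\<integral>x. partial_deriv j (\<lambda>x. f x *\<^sub>R g x) x \<partial>lborel) = 0"
    by (intro integral_partial_deriv_zero C_diff_scaleR f g bounded_subset[OF f(2)]) auto
  moreover have "partial_deriv j (\<lambda>x. f x *\<^sub>R g x) x = partial_deriv j f x *\<^sub>R g x + f x *\<^sub>R partial_deriv j g x" for x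
    using f(1) g by (intro partial_deriv_scaleR C_diff_differentiable[of 0]) simp_all
  ultimately show "(\<integral>x. partial_deriv j f x *\<^sub>R g x \<partial>lborel) = - (\<integral>x. f x *\<^sub>R partial_deriv j g x \<partial>lborel)"
    using i by (simp add: eq_neg_iff_add_eq_0)
qed

lemma C_diff_translate: "C_diff m f \<Longrightarrow> C_diff m (\<lambda>x. f (x + c))"
  and partial_deriv_translate: "C_diff (Suc m) f \<Longrightarrow> partial_deriv j (\<lambda>x. f (x + c)) x = partial_deriv j f (x + c)"
proof -
  have d: "((\<lambda>x. f (x + c)) has_derivative frechet_derivative f (at (x + c))) (at x)" if "C_diff (Suc m) f" for m f x
    by (rule has_derivative_compose[OF _ C_diff_has_derivative[OF that]]) (auto intro!: derivative_eq_intros)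
  have p: "partial_deriv j (\<lambda>x. f (x + c)) x = partial_deriv j f (x + c)" if "C_diff (Suc m) f" for m f j x
    using partial_deriv_eq[OF d[OF that]] by (simp add: partial_deriv_def)
  show "C_diff (Suc m) f \<Longrightarrow> partial_deriv j (\<lambda>x. f (x + c)) x = partial_deriv j f (x + c)" by (rule p)
  show "C_diff m f \<Longrightarrow> C_diff m (\<lambda>x. f (x + c))"
  proof (induction m arbitrary: f)
    case 0
    then have "continuous_on UNIV f" by simp
    then have "continuous_on UNIV (\<lambda>x. f (x + c))"
      by (rule continuous_on_compose2) (auto intro!: continuous_intros)
    then show ?case by simp
  next
    case (Suc m)
    have "partial_deriv j (\<lambda>x. f (x + c)) = (\<lambda>x. partial_deriv j f (x + c))" for j
      using p[OF Suc.prems] by (rule ext)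
    moreover have "C_diff m (\<lambda>x. partial_deriv j f (x + c))" for j
      by (rule Suc.IH[OF C_diff_partial[OF Suc.prems]])
    moreover have "(\<lambda>x. f (x + c)) differentiable_on UNIV"
      unfolding differentiable_on_def using differentiableI[OF d[OF Suc.prems]] by simp
    ultimately show ?case by simp
  qed
qed

text \<open>
  For functions in \<open>C\<^sup>2\<close> both sides equal \<open>- \<integral> f \<partial>\<^sub>i\<partial>\<^sub>j g\<close>. To need one derivative only, \<open>\<partial>\<^sub>j g\<close> is replaced by a
  difference quotient; integration by parts moves \<open>\<partial>\<^sub>i\<close> to the other factor, a translation of the variable
  moves the difference quotient (with the opposite step) to \<open>f\<close>, and the step tends to zero.
\<close>

lemma integral_mixed_partials:
  fixes f g :: "real^2 \<Rightarrow> real"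
  assumes f: "C_diff 1 f" "bounded {x. f x \<noteq> 0}" and g: "C_diff 1 g" "bounded {x. g x \<noteq> 0}"
  shows "(\<integral>x. partial_deriv i f x * partial_deriv j g x \<partial>lborel)
       = (\<integral>x. partial_deriv j f x * partial_deriv i g x \<partial>lborel)"
proof -
  define t where "t n = inverse (real (Suc n))" for n
  have t: "t \<longlonglongrightarrow> 0" "\<And>n. t n \<noteq> 0" "\<And>n. \<bar>t n\<bar> \<le> 1"
    using LIMSEQ_inverse_real_of_nat by (auto simp: t_def[abs_def] inverse_le_1_iff)
  have cf: "continuous_on UNIV f" and cg: "continuous_on UNIV g"
    and cif: "continuous_on UNIV (partial_deriv i f)" and cig: "continuous_on UNIV (partial_deriv i g)"
    using C_diff_continuous[OF f(1)] C_diff_continuous[OF g(1)] f(1) g(1) by simp_all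
  let ?e = "\<lambda>n. t n *\<^sub>R axis j (1::real)"
  have eq: "(\<integral>x. partial_deriv i f x *\<^sub>R diff_quotient j (t n) g x \<partial>lborel)
      = (\<integral>x. partial_deriv i g x *\<^sub>R diff_quotient j (- t n) f x \<partial>lborel)" for n
  proof -
    have dC: "C_diff 1 (diff_quotient j (t n) g)"
      using C_diff_bounded_linear[OF bounded_linear_scaleR_right
         C_diff_add[OF C_diff_translate[OF g(1), of "?e n"] C_diff_bounded_linear[OF bounded_linear_minus[OF bounded_linear_ident] g(1)]],
         of "1 / t n"]
      by (simp add: diff_quotient_def[abs_def])
    have pd: "partial_deriv i (diff_quotient j (t n) g) x = diff_quotient j (t n) (partial_deriv i g) x" for x
    proof -
      have 1: "((\<lambda>x. g (x + ?e n)) has_derivative frechet_derivative (\<lambda>x. g (x + ?e n)) (at x)) (at x)"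
        using C_diff_translate[OF g(1), of "?e n"] C_diff_has_derivative[of 0] by simp
      have 2: "(g has_derivative frechet_derivative g (at x)) (at x)"
        using g(1) C_diff_has_derivative[of 0] by simp
      have "partial_deriv i (diff_quotient j (t n) g) x
          = (1 / t n) *\<^sub>R (partial_deriv i (\<lambda>x. g (x + ?e n)) x - partial_deriv i g x)"
        unfolding diff_quotient_def
        by (subst partial_deriv_eq[OF has_derivative_scaleR_right[OF has_derivative_diff[OF 1 2]]])
           (simp add: partial_deriv_def)
      then show ?thesis using partial_deriv_translate[of 0 g i "?e n"] g(1) by (simp add: diff_quotient_def)
    qed
    have m: "(\<lambda>x. f (x - ?e n) * partial_deriv i g x) \<in> borel_measurable borel"
      by (intro borel_measurable_continuous_onI continuous_intros cig continuous_on_compose2[OF cf]) auto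
    have bpg: "bounded {x. partial_deriv i g x \<noteq> 0}" by (rule bounded_partial_deriv_support[OF g(2)])
    have i1: "integrable lborel (\<lambda>x. f x * partial_deriv i g (x + ?e n))"
      by (intro continuous_bounded_support continuous_intros cf continuous_on_compose2[OF cig])
         (auto intro: bounded_subset[OF f(2)])
    have i2: "integrable lborel (\<lambda>x. f x * partial_deriv i g x)"
      by (intro continuous_bounded_support continuous_intros cf cig)
         (auto intro: bounded_subset[OF f(2)])
    have i3: "integrable lborel (\<lambda>x. f (x - ?e n) * partial_deriv i g x)"
      by (intro continuous_bounded_support continuous_intros cig continuous_on_compose2[OF cf])
         (auto intro: bounded_subset[OF bpg])
    have "(\<integral>x. partial_deriv i f x *\<^sub>R diff_quotient j (t n) g x \<partial>lborel)
        = - (\<integral>x. f x *\<^sub>R diff_quotient j (t n) (partial_deriv i g) x \<partial>lborel)"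
      using integration_by_parts(1)[OF f dC, of i] pd by simp
    also have "\<dots> = - (1 / t n) * ((\<integral>x. f x * partial_deriv i g (x + ?e n) \<partial>lborel) - (\<integral>x. f x * partial_deriv i g x \<partial>lborel))"
      by (subst Bochner_Integration.integral_diff[OF i1 i2, symmetric])
         (simp add: diff_quotient_def algebra_simps flip: Bochner_Integration.integral_mult_right_zero Bochner_Integration.integral_minus)
    also have "(\<integral>x. f x * partial_deriv i g (x + ?e n) \<partial>lborel) = (\<integral>x. f (x - ?e n) * partial_deriv i g x \<partial>lborel)"
      using integral_lborel_translate[OF m, of "?e n"] by (simp add: add.commute)
    also have "- (1 / t n) * (\<dots> - (\<integral>x. f x * partial_deriv i g x \<partial>lborel))
        = (\<integral>x. partial_deriv i g x *\<^sub>R diff_quotient j (- t n) f x \<partial>lborel)"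
      by (subst Bochner_Integration.integral_diff[OF i3 i2, symmetric])
         (simp add: diff_quotient_def algebra_simps flip: Bochner_Integration.integral_mult_right_zero)
    finally show ?thesis .
  qed
  have "(\<lambda>n. \<integral>x. partial_deriv i f x *\<^sub>R diff_quotient j (t n) g x \<partial>lborel)
      \<longlonglongrightarrow> (\<integral>x. partial_deriv i f x *\<^sub>R partial_deriv j g x \<partial>lborel)"
    by (rule integral_diff_quotient_tendsto[OF g cif t])
  moreover have "(\<lambda>n. \<integral>x. partial_deriv i g x *\<^sub>R diff_quotient j (- t n) f x \<partial>lborel)
      \<longlonglongrightarrow> (\<integral>x. partial_deriv i g x *\<^sub>R partial_deriv j f x \<partial>lborel)"
    by (rule integral_diff_quotient_tendsto[OF f cig]) (use t tendsto_minus[OF t(1)] in auto)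
  ultimately show ?thesis unfolding eq using LIMSEQ_unique by (fastforce simp: mult.commute)
qed

section \<open>The fundamental lemma of the calculus of variations\<close>

lemma integral_on_eq:
  fixes f :: "real^2 \<Rightarrow> 'a::euclidean_space"
  assumes "U \<in> sets lebesgue"
  shows "(\<integral>x. f x \<partial>(lebesgue_on U)) = (\<integral>x. indicator U x *\<^sub>R f x \<partial>lebesgue)"
  using assms by (intro integral_restrict_space) auto

lemma integrable_on_eq:
  fixes f :: "real^2 \<Rightarrow> 'a::euclidean_space"
  assumes "U \<in> sets lebesgue"
  shows "integrable (lebesgue_on U) f \<longleftrightarrow> integrable lebesgue (\<lambda>x. indicator U x *\<^sub>R f x)"
  using assms by (intro integrable_restrict_space) auto

lemma integral_on_support:
  fixes f :: "real^2 \<Rightarrow> 'a::euclidean_space"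
  assumes "U \<in> sets lebesgue" "V \<in> sets lebesgue" "\<And>x. f x \<noteq> 0 \<Longrightarrow> x \<in> U \<longleftrightarrow> x \<in> V"
  shows "(\<integral>x. f x \<partial>(lebesgue_on U)) = (\<integral>x. f x \<partial>(lebesgue_on V))"
  unfolding integral_on_eq[OF assms(1)] integral_on_eq[OF assms(2)]
  using assms(3) by (intro Bochner_Integration.integral_cong) (auto simp: indicator_def)

lemma integrable_on_support:
  fixes f :: "real^2 \<Rightarrow> 'a::euclidean_space"
  assumes "U \<in> sets lebesgue" "V \<in> sets lebesgue" "\<And>x. f x \<noteq> 0 \<Longrightarrow> x \<in> U \<longleftrightarrow> x \<in> V"
  shows "integrable (lebesgue_on U) f \<longleftrightarrow> integrable (lebesgue_on V) f"
  unfolding integrable_on_eq[OF assms(1)] integrable_on_eq[OF assms(2)]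
  using assms(3) by (intro Bochner_Integration.integrable_cong) (auto simp: indicator_def)

lemma test_function_support: "test_function U \<phi> \<Longrightarrow> \<phi> x \<noteq> 0 \<Longrightarrow> x \<in> U"
  using closure_subset[of "{x. \<phi> x \<noteq> 0}"] by (auto simp: test_function_def)

lemma AE_lebesgue_on_negligible:
  assumes "U \<in> sets lebesgue" "negligible N" "\<And>x. x \<in> U \<Longrightarrow> x \<notin> N \<Longrightarrow> P x"
  shows "AE x in lebesgue_on U. P x"
proof -
  have "AE x in lebesgue. x \<notin> N"
    using assms(2) by (simp add: AE_not_in negligible_iff_null_sets)
  then show ?thesis using assms by (subst AE_restrict_space_iff) auto
qed

text \<open>
  The bump functions of the box converge boundedly to its indicator, so the hypothesis on test functions
  passes to the indicator of every box contained in \<open>U\<close>.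
\<close>

lemma integral_box_zero:
  fixes g :: "real^2 \<Rightarrow> 'a::euclidean_space"
  assumes U: "open U" and g: "locally_integrable U g" and ab: "cbox a b \<subseteq> U"
    and z: "\<And>\<phi>. test_function U \<phi> \<Longrightarrow> (\<integral>x. \<phi> x *\<^sub>R g x \<partial>(lebesgue_on U)) = 0"
  shows "(g has_integral 0) (cbox a b)"
proof -
  have i: "integrable (lebesgue_on (cbox a b)) g"
    using g ab by (auto simp: locally_integrable_def)
  have supp: "box_bump a b n x \<noteq> 0 \<Longrightarrow> x \<in> cbox a b" for n x
    using box_bump_support[of a b n] box_subset_cbox by blast
  have gm: "g \<in> borel_measurable (lebesgue_on (cbox a b))" using i by auto
  have im: "(\<lambda>x. indicator (box a b) x *\<^sub>R g x) \<in> borel_measurable (lebesgue_on (cbox a b))"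
      by (intro borel_measurable_scaleR gm borel_measurable_indicator)
         (auto simp: sets_restrict_space intro!: image_eqI[of _ _ "box a b"] dest: box_subset_cbox[THEN subsetD])
  have "(\<integral>x. box_bump a b n x *\<^sub>R g x \<partial>(lebesgue_on (cbox a b))) = 0" for n
  proof -
    have "(\<integral>x. box_bump a b n x *\<^sub>R g x \<partial>(lebesgue_on (cbox a b))) = (\<integral>x. box_bump a b n x *\<^sub>R g x \<partial>(lebesgue_on U))"
      using U ab supp by (intro integral_on_support) (auto simp: lebesgue_openin dest!: supp)
    then show ?thesis using z[OF test_function_box_bump[OF ab]] by simp
  qed
  moreover have "(\<lambda>n. \<integral>x. box_bump a b n x *\<^sub>R g x \<partial>(lebesgue_on (cbox a b)))
      \<longlonglongrightarrow> (\<integral>x. indicator (box a b) x *\<^sub>R g x \<partial>(lebesgue_on (cbox a b)))"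
  proof (rule integral_dominated_convergence)
    show "(\<lambda>x. indicator (box a b) x *\<^sub>R g x) \<in> borel_measurable (lebesgue_on (cbox a b))" by (rule im)
    show "(\<lambda>x. box_bump a b n x *\<^sub>R g x) \<in> borel_measurable (lebesgue_on (cbox a b))" for n
      by (intro borel_measurable_scaleR gm continuous_imp_measurable_on_sets_lebesgue smooth_continuous_on smooth_box_bump) auto
    show "integrable (lebesgue_on (cbox a b)) (\<lambda>x. norm (g x))" using i by simp
    show "AE x in lebesgue_on (cbox a b). (\<lambda>n. box_bump a b n x *\<^sub>R g x) \<longlonglongrightarrow> indicator (box a b) x *\<^sub>R g x"
      by (intro AE_I2 tendsto_intros box_bump_tendsto)
    show "AE x in lebesgue_on (cbox a b). norm (box_bump a b n x *\<^sub>R g x) \<le> norm (g x)" for n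
      using box_bump_01[of a b n] by (auto intro!: AE_I2 mult_left_le_one_le)
  qed
  ultimately have 0: "(\<integral>x. indicator (box a b) x *\<^sub>R g x \<partial>(lebesgue_on (cbox a b))) = 0"
    using LIMSEQ_unique[OF _ tendsto_const] by simp
  have "AE x in lebesgue_on (cbox a b). indicator (box a b) x *\<^sub>R g x = g x"
    by (rule AE_lebesgue_on_negligible[OF _ negligible_frontier_interval[of a b]]) (auto simp: indicator_def)
  then have "(\<integral>x. g x \<partial>(lebesgue_on (cbox a b))) = 0"
    using 0 integral_cong_AE[OF im gm] by simp
  then show ?thesis using has_integral_integral_lebesgue_on[OF i] by simp
qed

text \<open>
  By Lebesgue's differentiation theorem, almost every value is the limit of averages over shrinking cubes,
  and all these averages vanish.
\<close>

lemma zero_AE_cbox: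
  fixes g :: "real^2 \<Rightarrow> 'a::euclidean_space"
  assumes i: "integrable (lebesgue_on (cbox a b)) g"
    and z: "\<And>c d. cbox c d \<subseteq> cbox a b \<Longrightarrow> (g has_integral 0) (cbox c d)"
  shows "\<exists>N. negligible N \<and> (\<forall>x\<in>cbox a b - N. g x = 0)"
proof -
  define f where "f x = (if x \<in> cbox a b then g x else 0)" for x
  have "(g has_integral integral\<^sup>L (lebesgue_on (cbox a b)) g) (cbox a b)"
    by (rule has_integral_integral_lebesgue_on[OF i]) simp
  then have f: "f integrable_on UNIV"
    unfolding f_def[abs_def] integrable_restrict_UNIV by blast
  have "f integrable_on cbox c d" for c d
    by (rule integrable_on_subcbox[OF f]) simp
  from integrable_ccontinuous_explicit[OF this] obtain N where N: "negligible N"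
     "\<And>x e. \<lbrakk>x \<notin> N; 0 < e\<rbrakk> \<Longrightarrow> \<exists>d>0. \<forall>h. 0 < h \<and> h < d \<longrightarrow>
         norm(integral (cbox x (x + h *\<^sub>R One)) f /\<^sub>R h ^ DIM(real^2) - f x) < e" by metis
  show ?thesis
  proof (intro exI[of _ "N \<union> (cbox a b - box a b)"] conjI ballI)
    show "negligible (N \<union> (cbox a b - box a b))"
      by (intro negligible_Un N(1) negligible_frontier_interval)
    fix x assume x: "x \<in> cbox a b - (N \<union> (cbox a b - box a b))"
    then have xb: "x \<in> box a b" "x \<notin> N" by auto
    obtain e where e: "e > 0" "ball x e \<subseteq> box a b"
      using xb(1) open_box open_contains_ball by blast
    have "norm (f x) < \<epsilon>" if eps: "\<epsilon> > 0" for \<epsilon>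
    proof -
      obtain d where d: "d > 0" "\<And>h. 0 < h \<and> h < d \<Longrightarrow>
          norm(integral (cbox x (x + h *\<^sub>R One)) f /\<^sub>R h ^ DIM(real^2) - f x) < \<epsilon>"
        using N(2)[OF xb(2) eps] by blast
      \<comment> \<open>The cube with corner \<open>x\<close> and side \<open>h\<close> stays in the ball of radius \<open>e\<close>.\<close>
      define h where "h = min (d / 2) (e / (2 * (norm (One::real^2) + 1)))"
      have h: "0 < h" "h < d" "h * (norm (One::real^2) + 1) < e"
      proof -
        have n: "norm (One::real^2) + 1 > 0" using norm_ge_zero[of "One::real^2"] by linarith
        show "0 < h" using d e n by (simp add: h_def)
        show "h < d" using d by (simp add: h_def)
        have "h * (norm (One::real^2) + 1) \<le> e / (2 * (norm (One::real^2) + 1)) * (norm (One::real^2) + 1)"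
          using n by (intro mult_right_mono) (auto simp: h_def)
        also have "\<dots> = e / 2" using n by (simp add: field_simps)
        finally show "h * (norm (One::real^2) + 1) < e" using e by simp
      qed
      have "cbox x (x + h *\<^sub>R One) \<subseteq> box a b"
      proof -
        have "x + h *\<^sub>R One \<in> box a b"
        proof (rule subsetD[OF e(2)])
          have "h * norm (One::real^2) < e" using h(1,3) by (simp add: algebra_simps)
          then show "x + h *\<^sub>R One \<in> ball x e" using h(1) by (simp add: dist_norm)
        qed
        then show ?thesis using xb(1) h(1)
          by (subst subset_box) (auto simp: mem_box)
      qed
      then have s: "cbox x (x + h *\<^sub>R One) \<subseteq> cbox a b" using box_subset_cbox by blast
      have "(f has_integral 0) (cbox x (x + h *\<^sub>R One))"
        using s by (intro has_integral_eq[OF _ z[OF s]]) (auto simp: f_def)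
      then show "norm (f x) < \<epsilon>" using d(2)[of h] h by (simp add: integral_unique)
    qed
    then have "f x = 0" by (metis less_irrefl zero_less_norm_iff)
    then show "g x = 0" using x by (simp add: f_def)
  qed
qed

text \<open>
  This is what makes weak derivatives unique, so that a gradient obtained by choice can be computed with.
\<close>

lemma fundamental_lemma:
  fixes g :: "real^2 \<Rightarrow> 'a::euclidean_space"
  assumes U: "open U" and g: "locally_integrable U g"
    and z: "\<And>\<phi>. test_function U \<phi> \<Longrightarrow> (\<integral>x. \<phi> x *\<^sub>R g x \<partial>(lebesgue_on U)) = 0"
  shows "AE x in lebesgue_on U. g x = 0"
proof -
  obtain D where D: "countable D" "D \<subseteq> Pow U" "\<And>X. X \<in> D \<Longrightarrow> \<exists>a b. X = cbox a b" "\<Union>D = U"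
    using open_countable_Union_open_cbox[OF U] by metis
  have "\<exists>N. negligible N \<and> (\<forall>x\<in>X - N. g x = 0)" if X: "X \<in> D" for X
  proof -
    obtain a b where ab: "X = cbox a b" using D(3)[OF X] by blast
    have s: "cbox a b \<subseteq> U" using D(2) X ab by auto
    have i: "integrable (lebesgue_on (cbox a b)) g"
      using g s by (auto simp: locally_integrable_def)
    have zz: "(g has_integral 0) (cbox c d)" if "cbox c d \<subseteq> cbox a b" for c d
      by (rule integral_box_zero[OF U g _ z]) (use that s in auto)
    show ?thesis using zero_AE_cbox[OF i zz] ab by simp
  qed
  then obtain N where N: "\<And>X. X \<in> D \<Longrightarrow> negligible (N X)" "\<And>X x. X \<in> D \<Longrightarrow> x \<in> X - N X \<Longrightarrow> g x = 0"
    by metis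
  have "negligible (\<Union>X\<in>D. N X)"
    using D(1) N(1) by (intro negligible_countable_Union) auto
  moreover have "g x = 0" if "x \<in> U" "x \<notin> (\<Union>X\<in>D. N X)" for x
    using that D(4) N(2) by blast
  ultimately show ?thesis
    using U by (intro AE_lebesgue_on_negligible) auto
qed

section \<open>Weak derivatives\<close>

lemma locally_integrable_times:
  fixes g :: "real^2 \<Rightarrow> 'a::euclidean_space" and w :: "real^2 \<Rightarrow> real"
  assumes U: "open U" and g: "locally_integrable U g" and K: "compact K" "K \<subseteq> U"
    and w: "continuous_on UNIV w" "\<And>x. x \<notin> K \<Longrightarrow> w x = 0"
  shows "integrable (lebesgue_on U) (\<lambda>x. w x *\<^sub>R g x)"
proof -
  have KL: "K \<in> sets lebesgue" using K(1) by (simp add: compact_imp_closed)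
  have i: "integrable (lebesgue_on K) g" using g K by (auto simp: locally_integrable_def)
  obtain B where B: "\<And>x. x \<in> K \<Longrightarrow> norm (w x) \<le> B"
    using compact_imp_bounded[OF compact_continuous_image[OF continuous_on_subset[OF w(1)] K(1)]]
    unfolding bounded_iff by blast
  have "integrable (lebesgue_on K) (\<lambda>x. w x *\<^sub>R g x)"
  proof (rule Bochner_Integration.integrable_bound)
    show "integrable (lebesgue_on K) (\<lambda>x. B *\<^sub>R norm (g x))" using i by simp
    show "(\<lambda>x. w x *\<^sub>R g x) \<in> borel_measurable (lebesgue_on K)"
      using KL by (intro borel_measurable_scaleR borel_measurable_integrable[OF i]
          continuous_imp_measurable_on_sets_lebesgue continuous_on_subset[OF w(1)]) auto
    show "AE x in lebesgue_on K. norm (w x *\<^sub>R g x) \<le> norm (B *\<^sub>R norm (g x))"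
    proof (rule AE_I2)
      fix x assume "x \<in> space (lebesgue_on K)"
      then have "norm (w x) \<le> B" using B by (simp add: space_restrict_space)
      then show "norm (w x *\<^sub>R g x) \<le> norm (B *\<^sub>R norm (g x))"
        using mult_right_mono[of "norm (w x)" "\<bar>B\<bar>" "norm (g x)"] by (simp add: abs_mult)
    qed
  qed
  then show ?thesis
    using U K w(2) by (subst integrable_on_support[OF _ KL]) auto
qed

lemma test_function_integrable:
  fixes g :: "real^2 \<Rightarrow> 'a::euclidean_space" and \<phi> :: "real^2 \<Rightarrow> real"
  assumes U: "open U" and g: "locally_integrable U g" and \<phi>: "test_function U \<phi>"
  shows "integrable (lebesgue_on U) (\<lambda>x. \<phi> x *\<^sub>R g x)" "integrable (lebesgue_on U) (\<lambda>x. partial_deriv j \<phi> x *\<^sub>R g x)"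
proof -
  let ?K = "closure {x. \<phi> x \<noteq> 0}"
  have K: "compact ?K" "?K \<subseteq> U" and s: "smooth \<phi>" using \<phi> by (auto simp: test_function_def)
  have 1: "\<phi> x = 0" if "x \<notin> ?K" for x using that closure_subset[of "{x. \<phi> x \<noteq> 0}"] by auto
  show "integrable (lebesgue_on U) (\<lambda>x. \<phi> x *\<^sub>R g x)"
    by (rule locally_integrable_times[OF U g K smooth_continuous_on[OF s] 1])
  show "integrable (lebesgue_on U) (\<lambda>x. partial_deriv j \<phi> x *\<^sub>R g x)"
    by (rule locally_integrable_times[OF U g K smooth_continuous_on[OF smooth_partial[OF s]]
       partial_deriv_support[OF order_refl]])
qed

lemma locally_integrable_diff:
  "locally_integrable U f \<Longrightarrow> locally_integrable U g \<Longrightarrow> locally_integrable U (\<lambda>x. f x - g x)"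
  by (auto simp: locally_integrable_def)

lemma has_weak_partial_unique:
  assumes U: "open U" and "has_weak_partial U j f g" "has_weak_partial U j f h"
  shows "AE x in lebesgue_on U. g x = h x"
proof -
  have l: "locally_integrable U g" "locally_integrable U h" using assms by (auto simp: has_weak_partial_def)
  have "AE x in lebesgue_on U. g x - h x = 0"
  proof (rule fundamental_lemma[OF U locally_integrable_diff[OF l]])
    fix \<phi> :: "real^2 \<Rightarrow> real" assume \<phi>: "test_function U \<phi>"
    have "- (\<integral>x. \<phi> x *\<^sub>R g x \<partial>(lebesgue_on U)) = - (\<integral>x. \<phi> x *\<^sub>R h x \<partial>(lebesgue_on U))"
      using assms(2,3) \<phi> unfolding has_weak_partial_def by metis
    then show "(\<integral>x. \<phi> x *\<^sub>R (g x - h x) \<partial>(lebesgue_on U)) = 0"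
      using test_function_integrable(1)[OF U l(1) \<phi>] test_function_integrable(1)[OF U l(2) \<phi>]
      by (simp add: scaleR_diff_right)
  qed
  then show ?thesis by auto
qed

lemma has_weak_partial_diff:
  assumes U: "open U" and f: "has_weak_partial U j f f'" and g: "has_weak_partial U j g g'"
  shows "has_weak_partial U j (\<lambda>x. f x - g x) (\<lambda>x. f' x - g' x)"
proof -
  have l: "locally_integrable U f" "locally_integrable U f'" "locally_integrable U g" "locally_integrable U g'"
    using assms by (auto simp: has_weak_partial_def)
  show ?thesis
    unfolding has_weak_partial_def
  proof (intro conjI locally_integrable_diff l allI impI)
    fix \<phi> :: "real^2 \<Rightarrow> real" assume \<phi>: "test_function U \<phi>"
    note [simp] = test_function_integrable[OF U l(1) \<phi>] test_function_integrable[OF U l(2) \<phi>]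
       test_function_integrable[OF U l(3) \<phi>] test_function_integrable[OF U l(4) \<phi>]
    show "(\<integral>x. partial_deriv j \<phi> x *\<^sub>R (f x - g x) \<partial>(lebesgue_on U)) = - (\<integral>x. \<phi> x *\<^sub>R (f' x - g' x) \<partial>(lebesgue_on U))"
      using f g \<phi> by (simp add: scaleR_diff_right has_weak_partial_def)
  qed
qed

lemma has_weak_partial_subset:
  assumes "open U" "open V" "V \<subseteq> U" and f: "has_weak_partial U j f f'"
  shows "has_weak_partial V j f f'"
proof -
  have l: "locally_integrable V f" "locally_integrable V f'"
    using assms by (auto simp: has_weak_partial_def locally_integrable_def)
  show ?thesis
    unfolding has_weak_partial_def
  proof (intro conjI l allI impI)
    fix \<phi> :: "real^2 \<Rightarrow> real" assume \<phi>: "test_function V \<phi>"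
    then have \<phi>U: "test_function U \<phi>" using assms(3) by (auto simp: test_function_def)
    have "x \<in> V" if "\<phi> x \<noteq> 0" for x using test_function_support[OF \<phi> that] .
    moreover have "x \<in> V" if "partial_deriv j \<phi> x \<noteq> 0" for x
      using that \<phi> partial_deriv_support[of \<phi> V x j] by (auto simp: test_function_def)
    ultimately have "(\<integral>x. partial_deriv j \<phi> x *\<^sub>R f x \<partial>(lebesgue_on V)) = (\<integral>x. partial_deriv j \<phi> x *\<^sub>R f x \<partial>(lebesgue_on U))"
       "(\<integral>x. \<phi> x *\<^sub>R f' x \<partial>(lebesgue_on V)) = (\<integral>x. \<phi> x *\<^sub>R f' x \<partial>(lebesgue_on U))"
      using assms(1-3) by (auto intro!: integral_on_support)
    then show "(\<integral>x. partial_deriv j \<phi> x *\<^sub>R f x \<partial>(lebesgue_on V)) = - (\<integral>x. \<phi> x *\<^sub>R f' x \<partial>(lebesgue_on V))"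
      using f \<phi>U by (simp add: has_weak_partial_def)
  qed
qed

lemma continuous_locally_integrable:
  fixes f :: "real^2 \<Rightarrow> 'a::euclidean_space"
  assumes "continuous_on UNIV f"
  shows "locally_integrable U f"
  unfolding locally_integrable_def
proof (intro allI impI)
  fix K :: "(real^2) set" assume K: "compact K \<and> K \<subseteq> U"
  then have KL: "K \<in> sets lebesgue" by (simp add: compact_imp_closed)
  have "integrable lborel (\<lambda>x. indicator K x *\<^sub>R f x)"
    using K continuous_on_subset[OF assms] by (intro borel_integrable_compact) auto
  then have "integrable lebesgue (\<lambda>x. indicator K x *\<^sub>R f x)"
    by (subst integrable_completion) auto
  then show "integrable (lebesgue_on K) f" by (simp add: integrable_on_eq[OF KL])
qed

lemma integral_on_lborel:
  fixes f :: "real^2 \<Rightarrow> 'a::euclidean_space"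
  assumes "open U" "continuous_on UNIV f" "\<And>x. f x \<noteq> 0 \<Longrightarrow> x \<in> U"
  shows "(\<integral>x. f x \<partial>(lebesgue_on U)) = (\<integral>x. f x \<partial>lborel)"
proof -
  have "(\<integral>x. f x \<partial>(lebesgue_on U)) = (\<integral>x. f x \<partial>(lebesgue_on UNIV))"
    using assms by (intro integral_on_support) auto
  also have "\<dots> = (\<integral>x. f x \<partial>lebesgue)" by (simp add: lebesgue_on_UNIV_eq)
  also have "\<dots> = (\<integral>x. f x \<partial>lborel)"
    using borel_measurable_continuous_onI[OF assms(2)] by (intro integral_completion) simp
  finally show ?thesis .
qed

text \<open>
  Integration by parts on the whole plane; the support of the test function confines both integrals to \<open>U\<close>.
\<close>

lemma has_weak_partial_smooth:
  fixes f :: "real^2 \<Rightarrow> 'a::euclidean_space"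
  assumes U: "open U" and f: "smooth f"
  shows "has_weak_partial U j f (partial_deriv j f)"
  unfolding has_weak_partial_def
proof (intro conjI allI impI continuous_locally_integrable smooth_continuous_on f smooth_partial)
  fix \<phi> :: "real^2 \<Rightarrow> real" assume \<phi>: "test_function U \<phi>"
  then have s: "smooth \<phi>" and b: "bounded {x. \<phi> x \<noteq> 0}"
    using bounded_subset[OF compact_imp_bounded closure_subset] by (auto simp: test_function_def)
  have "(\<integral>x. partial_deriv j \<phi> x *\<^sub>R f x \<partial>(lebesgue_on U)) = (\<integral>x. partial_deriv j \<phi> x *\<^sub>R f x \<partial>lborel)"
    using \<phi> partial_deriv_support[of \<phi> U _ j]
    by (intro integral_on_lborel[OF U] continuous_intros smooth_continuous_on smooth_partial s f)
       (auto simp: test_function_def)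
  moreover have "(\<integral>x. \<phi> x *\<^sub>R partial_deriv j f x \<partial>(lebesgue_on U)) = (\<integral>x. \<phi> x *\<^sub>R partial_deriv j f x \<partial>lborel)"
    using test_function_support[OF \<phi>]
    by (intro integral_on_lborel[OF U] continuous_intros smooth_continuous_on smooth_partial s f) auto
  ultimately show "(\<integral>x. partial_deriv j \<phi> x *\<^sub>R f x \<partial>(lebesgue_on U)) = - (\<integral>x. \<phi> x *\<^sub>R partial_deriv j f x \<partial>(lebesgue_on U))"
    using integration_by_parts(1)[OF smooth_C_diff[OF s] b smooth_C_diff[OF f]] by simp
qed

lemma jacobian_nth:
  assumes "f differentiable (at x)"
  shows "jacobian f (at x) $ i $ j = partial_deriv j f x $ i"
  by (simp add: jacobian_def matrix_def partial_deriv_def)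

lemma column_jacobian: "column j (jacobian f (at x)) = partial_deriv j f x"
  by (simp add: jacobian_def matrix_def partial_deriv_def column_def vec_eq_iff)

lemma column_diff: "column j (A - B) = column j A - column j (B::real^2^2)"
  by (simp add: column_def vec_eq_iff)

lemma column_eq_iff: "A = B \<longleftrightarrow> (\<forall>j. column j A = column j (B::real^2^2))"
  by (auto simp: column_def vec_eq_iff)

lemma has_weak_grad_unique:
  assumes "open U" "has_weak_grad U u G" "has_weak_grad U u H"
  shows "AE x in lebesgue_on U. G x = H x"
proof -
  have "\<forall>j. AE x in lebesgue_on U. column j (G x) = column j (H x)"
    using assms has_weak_partial_unique unfolding has_weak_grad_def by blast
  then have "AE x in lebesgue_on U. \<forall>j. column j (G x) = column j (H x)"
    by (subst AE_all_countable) simp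
  then show ?thesis by (simp add: column_eq_iff)
qed

lemma has_weak_grad_diff:
  assumes "open U" "has_weak_grad U u G" "has_weak_grad U v H"
  shows "has_weak_grad U (\<lambda>x. u x - v x) (\<lambda>x. G x - H x)"
  using assms has_weak_partial_diff unfolding has_weak_grad_def column_diff by blast

lemma has_weak_grad_subset:
  assumes "open U" "open V" "V \<subseteq> U" "has_weak_grad U u G"
  shows "has_weak_grad V u G"
  using assms has_weak_partial_subset unfolding has_weak_grad_def by blast

lemma has_weak_grad_smooth:
  assumes "open U" "smooth u"
  shows "has_weak_grad U u (\<lambda>x. jacobian u (at x))"
  using assms has_weak_partial_smooth unfolding has_weak_grad_def column_jacobian by auto

lemma has_weak_grad_weak_grad: "has_weak_grad U u G \<Longrightarrow> has_weak_grad U u (weak_grad U u)"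
  unfolding weak_grad_def by (rule someI[of "has_weak_grad U u"])

lemma weak_grad_AE: "open U \<Longrightarrow> has_weak_grad U u G \<Longrightarrow> AE x in lebesgue_on U. weak_grad U u x = G x"
  using has_weak_grad_unique has_weak_grad_weak_grad by blast

section \<open>Square-integrable functions\<close>

lemma square_integrable_bounded_linear:
  assumes L: "bounded_linear L" and f: "square_integrable U f"
  shows "square_integrable U (\<lambda>x. L (f x))"
proof -
  obtain K where K: "\<And>x. norm (L x) \<le> norm x * K"
    using bounded_linear.bounded[OF L] by blast
  have m: "(\<lambda>x. L (f x)) \<in> borel_measurable (lebesgue_on U)"
    using f borel_measurable_continuous_onI[OF linear_continuous_on[OF L]]
    by (intro measurable_compose[of f _ borel L]) (auto simp: square_integrable_def)
  have "integrable (lebesgue_on U) (\<lambda>x. (norm (L (f x)))\<^sup>2)"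
  proof (rule Bochner_Integration.integrable_bound)
    show "integrable (lebesgue_on U) (\<lambda>x. K\<^sup>2 * (norm (f x))\<^sup>2)"
      using f by (simp add: square_integrable_def)
    show "(\<lambda>x. (norm (L (f x)))\<^sup>2) \<in> borel_measurable (lebesgue_on U)" using m by simp
    have "(norm (L (f x)))\<^sup>2 \<le> (norm (f x) * K)\<^sup>2" for x by (rule power_mono[OF K]) simp
    then show "AE x in lebesgue_on U. norm ((norm (L (f x)))\<^sup>2) \<le> norm (K\<^sup>2 * (norm (f x))\<^sup>2)"
      by (intro AE_I2) (simp add: power_mult_distrib mult.commute)
  qed
  with m show ?thesis by (simp add: square_integrable_def)
qed

text \<open>
  Limits in \<open>L\<^sup>2\<close> are taken below with this consequence of the parallelogram law in place of the
  triangle inequality; each use costs a factor of two in a constant.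
\<close>

lemma norm_sq_add_le: "(norm (a + b))\<^sup>2 \<le> 2 * (norm a)\<^sup>2 + 2 * (norm (b::'a::real_inner))\<^sup>2"
proof -
  have "(norm (a + b))\<^sup>2 + (norm (a - b))\<^sup>2 = 2 * (norm a)\<^sup>2 + 2 * (norm b)\<^sup>2"
    by (simp add: power2_norm_eq_inner algebra_simps inner_commute)
  then show ?thesis using zero_le_power2[of "norm (a - b)"] by linarith
qed

lemma square_integrable_add:
  assumes f: "square_integrable U f" and g: "square_integrable U g"
  shows "square_integrable U (\<lambda>x. f x + g x)"
proof -
  have m: "(\<lambda>x. f x + g x) \<in> borel_measurable (lebesgue_on U)"
    using f g by (intro borel_measurable_add) (simp_all add: square_integrable_def)
  have "integrable (lebesgue_on U) (\<lambda>x. (norm (f x + g x))\<^sup>2)"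
  proof (rule Bochner_Integration.integrable_bound)
    show "integrable (lebesgue_on U) (\<lambda>x. 2 * (norm (f x))\<^sup>2 + 2 * (norm (g x))\<^sup>2)"
      using f g by (simp add: square_integrable_def)
    show "(\<lambda>x. (norm (f x + g x))\<^sup>2) \<in> borel_measurable (lebesgue_on U)" using m by simp
    show "AE x in lebesgue_on U. norm ((norm (f x + g x))\<^sup>2) \<le> norm (2 * (norm (f x))\<^sup>2 + 2 * (norm (g x))\<^sup>2)"
      using norm_sq_add_le by (intro AE_I2) simp
  qed
  with m show ?thesis by (simp add: square_integrable_def)
qed

lemma square_integrable_scaleR: "square_integrable U f \<Longrightarrow> square_integrable U (\<lambda>x. c *\<^sub>R f x)"
  by (rule square_integrable_bounded_linear[OF bounded_linear_scaleR_right])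

lemma square_integrable_diff:
  assumes "square_integrable U f" "square_integrable U g"
  shows "square_integrable U (\<lambda>x. f x - g x)"
  using square_integrable_add[OF assms(1) square_integrable_scaleR[OF assms(2), of "-1"]] by simp

lemma square_integrable_zero: "square_integrable U (\<lambda>x. 0)"
  by (simp add: square_integrable_def)

lemma square_integrable_sum:
  "(\<And>i. i \<in> I \<Longrightarrow> square_integrable U (f i)) \<Longrightarrow> square_integrable U (\<lambda>x. \<Sum>i\<in>I. f i x)"
  by (induction I rule: infinite_finite_induct) (auto simp: square_integrable_zero intro: square_integrable_add)

lemma square_integrable_cong_AE:
  assumes f: "square_integrable U f" and g: "g \<in> borel_measurable (lebesgue_on U)"
    and "AE x in lebesgue_on U. g x = f x"
  shows "square_integrable U g"
proof -
  have fm: "f \<in> borel_measurable (lebesgue_on U)" using f by (simp add: square_integrable_def)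
  have "integrable (lebesgue_on U) (\<lambda>x. (norm (g x))\<^sup>2) \<longleftrightarrow> integrable (lebesgue_on U) (\<lambda>x. (norm (f x))\<^sup>2)"
    using assms(3) g fm by (intro integrable_cong_AE) (auto elim: eventually_mono)
  then show ?thesis using f g by (simp add: square_integrable_def)
qed

lemma integrable_on_subset_lebesgue:
  fixes f :: "real^2 \<Rightarrow> 'a::euclidean_space"
  assumes "integrable (lebesgue_on U) f" "U \<in> sets lebesgue" "V \<in> sets lebesgue" "V \<subseteq> U"
  shows "integrable (lebesgue_on V) f"
proof -
  have "integrable lebesgue (\<lambda>x. indicator V x *\<^sub>R (indicator U x *\<^sub>R f x))"
    by (rule integrable_mult_indicator[OF assms(3) assms(1)[unfolded integrable_on_eq[OF assms(2)]]])
  moreover have "indicator V x *\<^sub>R (indicator U x *\<^sub>R f x) = indicator V x *\<^sub>R f x" for x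
    using assms(4) by (auto simp: indicator_def)
  ultimately show ?thesis unfolding integrable_on_eq[OF assms(3)] by (simp only:)
qed

lemma square_integrable_subset:
  assumes "square_integrable U f" "V \<subseteq> U" "U \<in> sets lebesgue" "V \<in> sets lebesgue"
  shows "square_integrable V f"
proof -
  have m: "f \<in> borel_measurable (lebesgue_on V)"
    by (rule measurable_restrict_mono[OF _ assms(2)]) (use assms(1) in \<open>simp add: square_integrable_def\<close>)
  have "integrable (lebesgue_on U) (\<lambda>x. (norm (f x))\<^sup>2)" using assms by (simp add: square_integrable_def)
  then have "integrable (lebesgue_on V) (\<lambda>x. (norm (f x))\<^sup>2)"
    by (rule integrable_on_subset_lebesgue[OF _ assms(3,4,2)])
  with m show ?thesis by (simp add: square_integrable_def)
qed

lemma inner_integrable: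
  assumes f: "square_integrable U f" and g: "square_integrable U g"
  shows "integrable (lebesgue_on U) (\<lambda>x. f x \<bullet> g x)"
proof (rule Bochner_Integration.integrable_bound)
  show "integrable (lebesgue_on U) (\<lambda>x. (norm (f x))\<^sup>2 + (norm (g x))\<^sup>2)"
    using f g by (simp add: square_integrable_def)
  show "(\<lambda>x. f x \<bullet> g x) \<in> borel_measurable (lebesgue_on U)"
    using f g by (auto simp: square_integrable_def)
  have "\<bar>f x \<bullet> g x\<bar> \<le> (norm (f x))\<^sup>2 + (norm (g x))\<^sup>2" for x
  proof -
    have "\<bar>f x \<bullet> g x\<bar> \<le> norm (f x) * norm (g x)" by (rule Cauchy_Schwarz_ineq2)
    also have "\<dots> \<le> (norm (f x))\<^sup>2 + (norm (g x))\<^sup>2"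
      using sum_squares_bound[of "norm (f x)" "norm (g x)"] mult_nonneg_nonneg[of "norm (f x)" "norm (g x)"]
      by (simp del: mult_nonneg_nonneg)
    finally show ?thesis .
  qed
  then show "AE x in lebesgue_on U. norm (f x \<bullet> g x) \<le> norm ((norm (f x))\<^sup>2 + (norm (g x))\<^sup>2)"
    by (intro AE_I2) simp
qed

lemma l2_inner_commute: "l2_inner U f g = l2_inner U g f"
  by (simp add: l2_inner_def inner_commute)

lemma l2_inner_nonneg: "l2_inner U f f \<ge> 0"
  by (simp add: l2_inner_def)

abbreviation l2_sq :: "(real^2) set \<Rightarrow> (real^2 \<Rightarrow> 'a::euclidean_space) \<Rightarrow> real" where
  "l2_sq U f \<equiv> l2_inner U f f"

lemma l2_norm_sq: "(l2_norm U f)\<^sup>2 = l2_sq U f"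
  by (simp add: l2_norm_def l2_inner_nonneg)

lemma l2_inner_add_left:
  "square_integrable U f \<Longrightarrow> square_integrable U g \<Longrightarrow> square_integrable U h \<Longrightarrow>
   l2_inner U (\<lambda>x. f x + g x) h = l2_inner U f h + l2_inner U g h"
  by (simp add: l2_inner_def inner_add_left inner_integrable)

lemma l2_inner_diff_left:
  "square_integrable U f \<Longrightarrow> square_integrable U g \<Longrightarrow> square_integrable U h \<Longrightarrow>
   l2_inner U (\<lambda>x. f x - g x) h = l2_inner U f h - l2_inner U g h"
  by (simp add: l2_inner_def inner_diff_left inner_integrable)

lemma l2_inner_scaleR_left: "l2_inner U (\<lambda>x. c *\<^sub>R f x) h = c * l2_inner U f h"
  by (simp add: l2_inner_def)

lemma l2_inner_zero_left: "l2_inner U (\<lambda>x. 0) h = 0"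
  by (simp add: l2_inner_def)

lemma l2_inner_sum_left:
  assumes "\<And>i. i \<in> I \<Longrightarrow> square_integrable U (f i)" "square_integrable U h"
  shows "l2_inner U (\<lambda>x. \<Sum>i\<in>I. f i x) h = (\<Sum>i\<in>I. l2_inner U (f i) h)"
  using assms(1)
proof (induction I rule: infinite_finite_induct)
  case (insert i I)
  then show ?case
    using assms(2) by (simp add: l2_inner_add_left square_integrable_sum)
qed (auto simp: l2_inner_zero_left)

lemma l2_inner_cong_AE:
  assumes "AE x in lebesgue_on U. f x = f' x" "AE x in lebesgue_on U. g x = g' x"
    and "square_integrable U f" "square_integrable U f'" "square_integrable U g" "square_integrable U g'"
  shows "l2_inner U f g = l2_inner U f' g'"
  unfolding l2_inner_def
  by (rule integral_cong_AE) (use assms in \<open>auto simp: square_integrable_def\<close>)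

lemma l2_inner_self_eq_0:
  assumes "square_integrable U f" "l2_sq U f = 0"
  shows "AE x in lebesgue_on U. f x = 0"
proof -
  have "AE x in lebesgue_on U. f x \<bullet> f x = 0"
    using assms inner_integrable[OF assms(1,1)]
    by (subst integral_nonneg_eq_0_iff_AE[symmetric]) (auto simp: l2_inner_def)
  then show ?thesis by simp
qed

lemma l2_inner_eq_0_left:
  assumes "square_integrable U f" "l2_sq U f = 0" "square_integrable U g"
  shows "l2_inner U f g = 0"
  using l2_inner_cong_AE[OF l2_inner_self_eq_0[OF assms(1,2)] _ assms(1) square_integrable_zero assms(3,3)]
  by (simp add: l2_inner_zero_left)

lemma l2_inner_add_le:
  assumes "square_integrable U f" "square_integrable U g"
  shows "l2_sq U (\<lambda>x. f x + g x) \<le> 2 * l2_sq U f + 2 * l2_sq U g"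
proof -
  have "(\<integral>x. (f x + g x) \<bullet> (f x + g x) \<partial>(lebesgue_on U)) \<le> (\<integral>x. 2 * (f x \<bullet> f x) + 2 * (g x \<bullet> g x) \<partial>(lebesgue_on U))"
    using assms norm_sq_add_le unfolding power2_norm_eq_inner
    by (intro integral_mono inner_integrable square_integrable_add) (auto simp: inner_integrable)
  then show ?thesis using assms by (simp add: l2_inner_def inner_integrable)
qed

text \<open>
  Gram-Schmidt for a possibly degenerate family. The new function is made orthogonal to the old ones; if what
  remains has norm zero, it is orthogonal to everything and the coefficient may be zero, which is the value
  that division by zero gives.
\<close>

lemma l2_span_projection:
  assumes "finite I" "\<And>i. i \<in> I \<Longrightarrow> square_integrable U (e i)" "square_integrable U f"
  shows "\<exists>c. \<forall>j\<in>I. l2_inner U (\<lambda>x. f x - (\<Sum>i\<in>I. c i *\<^sub>R e i x)) (e j) = 0"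
  using assms
proof (induction I arbitrary: f rule: finite_induct)
  case (insert k I)
  have e: "square_integrable U (e i)" if "i \<in> insert k I" for i using insert.prems that by blast
  have s: "square_integrable U (\<lambda>x. \<Sum>i\<in>I. c i *\<^sub>R e i x)" for c
    by (intro square_integrable_sum square_integrable_scaleR e) auto
  obtain d where d: "\<And>j. j \<in> I \<Longrightarrow> l2_inner U (\<lambda>x. e k x - (\<Sum>i\<in>I. d i *\<^sub>R e i x)) (e j) = 0"
    using insert.IH[of "e k"] e by auto
  obtain c where c: "\<And>j. j \<in> I \<Longrightarrow> l2_inner U (\<lambda>x. f x - (\<Sum>i\<in>I. c i *\<^sub>R e i x)) (e j) = 0"
    using insert.IH[of f] e insert.prems(2) by auto
  define g where "g x = e k x - (\<Sum>i\<in>I. d i *\<^sub>R e i x)" for x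
  define r where "r x = f x - (\<Sum>i\<in>I. c i *\<^sub>R e i x)" for x
  have g: "square_integrable U g" and r: "square_integrable U r"
    unfolding g_def r_def using e s insert.prems(2) by (auto intro: square_integrable_diff)
  define t where "t = l2_inner U r g / l2_sq U g"
  have tg: "square_integrable U (\<lambda>x. t *\<^sub>R g x)" by (rule square_integrable_scaleR[OF g])
  have rt: "square_integrable U (\<lambda>x. r x - t *\<^sub>R g x)" by (rule square_integrable_diff[OF r tg])
  have og: "l2_inner U (\<lambda>x. r x - t *\<^sub>R g x) g = 0"
    unfolding l2_inner_diff_left[OF r tg g] l2_inner_scaleR_left
    using l2_inner_eq_0_left[OF g _ r] l2_inner_commute[of U r g]
    by (cases "l2_sq U g = 0") (auto simp: t_def)
  have oI: "l2_inner U (\<lambda>x. r x - t *\<^sub>R g x) (e j) = 0" if "j \<in> I" for j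
    using c[OF that] d[OF that] that
    by (simp add: l2_inner_diff_left[OF r tg e] l2_inner_scaleR_left g_def[symmetric] r_def[symmetric])
  have ok: "l2_inner U (\<lambda>x. r x - t *\<^sub>R g x) (e k) = 0"
  proof -
    have "e k = (\<lambda>x. g x + (\<Sum>i\<in>I. d i *\<^sub>R e i x))" by (simp add: g_def)
    then have "l2_inner U (\<lambda>x. r x - t *\<^sub>R g x) (e k)
        = l2_inner U (\<lambda>x. g x + (\<Sum>i\<in>I. d i *\<^sub>R e i x)) (\<lambda>x. r x - t *\<^sub>R g x)"
      by (metis l2_inner_commute)
    also have "\<dots> = l2_inner U g (\<lambda>x. r x - t *\<^sub>R g x)
        + (\<Sum>i\<in>I. l2_inner U (\<lambda>x. d i *\<^sub>R e i x) (\<lambda>x. r x - t *\<^sub>R g x))"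
      using rt e by (simp add: l2_inner_add_left[OF g s rt] l2_inner_sum_left square_integrable_scaleR)
    also have "\<dots> = 0"
      using og oI by (simp add: l2_inner_scaleR_left l2_inner_commute[of U _ "\<lambda>x. r x - t *\<^sub>R g x"])
    finally show ?thesis .
  qed
  let ?c = "\<lambda>i. if i = k then t else c i - t * d i"
  have "f x - (\<Sum>i\<in>insert k I. ?c i *\<^sub>R e i x) = r x - t *\<^sub>R g x" for x
  proof -
    have "(\<Sum>i\<in>I. ?c i *\<^sub>R e i x) = (\<Sum>i\<in>I. c i *\<^sub>R e i x - t *\<^sub>R (d i *\<^sub>R e i x))"
      using insert.hyps by (intro sum.cong) (auto simp: algebra_simps)
    then show ?thesis
      using insert.hyps by (simp add: g_def r_def sum_subtractf scaleR_sum_right algebra_simps)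
  qed
  then show ?case using ok oI by (intro exI[of _ ?c]) auto
qed simp

section \<open>Polynomials\<close>

lemma finite_degree_index: "finite {(i, j). i + j \<le> (n::nat)}"
  by (rule finite_subset[of _ "{..n} \<times> {..n}"]) auto

lemma polys_monomial:
  assumes "i + j \<le> n"
  shows "(\<lambda>x. (x $ 1 ^ i * x $ 2 ^ j) *\<^sub>R c) \<in> polys n"
proof -
  have "(\<Sum>(i', j')\<in>{(i, j). i + j \<le> n}. (x $ 1 ^ i' * x $ 2 ^ j') *\<^sub>R (if i' = i \<and> j' = j then c else 0))
      = (x $ 1 ^ i * x $ 2 ^ j) *\<^sub>R c" for x :: "real^2"
    using assms
    by (subst sum.remove[OF finite_degree_index, of "(i, j)"]) (auto intro!: sum.neutral split: if_splits)
  then show ?thesis unfolding polys_def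
    by (intro CollectI exI[of _ "\<lambda>i' j'. if i' = i \<and> j' = j then c else 0"]) simp
qed

lemma polys_zero: "(\<lambda>x. 0) \<in> polys n"
  unfolding polys_def by (intro CollectI exI[of _ "\<lambda>i j. 0"]) simp

lemma polys_add:
  assumes "p \<in> polys n" "q \<in> polys n"
  shows "(\<lambda>x. p x + q x) \<in> polys n"
proof -
  obtain c d where "p = (\<lambda>x. \<Sum>(i, j)\<in>{(i, j). i + j \<le> n}. (x $ 1 ^ i * x $ 2 ^ j) *\<^sub>R c i j)"
     "q = (\<lambda>x. \<Sum>(i, j)\<in>{(i, j). i + j \<le> n}. (x $ 1 ^ i * x $ 2 ^ j) *\<^sub>R d i j)"
    using assms by (auto simp: polys_def)
  then have "(\<lambda>x. p x + q x) = (\<lambda>x. \<Sum>(i, j)\<in>{(i, j). i + j \<le> n}. (x $ 1 ^ i * x $ 2 ^ j) *\<^sub>R (c i j + d i j))"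
    by (auto simp: sum.distrib[symmetric] scaleR_add_right intro!: ext sum.cong)
  then show ?thesis unfolding polys_def by (intro CollectI exI[of _ "\<lambda>i j. c i j + d i j"])
qed

lemma polys_sum: "(\<And>i. i \<in> I \<Longrightarrow> p i \<in> polys n) \<Longrightarrow> (\<lambda>x. \<Sum>i\<in>I. p i x) \<in> polys n"
  by (induction I rule: infinite_finite_induct) (auto simp: polys_zero intro: polys_add)

lemma polys_induct [consumes 1, case_names zero add monomial]:
  assumes "p \<in> polys n" "P (\<lambda>x. 0)"
    and "\<And>p q. p \<in> polys n \<Longrightarrow> q \<in> polys n \<Longrightarrow> P p \<Longrightarrow> P q \<Longrightarrow> P (\<lambda>x. p x + q x)"
    and "\<And>i j c. i + j \<le> n \<Longrightarrow> P (\<lambda>x. (x $ 1 ^ i * x $ 2 ^ j) *\<^sub>R c)"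
  shows "P p"
proof -
  obtain c where p: "p = (\<lambda>x. \<Sum>(i, j)\<in>{(i, j). i + j \<le> n}. (x $ 1 ^ i * x $ 2 ^ j) *\<^sub>R c i j)"
    using assms(1) by (auto simp: polys_def)
  have "I \<subseteq> {(i, j). i + j \<le> n} \<Longrightarrow>
      (\<lambda>x. \<Sum>(i, j)\<in>I. (x $ 1 ^ i * x $ 2 ^ j) *\<^sub>R c i j) \<in> polys n \<and>
      P (\<lambda>x. \<Sum>(i, j)\<in>I. (x $ 1 ^ i * x $ 2 ^ j) *\<^sub>R c i j)" if "finite I" for I
    using that
  proof (induction I rule: finite_induct)
    case empty
    then show ?case using assms(2) by (simp add: polys_zero)
  next
    case (insert ij I)
    obtain i j where ij: "ij = (i, j)" by (cases ij)
    then have le: "i + j \<le> n" using insert.prems by simp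
    have IH: "(\<lambda>x. \<Sum>(i, j)\<in>I. (x $ 1 ^ i * x $ 2 ^ j) *\<^sub>R c i j) \<in> polys n"
       "P (\<lambda>x. \<Sum>(i, j)\<in>I. (x $ 1 ^ i * x $ 2 ^ j) *\<^sub>R c i j)"
      using insert by auto
    have "(\<lambda>x. \<Sum>(i, j)\<in>insert ij I. (x $ 1 ^ i * x $ 2 ^ j) *\<^sub>R c i j)
        = (\<lambda>x::real^2. (x $ 1 ^ i * x $ 2 ^ j) *\<^sub>R c i j + (\<Sum>(i, j)\<in>I. (x $ 1 ^ i * x $ 2 ^ j) *\<^sub>R c i j))"
      using insert.hyps ij by simp
    then show ?case
      using polys_add[OF polys_monomial[OF le] IH(1)] assms(3)[OF polys_monomial[OF le] IH(1) assms(4)[OF le] IH(2)]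
      by simp
  qed
  then show ?thesis using finite_degree_index p by blast
qed

lemma polys_smooth: "p \<in> polys n \<Longrightarrow> smooth p"
  by (induction rule: polys_induct) (auto intro!: smooth_scaleR smooth_mult smooth_power smooth_nth)

lemma polys_bounded_linear:
  assumes L: "bounded_linear L" and p: "p \<in> polys n"
  shows "(\<lambda>x. L (p x)) \<in> polys n"
  using p
proof (induction rule: polys_induct)
  case zero
  then show ?case using polys_zero by (simp add: linear_simps[OF L])
next
  case (add p q)
  then show ?case using polys_add[of "\<lambda>x. L (p x)" n "\<lambda>x. L (q x)"] by (simp add: linear_simps[OF L])
next
  case (monomial i j c)
  then show ?case using polys_monomial[of i j n "L c"] by (simp add: linear_simps[OF L])
qed

lemma polys_scaleR:
  fixes p :: "real^2 \<Rightarrow> 'a::real_normed_vector"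
  shows "p \<in> polys n \<Longrightarrow> (\<lambda>x. c *\<^sub>R p x) \<in> polys n"
  by (rule polys_bounded_linear[OF bounded_linear_scaleR_right])

lemma polys_diff:
  fixes p :: "real^2 \<Rightarrow> 'a::real_normed_vector"
  shows "p \<in> polys n \<Longrightarrow> q \<in> polys n \<Longrightarrow> (\<lambda>x. p x - q x) \<in> polys n"
  using polys_add[of p n "\<lambda>x. (-1) *\<^sub>R q x"] polys_scaleR[of q n "-1"] by simp

lemma polys_mono:
  assumes "p \<in> polys m" "m \<le> n"
  shows "p \<in> polys n"
  using assms(1)
proof (induction rule: polys_induct)
  case (monomial i j c)
  then show ?case using assms(2) by (intro polys_monomial) simp
qed (auto intro: polys_zero polys_add)

lemma polys_const: "(\<lambda>x. c) \<in> polys n"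
  using polys_monomial[of 0 0 n c] by simp

lemma partial_deriv_add:
  "f differentiable at x \<Longrightarrow> g differentiable at x \<Longrightarrow>
   partial_deriv j (\<lambda>x. f x + g x) x = partial_deriv j f x + partial_deriv j g x"
  by (subst partial_deriv_eq[OF has_derivative_add]) (auto simp: frechet_derivative_works[symmetric] partial_deriv_def)

lemma partial_deriv_monomial:
  "partial_deriv 1 (\<lambda>x. (x $ 1 ^ i * x $ 2 ^ j) *\<^sub>R c) = (\<lambda>x. (x $ 1 ^ (i - 1) * x $ 2 ^ j) *\<^sub>R (real i *\<^sub>R c))"
  "partial_deriv 2 (\<lambda>x. (x $ 1 ^ i * x $ 2 ^ j) *\<^sub>R c) = (\<lambda>x. (x $ 1 ^ i * x $ 2 ^ (j - 1)) *\<^sub>R (real j *\<^sub>R c))"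
proof -
  have d: "((\<lambda>x. (x $ 1 ^ i * x $ 2 ^ j) *\<^sub>R c) has_derivative
     (\<lambda>h. (x $ 1 ^ i * (real j * (h $ 2) * x $ 2 ^ (j - 1)) + real i * (h $ 1) * x $ 1 ^ (i - 1) * x $ 2 ^ j) *\<^sub>R c)) (at x)"
    for x :: "real^2"
  proof -
    have n: "((\<lambda>x. x $ k) has_derivative (\<lambda>h. h $ k)) (at x)" for k
      by (rule bounded_linear_imp_has_derivative[OF bounded_linear_vec_nth])
    show ?thesis
      by (rule has_derivative_scaleR_left[OF has_derivative_mult[OF has_derivative_power[OF n] has_derivative_power[OF n]]])
  qed
  show "partial_deriv 1 (\<lambda>x. (x $ 1 ^ i * x $ 2 ^ j) *\<^sub>R c) = (\<lambda>x. (x $ 1 ^ (i - 1) * x $ 2 ^ j) *\<^sub>R (real i *\<^sub>R c))"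
    "partial_deriv 2 (\<lambda>x. (x $ 1 ^ i * x $ 2 ^ j) *\<^sub>R c) = (\<lambda>x. (x $ 1 ^ i * x $ 2 ^ (j - 1)) *\<^sub>R (real j *\<^sub>R c))"
    by (auto intro!: ext simp: partial_deriv_eq[OF d] axis_def mult.commute)
qed

lemma partial_deriv_polys:
  assumes "p \<in> polys n"
  shows "partial_deriv k p \<in> polys (n - 1)"
  using assms
proof (induction rule: polys_induct)
  case zero
  have "partial_deriv k (\<lambda>x. 0 :: 'a) = (\<lambda>x. 0)" by (rule ext, subst partial_deriv_eq[OF has_derivative_const]) simp
  then show ?case by (simp add: polys_zero)
next
  case (add p q)
  have "partial_deriv k (\<lambda>x. p x + q x) = (\<lambda>x. partial_deriv k p x + partial_deriv k q x)"
    using add smooth_differentiable[OF polys_smooth] by (intro ext partial_deriv_add)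
  then show ?case using add polys_add by metis
next
  case (monomial i j c)
  have "k = 1 \<or> k = 2" by (rule exhaust_2)
  moreover have "(\<lambda>x. (x $ 1 ^ (i - 1) * x $ 2 ^ j) *\<^sub>R (real i *\<^sub>R c)) \<in> polys (n - 1)"
  proof (cases i)
    case (Suc m)
    then show ?thesis using monomial by (intro polys_monomial) simp
  qed (simp add: polys_zero)
  moreover have "(\<lambda>x. (x $ 1 ^ i * x $ 2 ^ (j - 1)) *\<^sub>R (real j *\<^sub>R c)) \<in> polys (n - 1)"
  proof (cases j)
    case (Suc m)
    then show ?thesis using monomial by (intro polys_monomial) simp
  qed (simp add: polys_zero)
  ultimately show ?case by (auto simp: partial_deriv_monomial)
qed

lemma polys_along_line:
  assumes "p \<in> polys n"
  shows "\<exists>q :: real poly. \<forall>t. p (a + t *\<^sub>R d) \<bullet> b = poly q t"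
  using assms
proof (induction rule: polys_induct)
  case zero
  show ?case by (rule exI[of _ 0]) simp
next
  case (add p q)
  then obtain P Q where "\<forall>t. p (a + t *\<^sub>R d) \<bullet> b = poly P t" "\<forall>t. q (a + t *\<^sub>R d) \<bullet> b = poly Q t" by blast
  then show ?case by (intro exI[of _ "P + Q"]) (simp add: inner_add_left)
next
  case (monomial i j c)
  show ?case
    by (rule exI[of _ "[:a $ 1, d $ 1:] ^ i * [:a $ 2, d $ 2:] ^ j * [:c \<bullet> b:]"]) (simp add: algebra_simps)
qed

text \<open>
  On the line joining an inner point of \<open>U\<close> with an arbitrary point, a component of \<open>p\<close> is a
  one-variable polynomial with infinitely many roots. Consequently a projection onto polynomials is unique as
  a function on the whole plane, although the inner product sees only its values on \<open>U\<close>.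
\<close>

lemma polys_zero_on_open:
  fixes p :: "real^2 \<Rightarrow> 'a::euclidean_space"
  assumes p: "p \<in> polys n" and U: "open U" "U \<noteq> {}" and z: "\<And>x. x \<in> U \<Longrightarrow> p x = 0"
  shows "p = (\<lambda>x. 0)"
proof
  fix x
  obtain a e where a: "e > 0" "ball a e \<subseteq> U" using U open_contains_ball by blast
  show "p x = 0"
  proof (rule euclidean_eqI)
    fix b :: 'a
    obtain q where q: "\<And>t. p (a + t *\<^sub>R (x - a)) \<bullet> b = poly q t" using polys_along_line[OF p] by blast
    define s where "s = e / (norm (x - a) + 1)"
    have n: "norm (x - a) + 1 > 0" using norm_ge_zero[of "x - a"] by linarith
    then have s: "s > 0" using a by (simp add: s_def)
    have "poly q t = 0" if t: "t \<in> {0<..<s}" for t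
    proof -
      have "t * (norm (x - a) + 1) < e" using t n by (simp add: s_def pos_less_divide_eq)
      then have "t * norm (x - a) < e" using t by (simp add: algebra_simps)
      then have "a + t *\<^sub>R (x - a) \<in> ball a e" using t by (simp add: dist_norm)
      then show ?thesis using q[of t] z a(2) by auto
    qed
    then have "{0<..<s} \<subseteq> {t. poly q t = 0}" by blast
    then have "infinite {t. poly q t = 0}"
      using infinite_Ioo[OF s] finite_subset by blast
    then have "q = 0" using poly_roots_finite by blast
    then show "p x \<bullet> b = 0 \<bullet> b" using q[of 1] by simp
  qed
qed

lemma continuous_square_integrable:
  fixes f :: "real^2 \<Rightarrow> 'a::euclidean_space"
  assumes "bounded U" "U \<in> sets lebesgue" "continuous_on UNIV f"
  shows "square_integrable U f"
proof -
  have c: "compact (closure U)" using assms(1) by (simp add: compact_closure)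
  then have cl: "closure U \<in> sets lebesgue" by simp
  have sq: "continuous_on UNIV (\<lambda>x. (norm (f x))\<^sup>2)" using assms(3) by (intro continuous_intros)
  have "integrable (lebesgue_on (closure U)) (\<lambda>x. (norm (f x))\<^sup>2)"
    using continuous_locally_integrable[OF sq, of UNIV] c by (simp add: locally_integrable_def)
  then have "integrable (lebesgue_on U) (\<lambda>x. (norm (f x))\<^sup>2)"
    by (rule integrable_on_subset_lebesgue[OF _ cl assms(2) closure_subset])
  moreover have "f \<in> borel_measurable (lebesgue_on U)"
    using assms continuous_on_subset by (intro continuous_imp_measurable_on_sets_lebesgue) auto
  ultimately show ?thesis by (simp add: square_integrable_def)
qed

section \<open>Projections and Sobolev functions on a bounded open set\<close>

lemma borel_measurable_on_AE:
  fixes f :: "real^2 \<Rightarrow> 'a::euclidean_space"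
  assumes U: "U \<in> sets lebesgue" and f: "f \<in> borel_measurable (lebesgue_on U)"
    and ae: "AE x in lebesgue_on U. f x = g x"
  shows "g \<in> borel_measurable (lebesgue_on U)"
proof -
  have s: "U \<inter> space lebesgue \<in> sets lebesgue" using U by simp
  have "(\<lambda>x. indicator U x *\<^sub>R f x) \<in> borel_measurable lebesgue"
    using f unfolding borel_measurable_restrict_space_iff[OF s] .
  moreover have "AE x in lebesgue. indicator U x *\<^sub>R f x = indicator U x *\<^sub>R g x"
    using ae unfolding AE_restrict_space_iff[OF s] by (auto elim!: eventually_mono simp: indicator_def)
  ultimately have "(\<lambda>x. indicator U x *\<^sub>R g x) \<in> borel_measurable lebesgue"
    by (rule borel_measurable_AE)
  then show ?thesis unfolding borel_measurable_restrict_space_iff[OF s] .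
qed

lemma jacobian_diff:
  fixes f g :: "real^2 \<Rightarrow> real^2"
  shows "f differentiable (at x) \<Longrightarrow> g differentiable (at x) \<Longrightarrow>
   jacobian (\<lambda>x. f x - g x) (at x) = jacobian f (at x) - jacobian g (at x)"
  unfolding column_eq_iff column_diff column_jacobian
  by (subst partial_deriv_eq[OF has_derivative_diff]) (auto simp: frechet_derivative_works[symmetric] partial_deriv_def)

lemma jacobian_add:
  fixes f g :: "real^2 \<Rightarrow> real^2"
  shows "f differentiable (at x) \<Longrightarrow> g differentiable (at x) \<Longrightarrow>
   jacobian (\<lambda>x. f x + g x) (at x) = jacobian f (at x) + jacobian g (at x)"
  by (auto simp: vec_eq_iff jacobian_nth partial_deriv_add)

lemma partial_deriv_const: "partial_deriv j (\<lambda>x. c) = (\<lambda>x. 0)"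
  by (rule ext, subst partial_deriv_eq[OF has_derivative_const]) simp

lemma jacobian_const: "jacobian (\<lambda>x::real^2. c::real^2) (at x) = 0"
  by (simp add: vec_eq_iff jacobian_nth partial_deriv_const)

lemma continuous_jacobian:
  fixes f :: "real^2 \<Rightarrow> real^2"
  assumes "smooth f"
  shows "continuous_on S (\<lambda>x. jacobian f (at x))"
proof -
  have eq: "jacobian f (at x) = (\<chi> i j. partial_deriv j f x $ i)" for x
    using smooth_differentiable[OF assms] by (auto simp: vec_eq_iff jacobian_nth)
   have "continuous_on S (\<lambda>x. \<chi> i j. partial_deriv j f x $ i)"
    by (intro continuous_on_vec_lambda continuous_on_component smooth_continuous_on smooth_partial assms)
  then show ?thesis unfolding eq .
qed

lemma jacobian_polys:
  fixes p :: "real^2 \<Rightarrow> real^2"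
  assumes "p \<in> polys n"
  shows "(\<lambda>x. jacobian p (at x)) \<in> polys (n - 1)"
proof -
  have "(\<lambda>x. jacobian p (at x)) = (\<lambda>x. \<Sum>j\<in>UNIV. (\<chi> i k. if k = j then partial_deriv j p x $ i else 0))"
    using smooth_differentiable[OF polys_smooth[OF assms]] by (auto simp: vec_eq_iff jacobian_nth)
  moreover have "(\<lambda>x. (\<chi> i k. if k = j then partial_deriv j p x $ i else 0)) \<in> polys (n - 1)" for j :: 2
  proof (rule polys_bounded_linear[OF _ partial_deriv_polys[OF assms]])
    have "linear (\<lambda>v::real^2. (\<chi> i k. if k = j then v $ i else 0))"
      by (rule linearI) (auto simp: vec_eq_iff)
    then show "bounded_linear (\<lambda>v::real^2. (\<chi> i k. if k = j then v $ i else 0))"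
      by (simp add: linear_conv_bounded_linear)
  qed
  ultimately show ?thesis by (simp only:) (rule polys_sum)
qed

text \<open>
  The setting of the projections: boundedness makes smooth functions square integrable, openness and
  nonemptiness make the \<open>L\<^sup>2\<close> norm a norm on polynomials.
\<close>

locale bounded_open_set =
  fixes U :: "(real^2) set"
  assumes U: "open U" "bounded U" "U \<noteq> {}"
begin

lemma U_sets: "U \<in> sets lebesgue"
  using U(1) by simp

lemma sqint_continuous: "continuous_on UNIV f \<Longrightarrow> square_integrable U f" for f :: "real^2 \<Rightarrow> 'a::euclidean_space"
  by (rule continuous_square_integrable[OF U(2) U_sets])

lemma sqint_smooth: "smooth f \<Longrightarrow> square_integrable U f" for f :: "real^2 \<Rightarrow> 'a::euclidean_space"
  by (rule sqint_continuous[OF smooth_continuous_on])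

lemma sqint_polys: "f \<in> polys n \<Longrightarrow> square_integrable U f" for f :: "real^2 \<Rightarrow> 'a::euclidean_space"
  by (rule sqint_smooth[OF polys_smooth])

lemma continuous_AE_zero:
  fixes f :: "real^2 \<Rightarrow> 'a::euclidean_space"
  assumes c: "continuous_on UNIV f" and z: "AE x in lebesgue_on U. f x = 0" and x: "x \<in> U"
  shows "f x = 0"
proof -
  have "AE x in lebesgue. x \<notin> {x\<in>U. f x \<noteq> 0}"
    using z U_sets by (subst (asm) AE_restrict_space_iff) (auto elim: eventually_mono)
  moreover have "open ({x. f x \<noteq> 0} \<inter> U)"
    using open_Collect_neq[OF c continuous_on_const] U(1) by (rule open_Int)
  moreover have "{x\<in>U. f x \<noteq> 0} = {x. f x \<noteq> 0} \<inter> U" by auto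
  ultimately have o: "open {x\<in>U. f x \<noteq> 0}" and ae: "AE x in lebesgue. x \<notin> {x\<in>U. f x \<noteq> 0}" by simp_all
  have "{x\<in>U. f x \<noteq> 0} \<in> null_sets lebesgue" using ae o by (subst AE_iff_null_sets) auto
  then have "negligible {x\<in>U. f x \<noteq> 0}" by (simp add: negligible_iff_null_sets)
  then have "{x\<in>U. f x \<noteq> 0} = {}" using open_not_negligible[OF o] by blast
  then show ?thesis using x by blast
qed

lemma polys_l2_zero:
  fixes p :: "real^2 \<Rightarrow> 'a::euclidean_space"
  assumes "p \<in> polys n" "l2_sq U p = 0"
  shows "p = (\<lambda>x. 0)"
  using continuous_AE_zero[OF smooth_continuous_on[OF polys_smooth[OF assms(1)]]
      l2_inner_self_eq_0[OF sqint_polys[OF assms(1)] assms(2)]]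
  by (rule polys_zero_on_open[OF assms(1) U(1,3)])

text \<open>
  Both projections of the method, onto polynomials (\<open>D\<close> the identity) and onto gradients of polynomials (\<open>D\<close> the
  Jacobian), are instances. Polynomials have vector coefficients; over the reals they are spanned by the
  finitely many products of a monomial with a basis vector, to which the Gram-Schmidt lemma applies.
\<close>

lemma projection_onto_image_of_polys:
  fixes D :: "(real^2 \<Rightarrow> 'a::euclidean_space) \<Rightarrow> real^2 \<Rightarrow> 'b::euclidean_space"
  assumes sq: "\<And>q. q \<in> polys n \<Longrightarrow> square_integrable U (D q)" and G: "square_integrable U G"
    and lin: "\<And>(I :: ((nat \<times> nat) \<times> 'a) set) h c x. (\<And>s. s \<in> I \<Longrightarrow> h s \<in> polys n) \<Longrightarrow>
      D (\<lambda>x. \<Sum>s\<in>I. c s *\<^sub>R h s x) x = (\<Sum>s\<in>I. c s *\<^sub>R D (h s) x)"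
  shows "\<exists>p\<in>polys n. \<forall>q\<in>polys n. l2_inner U (D q) (\<lambda>x. G x - D p x) = 0"
proof -
  let ?I = "{(i, j). i + j \<le> n} \<times> (Basis :: 'a set)"
  let ?m = "\<lambda>((i, j), b) (x::real^2). (x $ 1 ^ i * x $ 2 ^ j) *\<^sub>R (b::'a)"
  have m: "?m s \<in> polys n" if "s \<in> ?I" for s using that by (auto intro: polys_monomial)
  have "\<exists>c. \<forall>t\<in>?I. l2_inner U (\<lambda>x. G x - (\<Sum>s\<in>?I. c s *\<^sub>R D (?m s) x)) (D (?m t)) = 0"
    by (rule l2_span_projection[OF _ sq[OF m] G]) (simp_all add: finite_degree_index)
  then obtain c where c: "\<And>t. t \<in> ?I \<Longrightarrow> l2_inner U (\<lambda>x. G x - (\<Sum>s\<in>?I. c s *\<^sub>R D (?m s) x)) (D (?m t)) = 0"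
    by blast
  let ?p = "\<lambda>x. \<Sum>s\<in>?I. c s *\<^sub>R ?m s x"
  have p: "?p \<in> polys n" by (intro polys_sum polys_scaleR m)
  have Dp: "D ?p x = (\<Sum>s\<in>?I. c s *\<^sub>R D (?m s) x)" for x by (rule lin[OF m])
  let ?r = "\<lambda>x. G x - D ?p x"
  have r: "square_integrable U ?r" by (intro square_integrable_diff G sq p)
  have orth: "l2_inner U (D (?m t)) ?r = 0" if "t \<in> ?I" for t
    unfolding Dp using c[OF that] by (simp only: l2_inner_commute)
  have "l2_inner U (D q) ?r = 0" if q: "q \<in> polys n" for q
  proof -
    obtain d where d: "q = (\<lambda>x. \<Sum>(i, j)\<in>{(i, j). i + j \<le> n}. (x $ 1 ^ i * x $ 2 ^ j) *\<^sub>R d i j)"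
      using q by (auto simp: polys_def)
    define e where "e s = (case s of ((i, j), b) \<Rightarrow> d i j \<bullet> b)" for s
    have eq: "q = (\<lambda>x. \<Sum>s\<in>?I. e s *\<^sub>R ?m s x)"
    proof
      fix x
      have "(x $ 1 ^ i * x $ 2 ^ j) *\<^sub>R d i j = (\<Sum>b\<in>Basis. e ((i, j), b) *\<^sub>R ?m ((i, j), b) x)" for i j
        using arg_cong[OF euclidean_representation[of "d i j", symmetric], of "\<lambda>v. (x $ 1 ^ i * x $ 2 ^ j) *\<^sub>R v"]
        by (simp add: e_def scaleR_sum_right mult.commute)
      then have "q x = (\<Sum>ij\<in>{(i, j). i + j \<le> n}. \<Sum>b\<in>Basis. e (ij, b) *\<^sub>R ?m (ij, b) x)"
        unfolding d by (intro sum.cong) auto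
      then show "q x = (\<Sum>s\<in>?I. e s *\<^sub>R ?m s x)" by (simp add: sum.cartesian_product case_prod_unfold)
    qed
    have Dq: "D q = (\<lambda>x. \<Sum>s\<in>?I. e s *\<^sub>R D (?m s) x)"
      using arg_cong[OF eq, of "\<lambda>q. D q x" for x] lin[OF m] by (intro ext) (rule trans)
    have "l2_inner U (D q) ?r = (\<Sum>s\<in>?I. l2_inner U (\<lambda>x. e s *\<^sub>R D (?m s) x) ?r)"
      unfolding Dq by (rule l2_inner_sum_left[OF square_integrable_scaleR[OF sq[OF m]] r])
    also have "\<dots> = 0" using orth by (intro sum.neutral ballI) (simp only: l2_inner_scaleR_left mult_zero_right)
    finally show ?thesis .
  qed
  then show ?thesis using p by blast
qed

lemma l2_projection_exists:
  fixes f :: "real^2 \<Rightarrow> 'a::euclidean_space"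
  assumes f: "square_integrable U f"
  shows "\<exists>p\<in>polys n. \<forall>q\<in>polys n. l2_inner U (\<lambda>x. f x - p x) q = 0"
  using projection_onto_image_of_polys[of n "\<lambda>q. q" f, OF sqint_polys f refl] by (simp add: l2_inner_commute)

lemma l2_proj_eqI:
  fixes f :: "real^2 \<Rightarrow> 'a::euclidean_space"
  assumes f: "square_integrable U f" and p: "p \<in> polys n" "\<And>q. q \<in> polys n \<Longrightarrow> l2_inner U (\<lambda>x. f x - p x) q = 0"
  shows "l2_proj n U f = p"
  unfolding l2_proj_def
proof (rule the_equality)
  show "p \<in> polys n \<and> (\<forall>q\<in>polys n. l2_inner U (\<lambda>x. f x - p x) q = 0)" using p by blast
  fix p' assume p': "p' \<in> polys n \<and> (\<forall>q\<in>polys n. l2_inner U (\<lambda>x. f x - p' x) q = 0)"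
  have d: "(\<lambda>x. p' x - p x) \<in> polys n" using p(1) p' by (blast intro: polys_diff)
  have s: "square_integrable U (\<lambda>x. f x - p x)" "square_integrable U (\<lambda>x. f x - p' x)" "square_integrable U (\<lambda>x. p' x - p x)"
    using f p(1) p' d sqint_polys by (auto intro: square_integrable_diff)
  have "l2_inner U (\<lambda>x. (f x - p x) - (f x - p' x)) (\<lambda>x. p' x - p x) = 0"
    using p(2)[OF d] p' d by (subst l2_inner_diff_left[OF s]) auto
  then have "(\<lambda>x. p' x - p x) = (\<lambda>x. 0)" by (intro polys_l2_zero[OF d]) simp
  then show "p' = p" by (simp add: fun_eq_iff)
qed

lemma l2_proj_polys:
  fixes f :: "real^2 \<Rightarrow> 'a::euclidean_space"
  assumes "square_integrable U f" shows "l2_proj n U f \<in> polys n"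
proof -
  obtain p where "p \<in> polys n" "\<And>q. q \<in> polys n \<Longrightarrow> l2_inner U (\<lambda>x. f x - p x) q = 0"
    using l2_projection_exists[OF assms] by blast
  then show ?thesis using l2_proj_eqI[OF assms] by simp
qed

lemma l2_proj_orthogonal:
  fixes f :: "real^2 \<Rightarrow> 'a::euclidean_space"
  assumes "square_integrable U f" "q \<in> polys n"
  shows "l2_inner U (\<lambda>x. f x - l2_proj n U f x) q = 0"
proof -
  obtain p where "p \<in> polys n" "\<And>q. q \<in> polys n \<Longrightarrow> l2_inner U (\<lambda>x. f x - p x) q = 0"
    using l2_projection_exists[OF assms(1)] by blast
  then show ?thesis using l2_proj_eqI[OF assms(1)] assms(2) by simp
qed

lemma l2_orthogonal_add:
  fixes f :: "real^2 \<Rightarrow> 'a::euclidean_space"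
  assumes f: "square_integrable U f" and g: "square_integrable U g" and o: "l2_inner U f g = 0"
  shows "l2_sq U (\<lambda>x. f x + g x) = l2_sq U f + l2_sq U g"
proof -
  have s: "square_integrable U (\<lambda>x. f x + g x)" by (rule square_integrable_add[OF f g])
  show ?thesis
    using o by (simp add: l2_inner_add_left[OF f g s] l2_inner_commute[of U _ "\<lambda>x. f x + g x"]
        l2_inner_add_left[OF f g f] l2_inner_add_left[OF f g g] l2_inner_commute[of U g f])
qed

lemma l2_proj_pythagoras:
  fixes f :: "real^2 \<Rightarrow> 'a::euclidean_space"
  assumes f: "square_integrable U f"
  shows "l2_sq U f = l2_sq U (l2_proj n U f)
     + l2_sq U (\<lambda>x. f x - l2_proj n U f x)"
proof -
  note p = l2_proj_polys[OF f, of n]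
  note s = sqint_polys[OF p]
  show ?thesis
    using l2_orthogonal_add[OF s square_integrable_diff[OF f s]] l2_proj_orthogonal[OF f p]
    by (simp add: l2_inner_commute)
qed

lemma l2_proj_best:
  fixes f :: "real^2 \<Rightarrow> 'a::euclidean_space"
  assumes f: "square_integrable U f" and q: "q \<in> polys n"
  shows "l2_sq U (\<lambda>x. f x - l2_proj n U f x) \<le> l2_sq U (\<lambda>x. f x - q x)"
proof -
  note p = l2_proj_polys[OF f, of n]
  have d: "(\<lambda>x. l2_proj n U f x - q x) \<in> polys n" by (rule polys_diff[OF p q])
  have "l2_sq U (\<lambda>x. (f x - l2_proj n U f x) + (l2_proj n U f x - q x))
     = l2_sq U (\<lambda>x. f x - l2_proj n U f x)
      + l2_sq U (\<lambda>x. l2_proj n U f x - q x)"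
    by (rule l2_orthogonal_add[OF square_integrable_diff[OF f sqint_polys[OF p]] sqint_polys[OF d] l2_proj_orthogonal[OF f d]])
  then show ?thesis using l2_inner_nonneg[of U "\<lambda>x. l2_proj n U f x - q x"] by simp
qed

lemma l2_proj_residual:
  fixes f :: "real^2 \<Rightarrow> 'a::euclidean_space"
  assumes f: "square_integrable U f"
  shows "l2_proj n U (\<lambda>x. f x - l2_proj n U f x) = (\<lambda>x. 0)"
  by (rule l2_proj_eqI[OF square_integrable_diff[OF f sqint_polys[OF l2_proj_polys[OF f]]] polys_zero])
     (simp add: l2_proj_orthogonal[OF f])

subsection \<open>Sobolev functions\<close>

lemma H1_sqint: "u \<in> H1 U \<Longrightarrow> square_integrable U u"
  by (simp add: H1_def)

lemma H1_has_weak_grad: "u \<in> H1 U \<Longrightarrow> has_weak_grad U u (weak_grad U u)"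
  unfolding H1_def using has_weak_grad_weak_grad by blast

lemma weak_grad_eqI:
  assumes "has_weak_grad U u G"
  shows "AE x in lebesgue_on U. weak_grad U u x = G x"
  by (rule weak_grad_AE[OF U(1) assms])

text \<open>
  Some weak gradient is square integrable by definition; the one that is selected agrees with it almost
  everywhere and is measurable because Lebesgue measure is complete.
\<close>

lemma H1_weak_grad_sqint:
  assumes "u \<in> H1 U" shows "square_integrable U (weak_grad U u)"
proof -
  obtain G where G: "has_weak_grad U u G" "square_integrable U G" using assms by (auto simp: H1_def)
  note ae = weak_grad_eqI[OF G(1)]
  have "weak_grad U u \<in> borel_measurable (lebesgue_on U)"
    by (rule borel_measurable_on_AE[OF U_sets, of G]) (use G(2) ae in \<open>auto simp: square_integrable_def\<close>)
  from square_integrable_cong_AE[OF G(2) this ae] show ?thesis .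
qed

lemma H1_diff:
  assumes "u \<in> H1 U" "v \<in> H1 U"
  shows "(\<lambda>x. u x - v x) \<in> H1 U"
    and "AE x in lebesgue_on U. weak_grad U (\<lambda>x. u x - v x) x = weak_grad U u x - weak_grad U v x"
proof -
  have w: "has_weak_grad U (\<lambda>x. u x - v x) (\<lambda>x. weak_grad U u x - weak_grad U v x)"
    by (rule has_weak_grad_diff[OF U(1) H1_has_weak_grad[OF assms(1)] H1_has_weak_grad[OF assms(2)]])
  show "AE x in lebesgue_on U. weak_grad U (\<lambda>x. u x - v x) x = weak_grad U u x - weak_grad U v x"
    by (rule weak_grad_eqI[OF w])
  show "(\<lambda>x. u x - v x) \<in> H1 U"
    using w square_integrable_diff[OF H1_sqint[OF assms(1)] H1_sqint[OF assms(2)]]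
      square_integrable_diff[OF H1_weak_grad_sqint[OF assms(1)] H1_weak_grad_sqint[OF assms(2)]]
    unfolding H1_def by blast
qed

lemma sqint_jacobian: fixes u :: "real^2 \<Rightarrow> real^2" shows "smooth u \<Longrightarrow> square_integrable U (\<lambda>x. jacobian u (at x))"
  by (rule sqint_continuous[OF continuous_jacobian])

lemma H1_smooth:
  assumes "smooth u"
  shows "u \<in> H1 U" and "AE x in lebesgue_on U. weak_grad U u x = jacobian u (at x)"
  using weak_grad_eqI[OF has_weak_grad_smooth[OF U(1) assms]] sqint_smooth[OF assms] sqint_jacobian[OF assms]
    has_weak_grad_smooth[OF U(1) assms]
  by (auto simp: H1_def)

end

lemma jacobian_sum:
  fixes h :: "'i \<Rightarrow> real^2 \<Rightarrow> real^2"
  assumes "\<And>s. s \<in> J \<Longrightarrow> smooth (h s)"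
  shows "jacobian (\<lambda>x. \<Sum>s\<in>J. c s *\<^sub>R h s x) (at x) = (\<Sum>s\<in>J. c s *\<^sub>R jacobian (h s) (at x))"
proof -
  have d: "((\<lambda>x. \<Sum>s\<in>J. c s *\<^sub>R h s x) has_derivative (\<lambda>y. \<Sum>s\<in>J. c s *\<^sub>R frechet_derivative (h s) (at x) y)) (at x)"
    using smooth_differentiable[OF assms]
    by (intro has_derivative_sum has_derivative_scaleR_right) (auto simp: frechet_derivative_works[symmetric])
  show ?thesis
    using assms smooth_differentiable
    by (auto simp: jacobian_def matrix_def vec_eq_iff frechet_derivative_at[OF d, symmetric])
qed

lemma const_projection_diff:
  assumes "const_projection U P0" "u \<in> H1 U" "v \<in> H1 U"
  shows "P0 (\<lambda>x. u x - v x) = P0 u - P0 v"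
proof -
  have "P0 (\<lambda>x. 1 *\<^sub>R u x + (-1) *\<^sub>R v x) = 1 *\<^sub>R P0 u + (-1) *\<^sub>R P0 v"
    by (rule assms(1)[unfolded const_projection_def, THEN conjunct1, rule_format, OF assms(2,3)])
  then show ?thesis by simp
qed

context bounded_open_set begin

subsection \<open>The gradient projection\<close>

lemma gradient_projection_exists:
  assumes G: "square_integrable U G"
  shows "\<exists>p\<in>polys k. \<forall>q\<in>polys k. l2_inner U (\<lambda>x. jacobian q (at x)) (\<lambda>x. G x - jacobian (p :: real^2 \<Rightarrow> real^2) (at x)) = 0"
  by (rule projection_onto_image_of_polys[of k "\<lambda>q x. jacobian q (at x)"])
     (rule sqint_jacobian polys_smooth G jacobian_sum | assumption)+

text \<open>
  The kernel of the gradient form on polynomials consists of the constants, which the projection onto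
  constants in the definition of the gradient projection fixes.
\<close>

lemma jacobian_zero_imp_const:
  assumes p: "p \<in> polys n" and z: "l2_sq U (\<lambda>x. jacobian p (at x)) = 0"
  obtains c where "p = (\<lambda>x. c :: real^2)"
proof -
  have "(\<lambda>x. jacobian p (at x)) = (\<lambda>x. 0)" by (rule polys_l2_zero[OF jacobian_polys[OF p] z])
  then have "jacobian p (at x) = 0" for x by (rule fun_cong)
  then have "(p has_derivative (\<lambda>h. 0)) (at x within UNIV)" for x
    using smooth_differentiable[OF polys_smooth[OF p], of x] by (simp add: jacobian_works)
  from has_derivative_zero_constant[OF convex_UNIV this] show ?thesis using that by auto
qed

lemma grad_proj_eqI:
  assumes P0: "const_projection U P0" and v: "v \<in> H1 U" and p: "p \<in> polys k"
    and orth: "\<And>q. q \<in> polys k \<Longrightarrow> l2_inner U (\<lambda>x. jacobian q (at x)) (\<lambda>x. weak_grad U v x - jacobian p (at x)) = 0"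
    and mean: "P0 (\<lambda>x. v x - p x) = 0"
  shows "grad_proj k U P0 v = p"
  unfolding grad_proj_def
proof (rule the_equality)
  have wg: "l2_inner U (\<lambda>x. jacobian q (at x)) (weak_grad U (\<lambda>x. v x - p x))
      = l2_inner U (\<lambda>x. jacobian q (at x)) (\<lambda>x. weak_grad U v x - jacobian p (at x))"
    if "q \<in> polys k" "p \<in> polys k" for q p :: "real^2 \<Rightarrow> real^2"
  proof (rule l2_inner_cong_AE)
    note s = polys_smooth[OF that(2)]
    show "AE x in lebesgue_on U. weak_grad U (\<lambda>x. v x - p x) x = weak_grad U v x - jacobian p (at x)"
      using H1_diff(2)[OF v H1_smooth(1)[OF s]] H1_smooth(2)[OF s] by eventually_elim simp
    show "square_integrable U (weak_grad U (\<lambda>x. v x - p x))"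
      by (intro H1_weak_grad_sqint H1_diff(1) v H1_smooth s)
    show "square_integrable U (\<lambda>x. weak_grad U v x - jacobian p (at x))"
      by (intro square_integrable_diff H1_weak_grad_sqint v sqint_jacobian s)
  qed (use that in \<open>auto intro!: sqint_jacobian polys_smooth\<close>)
  show "p \<in> polys k \<and> (\<forall>q\<in>polys k. l2_inner U (\<lambda>x. jacobian q (at x)) (weak_grad U (\<lambda>x. v x - p x)) = 0)
      \<and> P0 (\<lambda>x. v x - p x) = 0"
    using p orth mean wg by simp
  fix p' assume p': "p' \<in> polys k \<and> (\<forall>q\<in>polys k. l2_inner U (\<lambda>x. jacobian q (at x)) (weak_grad U (\<lambda>x. v x - p' x)) = 0)
      \<and> P0 (\<lambda>x. v x - p' x) = 0"
  let ?d = "\<lambda>x. p' x - p x"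
  have d: "?d \<in> polys k" using p p' by (blast intro: polys_diff)
  have sp: "smooth p" "smooth p'" using p p' polys_smooth by blast+
  note jd = jacobian_diff[OF smooth_differentiable[OF sp(2)] smooth_differentiable[OF sp(1)]]
  have s: "square_integrable U (\<lambda>x. weak_grad U v x - jacobian p (at x))"
    "square_integrable U (\<lambda>x. weak_grad U v x - jacobian p' (at x))"
    "square_integrable U (\<lambda>x. jacobian ?d (at x))"
    by (intro square_integrable_diff H1_weak_grad_sqint v sqint_jacobian sp polys_smooth[OF d])+
  have "l2_inner U (\<lambda>x. (weak_grad U v x - jacobian p (at x)) - (weak_grad U v x - jacobian p' (at x)))
      (\<lambda>x. jacobian ?d (at x)) = 0"
    using orth[OF d] wg[OF d, of p'] p' d
    by (subst l2_inner_diff_left[OF s]) (simp add: l2_inner_commute[of U _ "\<lambda>x. jacobian ?d (at x)"])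
  then have "l2_sq U (\<lambda>x. jacobian ?d (at x)) = 0"
    by (simp add: jd)
  from jacobian_zero_imp_const[OF d this] obtain c where c: "?d = (\<lambda>x. c)" by blast
  have vp: "(\<lambda>x. v x - p x) \<in> H1 U" "(\<lambda>x. v x - p' x) \<in> H1 U"
    by (intro H1_diff(1) v H1_smooth(1) sp)+
  have "P0 ?d = 0" using const_projection_diff[OF P0 vp] mean p' by simp
  moreover have "P0 ?d = c" using P0 by (simp add: c const_projection_def)
  ultimately show "p' = p" using c by (simp add: fun_eq_iff)
qed

text \<open>
  A solution of the gradient equations is unique up to a constant, and adding the constant
  \<open>P0 (v - p)\<close> to any solution \<open>p\<close> satisfies the second condition.
\<close>

lemma grad_proj_works:
  assumes P0: "const_projection U P0" and v: "v \<in> H1 U"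
  shows "grad_proj k U P0 v \<in> polys k"
    and "q \<in> polys k \<Longrightarrow> l2_inner U (\<lambda>x. jacobian q (at x)) (\<lambda>x. weak_grad U v x - jacobian (grad_proj k U P0 v) (at x)) = 0"
    and "P0 (\<lambda>x. v x - grad_proj k U P0 v x) = 0"
proof -
  obtain p where p: "p \<in> polys k" and orth: "\<And>q. q \<in> polys k \<Longrightarrow>
      l2_inner U (\<lambda>x. jacobian q (at x)) (\<lambda>x. weak_grad U v x - jacobian (p :: real^2 \<Rightarrow> real^2) (at x)) = 0"
    using gradient_projection_exists[OF H1_weak_grad_sqint[OF v]] by blast
  let ?c = "P0 (\<lambda>x. v x - p x)"
  let ?p = "\<lambda>x. p x + ?c"
  have p': "?p \<in> polys k" by (rule polys_add[OF p polys_const])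
  have "jacobian ?p (at x) = jacobian p (at x)" for x
    using jacobian_add[of p x "\<lambda>x. ?c"] smooth_differentiable[OF polys_smooth[OF p]] by (simp add: jacobian_const)
  then have orth': "l2_inner U (\<lambda>x. jacobian q (at x)) (\<lambda>x. weak_grad U v x - jacobian ?p (at x)) = 0" if "q \<in> polys k" for q
    using orth[OF that] by (simp only:)
  have "P0 (\<lambda>x. (v x - p x) - ?c) = P0 (\<lambda>x. v x - p x) - P0 (\<lambda>x. ?c)"
    by (intro const_projection_diff[OF P0] H1_diff(1) v H1_smooth(1) polys_smooth[OF p] smooth_const)
  moreover have "P0 (\<lambda>x. ?c) = ?c" using P0 by (simp add: const_projection_def)
  ultimately have mean: "P0 (\<lambda>x. v x - ?p x) = 0" by (simp add: algebra_simps)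
  have eq: "grad_proj k U P0 v = ?p" by (rule grad_proj_eqI[OF P0 v p' orth' mean])
  show "grad_proj k U P0 v \<in> polys k" "P0 (\<lambda>x. v x - grad_proj k U P0 v x) = 0"
    using p' mean unfolding eq by simp_all
  show "l2_inner U (\<lambda>x. jacobian q (at x)) (\<lambda>x. weak_grad U v x - jacobian (grad_proj k U P0 v) (at x)) = 0" if "q \<in> polys k"
    using orth'[OF that] unfolding eq .
qed

lemma grad_proj_diff:
  assumes P0: "const_projection U P0" and u: "u \<in> H1 U" and v: "v \<in> H1 U"
  shows "grad_proj k U P0 (\<lambda>x. u x - v x) = (\<lambda>x. grad_proj k U P0 u x - grad_proj k U P0 v x)"
proof (rule grad_proj_eqI[OF P0 H1_diff(1)[OF u v]])
  note pu = grad_proj_works[OF P0 u] and pv = grad_proj_works[OF P0 v]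
  let ?p = "grad_proj k U P0 u" and ?q = "grad_proj k U P0 v"
  have sp: "smooth ?p" "smooth ?q" using pu(1) pv(1) polys_smooth by blast+
  show "(\<lambda>x. ?p x - ?q x) \<in> polys k" using pu(1) pv(1) by (rule polys_diff)
  have s: "square_integrable U (\<lambda>x. weak_grad U u x - jacobian ?p (at x))"
    "square_integrable U (\<lambda>x. weak_grad U v x - jacobian ?q (at x))"
    by (intro square_integrable_diff H1_weak_grad_sqint u v sqint_jacobian sp)+
  fix q :: "real^2 \<Rightarrow> real^2" assume q: "q \<in> polys k"
  have sq: "square_integrable U (\<lambda>x. jacobian q (at x))" by (rule sqint_jacobian[OF polys_smooth[OF q]])
  have "l2_inner U (\<lambda>x. weak_grad U (\<lambda>x. u x - v x) x - jacobian (\<lambda>x. ?p x - ?q x) (at x)) (\<lambda>x. jacobian q (at x))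
     = l2_inner U (\<lambda>x. (weak_grad U u x - jacobian ?p (at x)) - (weak_grad U v x - jacobian ?q (at x))) (\<lambda>x. jacobian q (at x))"
  proof (rule l2_inner_cong_AE)
    show "AE x in lebesgue_on U. weak_grad U (\<lambda>x. u x - v x) x - jacobian (\<lambda>x. ?p x - ?q x) (at x)
        = (weak_grad U u x - jacobian ?p (at x)) - (weak_grad U v x - jacobian ?q (at x))"
      using H1_diff(2)[OF u v]
      by eventually_elim (simp add: jacobian_diff[OF smooth_differentiable[OF sp(1)] smooth_differentiable[OF sp(2)]])
    show "square_integrable U (\<lambda>x. weak_grad U (\<lambda>x. u x - v x) x - jacobian (\<lambda>x. ?p x - ?q x) (at x))"
      by (intro square_integrable_diff H1_weak_grad_sqint H1_diff(1) u v sqint_jacobian smooth_diff sp)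
    show "square_integrable U (\<lambda>x. (weak_grad U u x - jacobian ?p (at x)) - (weak_grad U v x - jacobian ?q (at x)))"
      by (rule square_integrable_diff[OF s])
  qed (use sq in auto)
  also have "\<dots> = 0"
    using pu(2)[OF q] pv(2)[OF q] by (subst l2_inner_diff_left[OF s sq]) (simp add: l2_inner_commute)
  finally show "l2_inner U (\<lambda>x. jacobian q (at x)) (\<lambda>x. weak_grad U (\<lambda>x. u x - v x) x - jacobian (\<lambda>x. ?p x - ?q x) (at x)) = 0"
    by (simp only: l2_inner_commute)
next
  let ?p = "grad_proj k U P0 u" and ?q = "grad_proj k U P0 v"
  have "P0 (\<lambda>x. (u x - ?p x) - (v x - ?q x)) = P0 (\<lambda>x. u x - ?p x) - P0 (\<lambda>x. v x - ?q x)"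
    by (intro const_projection_diff[OF P0] H1_diff(1) u v H1_smooth(1)
        polys_smooth[OF grad_proj_works(1)[OF P0 u]] polys_smooth[OF grad_proj_works(1)[OF P0 v]])
  then show "P0 (\<lambda>x. u x - v x - (?p x - ?q x)) = 0"
    using grad_proj_works(3)[OF P0 u] grad_proj_works(3)[OF P0 v] by (simp add: algebra_simps)
qed

lemma grad_proj_of_poly:
  assumes P0: "const_projection U P0" and p: "p \<in> polys k"
  shows "grad_proj k U P0 p = p"
proof (rule grad_proj_eqI[OF P0 H1_smooth(1)[OF polys_smooth[OF p]] p])
  note s = polys_smooth[OF p]
  fix q :: "real^2 \<Rightarrow> real^2" assume q: "q \<in> polys k"
  have "l2_inner U (\<lambda>x. weak_grad U p x - jacobian p (at x)) (\<lambda>x. jacobian q (at x))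
     = l2_inner U (\<lambda>x. 0) (\<lambda>x. jacobian q (at x))"
  proof (rule l2_inner_cong_AE)
    show "AE x in lebesgue_on U. weak_grad U p x - jacobian p (at x) = 0"
      using H1_smooth(2)[OF s] by eventually_elim simp
  qed (auto intro!: square_integrable_diff H1_weak_grad_sqint H1_smooth(1) sqint_jacobian s polys_smooth[OF q] square_integrable_zero)
  then show "l2_inner U (\<lambda>x. jacobian q (at x)) (\<lambda>x. weak_grad U p x - jacobian p (at x)) = 0"
    by (simp add: l2_inner_zero_left l2_inner_commute)
next
  show "P0 (\<lambda>x. p x - p x) = 0" using P0 by (simp add: const_projection_def)
qed

end

section \<open>Polynomials solve the Stokes equation\<close>

lemma perp_nth [simp]: "perp x $ 1 = x $ 2" "perp x $ 2 = - (x $ 1)"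
  by (simp_all add: perp_def)

lemma smooth_perp: "smooth perp"
proof -
  have "perp = (\<lambda>x. x $ 2 *\<^sub>R axis 1 1 - x $ 1 *\<^sub>R axis 2 1)"
    by (rule ext) (simp add: vec_eq_iff forall_2 axis_def)
  then show ?thesis by (rule ssubst) (intro smooth_diff smooth_scaleR smooth_nth smooth_const)
qed

lemma scalar_grad_add:
  "f differentiable at x \<Longrightarrow> g differentiable at x \<Longrightarrow>
   scalar_grad (\<lambda>x. f x + g x) x = scalar_grad f x + scalar_grad g x"
  by (simp add: scalar_grad_def vec_eq_iff partial_deriv_add)

text \<open>
  For \<open>f\<close> homogeneous of degree \<open>d\<close>, Euler's identity gives \<open>\<nabla>(x \<cdot> f) = (d + 1) f + (curl f) x\<^sup>\<bottom>\<close>. Hence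
  \<open>s = - (x \<cdot> f) / (d + 1)\<close> and \<open>q = - (curl f) / (d + 1)\<close> solve \<open>f + \<nabla>s = q x\<^sup>\<bottom>\<close>. By linearity it suffices to
  write this down for a monomial times a constant vector.
\<close>

lemma polys_perp_decomposition:
  fixes f :: "real^2 \<Rightarrow> real^2"
  assumes "f \<in> polys m"
  shows "\<exists>s\<in>polys (Suc m). \<exists>q\<in>polys m. \<forall>x. f x + scalar_grad s x = q x *\<^sub>R perp x"
  using assms
proof (induction rule: polys_induct)
  case zero
  show ?case
    by (rule bexI[OF _ polys_zero], rule bexI[OF _ polys_zero]) (simp add: scalar_grad_def partial_deriv_const vec_eq_iff)
next
  case (add f g)
  then obtain s q s' q' where *: "s \<in> polys (Suc m)" "q \<in> polys m" "\<And>x. f x + scalar_grad s x = q x *\<^sub>R perp x"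
     "s' \<in> polys (Suc m)" "q' \<in> polys m" "\<And>x. g x + scalar_grad s' x = q' x *\<^sub>R perp x" by blast
  have "f x + g x + scalar_grad (\<lambda>x. s x + s' x) x = (q x + q' x) *\<^sub>R perp x" for x
    unfolding scalar_grad_add[OF smooth_differentiable[OF polys_smooth[OF *(1)]] smooth_differentiable[OF polys_smooth[OF *(4)]]]
    unfolding scaleR_add_left *(3)[of x, symmetric] *(6)[of x, symmetric] by simp
  then show ?case
    by (intro bexI[OF _ polys_add[OF *(1,4)]] bexI[OF _ polys_add[OF *(2,5)]] allI)
next
  case (monomial i j c)
  define N where "N = real (i + j + 1)"
  have N: "N > 0" by (simp add: N_def)
  \<comment> \<open>\<open>s = - (x \<cdot> c) x\<^sub>1\<^sup>i x\<^sub>2\<^sup>j / N\<close> with \<open>N = i + j + 1\<close>, and \<open>q\<close> is minus the curl of the monomial field, over \<open>N\<close>\<close>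
  define s where "s = (\<lambda>x::real^2. (x $ 1 ^ Suc i * x $ 2 ^ j) *\<^sub>R (- (c $ 1) / N) + (x $ 1 ^ i * x $ 2 ^ Suc j) *\<^sub>R (- (c $ 2) / N))"
  define q where "q = (\<lambda>x::real^2. (x $ 1 ^ i * x $ 2 ^ (j - 1)) *\<^sub>R (real j * c $ 1 / N) + (x $ 1 ^ (i - 1) * x $ 2 ^ j) *\<^sub>R (- (real i * c $ 2) / N))"
  have s: "s \<in> polys (Suc m)" unfolding s_def using monomial by (intro polys_add polys_monomial) auto
  have q: "q \<in> polys m"
    unfolding q_def using monomial by (intro polys_add polys_monomial) auto
  have sm: "smooth (\<lambda>x::real^2. (x $ 1 ^ i * x $ 2 ^ j) *\<^sub>R (c::real))" for i j c
    by (rule polys_smooth[OF polys_monomial[OF order_refl]])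
  have d1: "partial_deriv 1 s x = (x $ 1 ^ i * x $ 2 ^ j) * (real (Suc i) * (- (c $ 1) / N))
      + (x $ 1 ^ (i - 1) * x $ 2 ^ Suc j) * (real i * (- (c $ 2) / N))" for x
    unfolding s_def
    by (subst partial_deriv_add[OF smooth_differentiable[OF sm] smooth_differentiable[OF sm]])
       (simp only: partial_deriv_monomial, simp only: diff_Suc_1 real_scaleR_def)
  have d2: "partial_deriv 2 s x = (x $ 1 ^ Suc i * x $ 2 ^ (j - 1)) * (real j * (- (c $ 1) / N))
      + (x $ 1 ^ i * x $ 2 ^ j) * (real (Suc j) * (- (c $ 2) / N))" for x
    unfolding s_def
    by (subst partial_deriv_add[OF smooth_differentiable[OF sm] smooth_differentiable[OF sm]])
       (simp only: partial_deriv_monomial, simp only: diff_Suc_1 real_scaleR_def)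
  have "(x $ 1 ^ i * x $ 2 ^ j) *\<^sub>R c + scalar_grad s x = q x *\<^sub>R perp x" for x
  proof -
    have cN: "c $ k = c $ k / N * (real i + real j + 1)" for k
    proof -
      have "real i + real j + 1 = N" by (simp add: N_def)
      then show ?thesis using N by simp
    qed
    define a b where "a = c $ 1 / N" and "b = c $ 2 / N"
    have c: "c $ 1 = a * (real i + real j + 1)" "c $ 2 = b * (real i + real j + 1)" using cN by (simp_all add: a_def b_def)
    have ab: "- (c $ 1) / N = - a" "- (c $ 2) / N = - b" "real j * c $ 1 / N = real j * a" "- (real i * c $ 2) / N = - (real i * b)"
      by (simp_all add: a_def b_def)
    note d1' = d1[of x, unfolded ab] and d2' = d2[of x, unfolded ab]
    \<comment> \<open>The factors \<open>j\<close> and \<open>i\<close> vanish where the truncated exponents \<open>j - 1\<close> and \<open>i - 1\<close> are wrong.\<close>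
    have xj: "x $ 2 * x $ 2 ^ (j - 1) * real j = x $ 2 ^ j * real j" by (cases j) auto
    have xi: "x $ 1 * x $ 1 ^ (i - 1) * real i = x $ 1 ^ i * real i" by (cases i) auto
    have 1: "x $ 1 ^ i * x $ 2 ^ j * c $ 1 + partial_deriv 1 s x = q x * x $ 2"
    proof -
      have "q x * x $ 2 = x $ 1 ^ i * (x $ 2 * x $ 2 ^ (j - 1) * real j) * a - (x $ 1 ^ (i - 1) * x $ 2 ^ Suc j) * (real i * b)"
        unfolding q_def ab by (simp add: algebra_simps)
      then show ?thesis unfolding d1' xj c(1) by (simp add: algebra_simps)
    qed
    have 2: "x $ 1 ^ i * x $ 2 ^ j * c $ 2 + partial_deriv 2 s x = - (q x * x $ 1)"
    proof -
      have "q x * x $ 1 = (x $ 1 ^ Suc i * x $ 2 ^ (j - 1)) * (real j * a) - (x $ 1 * x $ 1 ^ (i - 1) * real i) * x $ 2 ^ j * b"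
        unfolding q_def ab by (simp add: algebra_simps)
      then show ?thesis unfolding d2' xi c(2) by (simp add: algebra_simps)
    qed
    show ?thesis using 1 2 by (simp add: vec_eq_iff forall_2 scalar_grad_def)
  qed
  then show ?case using s q by blast
qed

lemma partial_deriv_bounded_linear:
  assumes "bounded_linear L" "f differentiable (at x)"
  shows "partial_deriv j (\<lambda>x. L (f x)) x = L (partial_deriv j f x)"
proof -
  have "((\<lambda>x. L (f x)) has_derivative (\<lambda>h. L (frechet_derivative f (at x) h))) (at x)"
    using assms(2) by (intro bounded_linear.has_derivative[OF assms(1)]) (simp add: frechet_derivative_works)
  from partial_deriv_eq[OF this] show ?thesis by (simp add: partial_deriv_def)
qed

lemma partial_deriv_nth:
  "f differentiable (at x) \<Longrightarrow> partial_deriv j (\<lambda>x. f x $ i) x = partial_deriv j f x $ i"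
  by (rule partial_deriv_bounded_linear[OF bounded_linear_vec_nth])

lemma test_function_nth:
  assumes "test_function U \<phi>"
  shows "test_function U (\<lambda>x. \<phi> x $ i)"
proof -
  have "closure {x. \<phi> x $ i \<noteq> 0} \<subseteq> closure {x. \<phi> x \<noteq> 0}" by (rule closure_mono) auto
  moreover have "smooth (\<lambda>x. \<phi> x $ i)"
    using assms by (intro smooth_bounded_linear[OF bounded_linear_vec_nth]) (simp add: test_function_def)
  ultimately show ?thesis
    using assms compact_Int_closed[of "closure {x. \<phi> x \<noteq> 0}" "closure {x. \<phi> x $ i \<noteq> 0}"]
    by (auto simp: test_function_def Int_absorb1)
qed

lemma l2_inner_vec:
  fixes u v :: "real^2 \<Rightarrow> 'a::euclidean_space^2"
  assumes "square_integrable U u" "square_integrable U v"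
  shows "l2_inner U u v = (\<Sum>i\<in>UNIV. l2_inner U (\<lambda>x. u x $ i) (\<lambda>x. v x $ i))"
proof -
  have "integrable (lebesgue_on U) (\<lambda>x. u x $ i \<bullet> v x $ i)" for i
    by (rule inner_integrable; rule square_integrable_bounded_linear[OF bounded_linear_vec_nth]; fact)
  then show ?thesis unfolding l2_inner_def inner_vec_def by (subst Bochner_Integration.integral_sum) auto
qed

context bounded_open_set begin

lemma ibp_test:
  fixes a b :: "real^2 \<Rightarrow> real"
  assumes "test_function U b" "smooth a"
  shows "l2_inner U a (partial_deriv j b) = - l2_inner U (partial_deriv j a) b"
  using has_weak_partial_smooth[OF U(1) assms(2), of j] assms(1)
  by (simp add: has_weak_partial_def l2_inner_def mult.commute)

lemma sqint_nth: "square_integrable U u \<Longrightarrow> square_integrable U (\<lambda>x. u x $ i)"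
  by (rule square_integrable_bounded_linear[OF bounded_linear_vec_nth])

lemma ibp_jacobian:
  assumes \<phi>: "test_function U \<phi>" and p: "smooth p"
  shows "l2_inner U (\<lambda>x. jacobian p (at x)) (\<lambda>x. jacobian \<phi> (at x))
     = - l2_inner U (\<lambda>x. \<Sum>j\<in>UNIV. partial_deriv j (partial_deriv j p) x) (\<phi> :: real^2 \<Rightarrow> real^2)"
proof -
  have s: "smooth \<phi>" using \<phi> by (simp add: test_function_def)
  have sn: "smooth (\<lambda>x. p x $ i)" for i by (rule smooth_bounded_linear[OF bounded_linear_vec_nth p])
  have "l2_inner U (\<lambda>x. jacobian p (at x)) (\<lambda>x. jacobian \<phi> (at x))
      = (\<Sum>i\<in>UNIV. \<Sum>j\<in>UNIV. l2_inner U (\<lambda>x. jacobian p (at x) $ i $ j) (\<lambda>x. jacobian \<phi> (at x) $ i $ j))"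
    by (simp add: l2_inner_vec sqint_jacobian sqint_nth p s)
  also have "\<dots> = (\<Sum>i\<in>UNIV. \<Sum>j\<in>UNIV. l2_inner U (partial_deriv j (\<lambda>x. p x $ i)) (partial_deriv j (\<lambda>x. \<phi> x $ i)))"
  proof (intro sum.cong refl arg_cong2[of _ _ _ _ "l2_inner U"] ext)
    fix i j :: 2 and x
    show "jacobian p (at x) $ i $ j = partial_deriv j (\<lambda>x. p x $ i) x" "jacobian \<phi> (at x) $ i $ j = partial_deriv j (\<lambda>x. \<phi> x $ i) x"
      using smooth_differentiable[OF p] smooth_differentiable[OF s] by (simp_all add: jacobian_nth partial_deriv_nth)
  qed
  also have "\<dots> = (\<Sum>i\<in>UNIV. \<Sum>j\<in>UNIV. - l2_inner U (\<lambda>x. partial_deriv j (partial_deriv j p) x $ i) (\<lambda>x. \<phi> x $ i))"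
  proof (intro sum.cong refl)
    fix i j :: 2
    have 1: "partial_deriv j (\<lambda>x. p x $ i) = (\<lambda>x. partial_deriv j p x $ i)"
      using smooth_differentiable[OF p] by (intro ext partial_deriv_nth)
    have 2: "partial_deriv j (\<lambda>x. partial_deriv j p x $ i) = (\<lambda>x. partial_deriv j (partial_deriv j p) x $ i)"
      using smooth_differentiable[OF smooth_partial[OF p]] by (intro ext partial_deriv_nth)
    show "l2_inner U (partial_deriv j (\<lambda>x. p x $ i)) (partial_deriv j (\<lambda>x. \<phi> x $ i))
       = - l2_inner U (\<lambda>x. partial_deriv j (partial_deriv j p) x $ i) (\<lambda>x. \<phi> x $ i)"
      using ibp_test[OF test_function_nth[OF \<phi>] smooth_partial[OF sn], of j i j i] unfolding 1 2 .
  qed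
  also have "\<dots> = - (\<Sum>i\<in>UNIV. l2_inner U (\<lambda>x. (\<Sum>j\<in>UNIV. partial_deriv j (partial_deriv j p) x) $ i) (\<lambda>x. \<phi> x $ i))"
    by (simp add: sum_negf l2_inner_sum_left sqint_nth sqint_smooth smooth_partial p s)
  also have "\<dots> = - l2_inner U (\<lambda>x. \<Sum>j\<in>UNIV. partial_deriv j (partial_deriv j p) x) \<phi>"
    by (subst l2_inner_vec) (auto intro!: sqint_smooth smooth_sum smooth_partial p s)
  finally show ?thesis .
qed

lemma ibp_divergence:
  assumes \<phi>: "test_function U \<phi>" and a: "smooth a"
  shows "l2_inner U a (\<lambda>x. trace (jacobian \<phi> (at x))) = - l2_inner U (scalar_grad a) (\<phi> :: real^2 \<Rightarrow> real^2)"
proof -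
  have s: "smooth \<phi>" using \<phi> by (simp add: test_function_def)
  have sn: "smooth (\<lambda>x. \<phi> x $ i)" for i by (rule smooth_bounded_linear[OF bounded_linear_vec_nth s])
  have tr: "trace (jacobian \<phi> (at x)) = (\<Sum>i\<in>UNIV. partial_deriv i (\<lambda>x. \<phi> x $ i) x)" for x
    using smooth_differentiable[OF s] by (simp add: trace_def jacobian_nth partial_deriv_nth)
  have "l2_inner U a (\<lambda>x. trace (jacobian \<phi> (at x))) = (\<Sum>i\<in>UNIV. l2_inner U a (partial_deriv i (\<lambda>x. \<phi> x $ i)))"
    unfolding tr by (simp add: l2_inner_commute[of U a] l2_inner_sum_left sqint_smooth a smooth_partial[OF sn])
  also have "\<dots> = (\<Sum>i\<in>UNIV. - l2_inner U (\<lambda>x. scalar_grad a x $ i) (\<lambda>x. \<phi> x $ i))"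
    using ibp_test[OF test_function_nth[OF \<phi>] a] by (simp add: scalar_grad_def)
  also have "\<dots> = - l2_inner U (scalar_grad a) \<phi>"
  proof -
    have "scalar_grad a = (\<lambda>x. \<Sum>j\<in>UNIV. partial_deriv j a x *\<^sub>R axis j 1)"
      by (rule ext) (simp add: scalar_grad_def vec_eq_iff forall_2 sum_2 axis_def)
    then have "square_integrable U (scalar_grad a)"
      by (simp only:) (intro square_integrable_sum sqint_smooth smooth_scaleR smooth_partial a smooth_const)
    then show ?thesis by (simp add: l2_inner_vec sqint_smooth s sum_negf)
  qed
  finally show ?thesis .
qed

text \<open>
  Apply the decomposition to the Laplacian of \<open>p\<close>, which has degree at most \<open>k - 2\<close>, and
  integrate by parts. Subtracting its mean from the pressure \<open>s\<close> does not change the gradient.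
\<close>

lemma stokes_condition_polys:
  assumes p: "p \<in> polys k" and k: "k \<ge> 2"
  shows "stokes_condition k U p"
proof -
  let ?L = "\<lambda>x. \<Sum>j\<in>UNIV. partial_deriv j (partial_deriv j p) x"
  have L: "?L \<in> polys (k - 1 - 1)" by (intro polys_sum partial_deriv_polys p)
  obtain s q where s: "s \<in> polys (Suc (k - 1 - 1))" and q: "q \<in> polys (k - 1 - 1)"
    and sq: "\<And>x. ?L x + scalar_grad s x = q x *\<^sub>R perp x"
    using polys_perp_decomposition[OF L] by blast
  have ss: "smooth s" by (rule polys_smooth[OF s])
  define m where "m = (\<integral>x. s x \<partial>(lebesgue_on U)) / measure lebesgue U"
  let ?s = "\<lambda>x. s x - m"
  have ss': "smooth ?s" by (intro smooth_diff ss smooth_const)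
  have gs: "scalar_grad ?s x = scalar_grad s x" for x
    using partial_deriv_eq[OF has_derivative_diff[OF C_diff_has_derivative[OF smooth_C_diff[OF ss]] has_derivative_const]]
    by (simp add: scalar_grad_def vec_eq_iff partial_deriv_def)
  have si: "integrable (lebesgue_on U) s"
    using inner_integrable[OF sqint_smooth[OF ss] sqint_smooth[OF smooth_const[of 1]]] by simp
  have ci: "integrable (lebesgue_on U) (\<lambda>x. m)"
    using inner_integrable[OF sqint_smooth[OF smooth_const[of m]] sqint_smooth[OF smooth_const[of 1]]] by simp
  have fm: "U \<in> lmeasurable" using U by (simp add: lmeasurable_open)
  have "\<not> negligible U" using open_not_negligible U by blast
  then have mp: "measure lebesgue U \<noteq> 0" using fm by (simp add: negligible_iff_measure0)
  have "(\<integral>x. ?s x \<partial>(lebesgue_on U)) = (\<integral>x. s x \<partial>(lebesgue_on U)) - m * measure lebesgue U"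
    using si ci U_sets by (simp add: measure_restrict_space)
  then have mean: "(\<integral>x. ?s x \<partial>(lebesgue_on U)) = 0" using mp by (simp add: m_def)
  show ?thesis
    unfolding stokes_condition_def
  proof (rule exI[of _ ?s], rule exI[of _ q], intro conjI allI impI)
    show "square_integrable U ?s" by (rule sqint_smooth[OF ss'])
    show "q \<in> polys (k - 1)" by (rule polys_mono[OF q]) simp
    fix \<phi> :: "real^2 \<Rightarrow> real^2" assume \<phi>: "test_function U \<phi>"
    then have s\<phi>: "smooth \<phi>" by (simp add: test_function_def)
    have w: "l2_inner U (weak_grad U p) (\<lambda>x. jacobian \<phi> (at x)) = l2_inner U (\<lambda>x. jacobian p (at x)) (\<lambda>x. jacobian \<phi> (at x))"
      by (rule l2_inner_cong_AE[OF H1_smooth(2)[OF polys_smooth[OF p]] AE_I2])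
         (auto intro!: H1_weak_grad_sqint H1_smooth(1) polys_smooth[OF p] sqint_jacobian s\<phi>)
    have sL: "square_integrable U ?L" by (rule sqint_polys[OF L])
    have sg: "square_integrable U (scalar_grad s)"
    proof -
      have "scalar_grad s = (\<lambda>x. q x *\<^sub>R perp x - ?L x)" using sq by (auto simp: fun_eq_iff algebra_simps)
      then show ?thesis
        using sL sqint_smooth[OF smooth_scaleR[OF polys_smooth[OF q] smooth_perp]] by (simp add: square_integrable_diff)
    qed
    have "- l2_inner U (weak_grad U p) (\<lambda>x. jacobian \<phi> (at x)) - l2_inner U ?s (\<lambda>x. trace (jacobian \<phi> (at x)))
       = l2_inner U ?L \<phi> + l2_inner U (scalar_grad s) \<phi>"
      unfolding w ibp_jacobian[OF \<phi> polys_smooth[OF p]] ibp_divergence[OF \<phi> ss'] gs by simp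
    also have "\<dots> = l2_inner U (\<lambda>x. q x *\<^sub>R perp x) \<phi>"
      unfolding sq[symmetric] by (rule l2_inner_add_left[OF sL sg sqint_smooth[OF s\<phi>], symmetric])
    finally show "- l2_inner U (weak_grad U p) (\<lambda>x. jacobian \<phi> (at x)) - l2_inner U ?s (\<lambda>x. trace (jacobian \<phi> (at x)))
       = l2_inner U (\<lambda>x. q x *\<^sub>R perp x) \<phi>" .
  qed (rule mean)
qed

end

section \<open>The local virtual element space\<close>

lemma l2_norm_tendsto_0_iff:
  "(\<lambda>n. l2_norm U (f n)) \<longlonglongrightarrow> 0 \<longleftrightarrow> (\<lambda>n. l2_sq U (f n)) \<longlonglongrightarrow> 0"
proof
  assume "(\<lambda>n. l2_norm U (f n)) \<longlonglongrightarrow> 0"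
  then have "(\<lambda>n. (l2_norm U (f n))\<^sup>2) \<longlonglongrightarrow> 0\<^sup>2" by (rule tendsto_power)
  then show "(\<lambda>n. l2_sq U (f n)) \<longlonglongrightarrow> 0" by (simp add: l2_norm_sq)
next
  assume "(\<lambda>n. l2_sq U (f n)) \<longlonglongrightarrow> 0"
  then have "(\<lambda>n. sqrt (l2_sq U (f n))) \<longlonglongrightarrow> sqrt 0" by (rule tendsto_real_sqrt)
  then show "(\<lambda>n. l2_norm U (f n)) \<longlonglongrightarrow> 0" by (simp add: l2_norm_def)
qed

lemma nonneg_tendsto_0_bound:
  fixes f g :: "nat \<Rightarrow> real"
  assumes "\<And>n. 0 \<le> f n" "\<And>n. f n \<le> g n" "g \<longlonglongrightarrow> 0"
  shows "f \<longlonglongrightarrow> 0"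
  by (rule tendsto_sandwich[OF always_eventually always_eventually tendsto_const assms(3)]) (use assms in auto)

lemma l2_diff_tendsto_0:
  assumes "\<And>n. square_integrable U (f n)" "\<And>n. square_integrable U (g n)"
    and "(\<lambda>n. l2_norm U (f n)) \<longlonglongrightarrow> 0" "(\<lambda>n. l2_norm U (g n)) \<longlonglongrightarrow> 0"
  shows "(\<lambda>n. l2_norm U (\<lambda>x. f n x - g n x)) \<longlonglongrightarrow> 0"
proof -
  have neg: "l2_sq U (\<lambda>x. - g n x) = l2_sq U (g n)" for n
    by (simp add: l2_inner_def)
  have lim: "(\<lambda>n. 2 * l2_sq U (f n) + 2 * l2_sq U (g n)) \<longlonglongrightarrow> 2 * 0 + 2 * 0"
    using assms(3,4) unfolding l2_norm_tendsto_0_iff by (intro tendsto_intros)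
  have le: "l2_sq U (\<lambda>x. f n x - g n x) \<le> 2 * l2_sq U (f n) + 2 * l2_sq U (g n)" for n
    using l2_inner_add_le[OF assms(1)[of n] square_integrable_scaleR[OF assms(2)[of n], of "-1"]] neg[of n] by simp
  have "(\<lambda>n. l2_sq U (\<lambda>x. f n x - g n x)) \<longlonglongrightarrow> 0"
    by (rule nonneg_tendsto_0_bound[OF l2_inner_nonneg le lim[simplified]])
  then show ?thesis unfolding l2_norm_tendsto_0_iff .
qed

lemma edge_integral_mono:
  assumes "continuous_on (closed_segment a b) f" "continuous_on (closed_segment a b) g"
    and "\<And>x. x \<in> closed_segment a b \<Longrightarrow> f x \<le> g x"
  shows "edge_integral a b f \<le> edge_integral a b g"
  unfolding edge_integral_def
proof (intro mult_left_mono integral_mono)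
  have c: "continuous_on {0..1} (\<lambda>t. h (linepath a b t))" if "continuous_on (closed_segment a b) h" for h :: "real^2 \<Rightarrow> real"
    by (rule continuous_on_compose2[OF that]) (auto simp: linepath_in_path intro: continuous_on_linepath)
  show "integrable (lebesgue_on {0..1}) (\<lambda>t. f (linepath a b t))" "integrable (lebesgue_on {0..1}) (\<lambda>t. g (linepath a b t))"
    by (intro continuous_imp_integrable_real c assms)+
qed (auto intro!: assms(3) simp: linepath_in_path)

lemma edge_integral_add:
  assumes "continuous_on (closed_segment a b) f" "continuous_on (closed_segment a b) g"
  shows "edge_integral a b (\<lambda>x. f x + g x) = edge_integral a b f + edge_integral a b g"
proof -
  have c: "continuous_on {0..1} (\<lambda>t. h (linepath a b t))" if "continuous_on (closed_segment a b) h" for h :: "real^2 \<Rightarrow> real"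
    by (rule continuous_on_compose2[OF that]) (auto simp: linepath_in_path intro: continuous_on_linepath)
  have "integrable (lebesgue_on {0..1}) (\<lambda>t. f (linepath a b t))" "integrable (lebesgue_on {0..1}) (\<lambda>t. g (linepath a b t))"
    by (intro continuous_imp_integrable_real c assms)+
  then show ?thesis by (simp add: edge_integral_def algebra_simps)
qed

lemma edge_integral_cmult: "edge_integral a b (\<lambda>x. c * f x) = c * edge_integral a b f"
  by (simp add: edge_integral_def)

lemma edge_integral_nonneg: "(\<And>x. f x \<ge> 0) \<Longrightarrow> edge_integral a b f \<ge> 0"
  by (simp add: edge_integral_def)

lemma bounded_linear_trace: "bounded_linear (trace :: real^2^2 \<Rightarrow> real)"
  unfolding linear_conv_bounded_linear[symmetric]
  by (rule linearI) (simp_all add: trace_def sum.distrib sum_distrib_left)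

lemma finite_edges: "finite (edges P)"
  by (simp add: edges_def)

lemma edge_subset_union: "(a, b) \<in> edges P \<Longrightarrow> closed_segment a b \<subseteq> edge_union P"
  by (auto simp: edge_union_def)

locale element_region =
  fixes P :: element
  assumes region: "bounded_open_set (region P)"

sublocale element_region \<subseteq> bounded_open_set "region P" by (rule region)

context element_region begin

lemma H1_converges_diff:
  assumes su: "\<And>n. smooth (\<phi> n)" and u: "H1_converges (region P) \<phi> u"
    and sv: "\<And>n. smooth (\<psi> n)" and v: "H1_converges (region P) \<psi> v"
  shows "H1_converges (region P) (\<lambda>n x. \<phi> n x - \<psi> n x) (\<lambda>x. u x - v x)"
proof -
  have H: "u \<in> H1 (region P)" "v \<in> H1 (region P)" "\<And>n. \<phi> n \<in> H1 (region P)" "\<And>n. \<psi> n \<in> H1 (region P)"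
    using u v by (auto simp: H1_converges_def)
  have 1: "(\<lambda>n. l2_norm (region P) (\<lambda>x. (\<phi> n x - u x) - (\<psi> n x - v x))) \<longlonglongrightarrow> 0"
    by (rule l2_diff_tendsto_0) (use u v H in \<open>auto intro!: square_integrable_diff simp: H1_sqint H1_converges_def\<close>)
  have 2: "(\<lambda>n. l2_norm (region P) (\<lambda>x. (jacobian (\<phi> n) (at x) - weak_grad (region P) u x)
        - (jacobian (\<psi> n) (at x) - weak_grad (region P) v x))) \<longlonglongrightarrow> 0"
    by (rule l2_diff_tendsto_0)
       (use u v H su sv in \<open>auto intro!: square_integrable_diff simp: H1_weak_grad_sqint sqint_jacobian H1_converges_def\<close>)
  have "l2_norm (region P) (\<lambda>x. (jacobian (\<phi> n) (at x) - weak_grad (region P) u x)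
        - (jacobian (\<psi> n) (at x) - weak_grad (region P) v x))
     = l2_norm (region P) (\<lambda>x. jacobian (\<lambda>x. \<phi> n x - \<psi> n x) (at x) - weak_grad (region P) (\<lambda>x. u x - v x) x)" for n
  proof -
    have ae: "AE x in lebesgue_on (region P). (jacobian (\<phi> n) (at x) - weak_grad (region P) u x)
        - (jacobian (\<psi> n) (at x) - weak_grad (region P) v x)
        = jacobian (\<lambda>x. \<phi> n x - \<psi> n x) (at x) - weak_grad (region P) (\<lambda>x. u x - v x) x"
      using H1_diff(2)[OF H(1,2)]
      by eventually_elim (simp add: jacobian_diff[OF smooth_differentiable[OF su] smooth_differentiable[OF sv]])
    have s: "square_integrable (region P) (\<lambda>x. (jacobian (\<phi> n) (at x) - weak_grad (region P) u x)
        - (jacobian (\<psi> n) (at x) - weak_grad (region P) v x))"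
      "square_integrable (region P) (\<lambda>x. jacobian (\<lambda>x. \<phi> n x - \<psi> n x) (at x) - weak_grad (region P) (\<lambda>x. u x - v x) x)"
      by (intro square_integrable_diff sqint_jacobian H1_weak_grad_sqint H1_diff(1) H smooth_diff su sv)+
    show ?thesis unfolding l2_norm_def by (subst l2_inner_cong_AE[OF ae ae s s]) (rule refl)
  qed
  with 1 2 show ?thesis using H
    by (simp add: H1_converges_def H1_diff(1) algebra_simps)
qed

lemma has_continuous_trace_diff:
  assumes u: "has_continuous_trace P u g" and v: "has_continuous_trace P v h"
  shows "has_continuous_trace P (\<lambda>x. u x - v x) (\<lambda>x. g x - h x)"
proof -
  obtain \<phi> where \<phi>: "\<And>n. smooth (\<phi> n)" "H1_converges (region P) \<phi> u"
     "(\<lambda>n. \<Sum>(a, b)\<in>edges P. edge_integral a b (\<lambda>x. (norm (\<phi> n x - g x))\<^sup>2)) \<longlonglongrightarrow> 0"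
    using u by (auto simp: has_continuous_trace_def)
  obtain \<psi> where \<psi>: "\<And>n. smooth (\<psi> n)" "H1_converges (region P) \<psi> v"
     "(\<lambda>n. \<Sum>(a, b)\<in>edges P. edge_integral a b (\<lambda>x. (norm (\<psi> n x - h x))\<^sup>2)) \<longlonglongrightarrow> 0"
    using v by (auto simp: has_continuous_trace_def)
  have c: "continuous_on (edge_union P) g" "continuous_on (edge_union P) h"
    using u v by (auto simp: has_continuous_trace_def)
  let ?F = "\<lambda>n. \<Sum>(a, b)\<in>edges P. edge_integral a b (\<lambda>x. (norm ((\<phi> n x - \<psi> n x) - (g x - h x)))\<^sup>2)"
  let ?A = "\<lambda>n. \<Sum>(a, b)\<in>edges P. edge_integral a b (\<lambda>x. (norm (\<phi> n x - g x))\<^sup>2)"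
  let ?B = "\<lambda>n. \<Sum>(a, b)\<in>edges P. edge_integral a b (\<lambda>x. (norm (\<psi> n x - h x))\<^sup>2)"
  have le: "?F n \<le> 2 * ?A n + 2 * ?B n" for n
  proof -
    have "edge_integral a b (\<lambda>x. (norm ((\<phi> n x - \<psi> n x) - (g x - h x)))\<^sup>2)
        \<le> 2 * edge_integral a b (\<lambda>x. (norm (\<phi> n x - g x))\<^sup>2) + 2 * edge_integral a b (\<lambda>x. (norm (\<psi> n x - h x))\<^sup>2)"
      if ab: "(a, b) \<in> edges P" for a b
    proof -
      have cs: "continuous_on (closed_segment a b) g" "continuous_on (closed_segment a b) h"
        using c edge_subset_union[OF ab] continuous_on_subset by blast+
      note cc = cs smooth_continuous_on[OF \<phi>(1)] smooth_continuous_on[OF \<psi>(1)]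
      have "edge_integral a b (\<lambda>x. (norm ((\<phi> n x - \<psi> n x) - (g x - h x)))\<^sup>2)
          \<le> edge_integral a b (\<lambda>x. 2 * (norm (\<phi> n x - g x))\<^sup>2 + 2 * (norm (\<psi> n x - h x))\<^sup>2)"
      proof (rule edge_integral_mono)
        show "(norm ((\<phi> n x - \<psi> n x) - (g x - h x)))\<^sup>2 \<le> 2 * (norm (\<phi> n x - g x))\<^sup>2 + 2 * (norm (\<psi> n x - h x))\<^sup>2" for x
          using norm_sq_add_le[of "\<phi> n x - g x" "- (\<psi> n x - h x)"] by (simp add: algebra_simps norm_minus_commute)
      qed (intro continuous_intros cc)+
      also have "\<dots> = 2 * edge_integral a b (\<lambda>x. (norm (\<phi> n x - g x))\<^sup>2) + 2 * edge_integral a b (\<lambda>x. (norm (\<psi> n x - h x))\<^sup>2)"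
        unfolding edge_integral_cmult[symmetric] by (rule edge_integral_add; intro continuous_intros cc)
      finally show ?thesis .
    qed
    then have "?F n \<le> (\<Sum>(a, b)\<in>edges P. 2 * edge_integral a b (\<lambda>x. (norm (\<phi> n x - g x))\<^sup>2) + 2 * edge_integral a b (\<lambda>x. (norm (\<psi> n x - h x))\<^sup>2))"
      by (intro sum_mono) auto
    then show ?thesis by (simp add: case_prod_unfold sum.distrib sum_distrib_left)
  qed
  have nn: "?F n \<ge> 0" for n by (intro sum_nonneg) (auto intro!: edge_integral_nonneg)
  have bound_lim: "(\<lambda>n. 2 * ?A n + 2 * ?B n) \<longlonglongrightarrow> 2 * 0 + 2 * 0" by (intro tendsto_intros \<phi>(3) \<psi>(3))
  have lim: "?F \<longlonglongrightarrow> 0"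
    by (rule nonneg_tendsto_0_bound[OF nn le]) (use bound_lim in simp)
  show ?thesis
    unfolding has_continuous_trace_def
  proof (rule conjI[OF continuous_on_diff[OF c]], rule exI[of _ "\<lambda>n x. \<phi> n x - \<psi> n x"], intro conjI allI)
    show "smooth (\<lambda>x. \<phi> n x - \<psi> n x)" for n by (rule smooth_diff[OF \<phi>(1) \<psi>(1)])
    show "H1_converges (region P) (\<lambda>n x. \<phi> n x - \<psi> n x) (\<lambda>x. u x - v x)"
      by (rule H1_converges_diff[OF \<phi>(1,2) \<psi>(1,2)])
  qed (rule lim)
qed

lemma has_continuous_trace_smooth:
  assumes p: "smooth p"
  shows "has_continuous_trace P p p"
proof -
  have ae: "AE x in lebesgue_on (region P). jacobian p (at x) - weak_grad (region P) p x = 0"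
    using H1_smooth(2)[OF p] by eventually_elim simp
  have s: "square_integrable (region P) (\<lambda>x. jacobian p (at x) - weak_grad (region P) p x)"
    by (intro square_integrable_diff sqint_jacobian H1_weak_grad_sqint H1_smooth(1) p)
  have "l2_norm (region P) (\<lambda>x. jacobian p (at x) - weak_grad (region P) p x) = 0"
    unfolding l2_norm_def
    by (subst l2_inner_cong_AE[OF ae ae s square_integrable_zero s square_integrable_zero]) (simp add: l2_inner_def)
  then show ?thesis
    unfolding has_continuous_trace_def H1_converges_def
    by (intro conjI exI[of _ "\<lambda>n. p"] allI p smooth_continuous_on H1_smooth(1)) (simp_all add: l2_norm_def l2_inner_def edge_integral_def)
qed

lemma stokes_condition_diff:
  assumes H: "u \<in> H1 (region P)" "v \<in> H1 (region P)"
    and u: "stokes_condition k (region P) u" and v: "stokes_condition k (region P) v"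
  shows "stokes_condition k (region P) (\<lambda>x. u x - v x)"
proof -
  let ?U = "region P"
  obtain s p where s: "square_integrable ?U s" "(\<integral>x. s x \<partial>(lebesgue_on ?U)) = 0" "p \<in> polys (k - 1)"
    and sp: "\<And>\<phi>. test_function ?U \<phi> \<Longrightarrow> - l2_inner ?U (weak_grad ?U u) (\<lambda>x. jacobian \<phi> (at x))
             - l2_inner ?U s (\<lambda>x. trace (jacobian \<phi> (at x))) = l2_inner ?U (\<lambda>x. p x *\<^sub>R perp x) \<phi>"
    using u unfolding stokes_condition_def by blast
  obtain t q where t: "square_integrable ?U t" "(\<integral>x. t x \<partial>(lebesgue_on ?U)) = 0" "q \<in> polys (k - 1)"
    and tq: "\<And>\<phi>. test_function ?U \<phi> \<Longrightarrow> - l2_inner ?U (weak_grad ?U v) (\<lambda>x. jacobian \<phi> (at x))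
             - l2_inner ?U t (\<lambda>x. trace (jacobian \<phi> (at x))) = l2_inner ?U (\<lambda>x. q x *\<^sub>R perp x) \<phi>"
    using v unfolding stokes_condition_def by blast
  have int: "integrable (lebesgue_on ?U) f" if "square_integrable ?U f" for f :: "real^2 \<Rightarrow> real"
    using inner_integrable[OF that sqint_smooth[OF smooth_const[of 1]]] by simp
  show ?thesis
    unfolding stokes_condition_def
  proof (rule exI[of _ "\<lambda>x. s x - t x"], rule exI[of _ "\<lambda>x. p x - q x"], intro conjI allI impI)
    show "square_integrable ?U (\<lambda>x. s x - t x)" by (rule square_integrable_diff[OF s(1) t(1)])
    show "(\<integral>x. s x - t x \<partial>(lebesgue_on ?U)) = 0" using s t int by simp
    show "(\<lambda>x. p x - q x) \<in> polys (k - 1)" by (rule polys_diff[OF s(3) t(3)])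
    fix \<phi> :: "real^2 \<Rightarrow> real^2" assume \<phi>: "test_function ?U \<phi>"
    then have s\<phi>: "smooth \<phi>" by (simp add: test_function_def)
    note sj = sqint_jacobian[OF s\<phi>]
    have tr: "square_integrable ?U (\<lambda>x. trace (jacobian \<phi> (at x)))"
      by (rule square_integrable_bounded_linear[OF bounded_linear_trace sj])
    have pp: "square_integrable ?U (\<lambda>x. p x *\<^sub>R perp x)" if "p \<in> polys (k - 1)" for p :: "real^2 \<Rightarrow> real"
      by (intro sqint_smooth smooth_scaleR polys_smooth[OF that] smooth_perp)
    have w: "l2_inner ?U (weak_grad ?U (\<lambda>x. u x - v x)) (\<lambda>x. jacobian \<phi> (at x))
        = l2_inner ?U (weak_grad ?U u) (\<lambda>x. jacobian \<phi> (at x)) - l2_inner ?U (weak_grad ?U v) (\<lambda>x. jacobian \<phi> (at x))"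
      unfolding l2_inner_diff_left[OF H1_weak_grad_sqint[OF H(1)] H1_weak_grad_sqint[OF H(2)] sj, symmetric]
      by (rule l2_inner_cong_AE[OF H1_diff(2)[OF H] AE_I2])
         (auto intro!: H1_weak_grad_sqint H1_diff(1) H square_integrable_diff sj)
    show "- l2_inner ?U (weak_grad ?U (\<lambda>x. u x - v x)) (\<lambda>x. jacobian \<phi> (at x))
        - l2_inner ?U (\<lambda>x. s x - t x) (\<lambda>x. trace (jacobian \<phi> (at x)))
        = l2_inner ?U (\<lambda>x. (p x - q x) *\<^sub>R perp x) \<phi>"
      unfolding w l2_inner_diff_left[OF s(1) t(1) tr] scaleR_diff_left l2_inner_diff_left[OF pp[OF s(3)] pp[OF t(3)] sqint_smooth[OF s\<phi>]]
      using sp[OF \<phi>] tq[OF \<phi>] by simp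
  qed
qed

lemma Vloc_diff:
  assumes P0: "const_projection (region P) (P0 P)" and u: "u \<in> Vloc k P0 P" and v: "v \<in> Vloc k P0 P"
  shows "(\<lambda>x. u x - v x) \<in> Vloc k P0 P"
proof -
  let ?U = "region P"
  have H: "u \<in> H1 ?U" "v \<in> H1 ?U" using u v by (auto simp: Vloc_def)
  have stokes: "stokes_condition k ?U (\<lambda>x. u x - v x)"
    using u v by (intro stokes_condition_diff H) (auto simp: Vloc_def)
  have div: "\<exists>p\<in>polys (k - 1). AE x in lebesgue_on ?U. trace (weak_grad ?U (\<lambda>x. u x - v x) x) = p x"
  proof -
    obtain p q where p: "p \<in> polys (k - 1)" "AE x in lebesgue_on ?U. trace (weak_grad ?U u x) = p x"
      and q: "q \<in> polys (k - 1)" "AE x in lebesgue_on ?U. trace (weak_grad ?U v x) = q x"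
      using u v by (auto simp: Vloc_def)
    have "AE x in lebesgue_on ?U. trace (weak_grad ?U (\<lambda>x. u x - v x) x) = p x - q x"
      using H1_diff(2)[OF H] p(2) q(2) by eventually_elim (simp add: trace_sub)
    then show ?thesis by (intro bexI[OF _ polys_diff[OF p(1) q(1)]])
  qed
  have trace: "\<exists>g. has_continuous_trace P (\<lambda>x. u x - v x) g \<and>
              (\<forall>(a, b)\<in>edges P. \<exists>p\<in>polys k. \<forall>x\<in>closed_segment a b. g x = p x)"
  proof -
    have "\<exists>g. has_continuous_trace P u g \<and> (\<forall>(a, b)\<in>edges P. \<exists>p\<in>polys k. \<forall>x\<in>closed_segment a b. g x = p x)"
      using u by (simp add: Vloc_def)
    then obtain g where g: "has_continuous_trace P u g" "\<forall>(a, b)\<in>edges P. \<exists>p\<in>polys k. \<forall>x\<in>closed_segment a b. g x = p x"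
      by blast
    have "\<exists>h. has_continuous_trace P v h \<and> (\<forall>(a, b)\<in>edges P. \<exists>p\<in>polys k. \<forall>x\<in>closed_segment a b. h x = p x)"
      using v by (simp add: Vloc_def)
    then obtain h where h: "has_continuous_trace P v h" "\<forall>(a, b)\<in>edges P. \<exists>p\<in>polys k. \<forall>x\<in>closed_segment a b. h x = p x"
      by blast
    have "\<exists>p\<in>polys k. \<forall>x\<in>closed_segment a b. g x - h x = p x" if ab: "(a, b) \<in> edges P" for a b
    proof -
      obtain p q where "p \<in> polys k" "\<forall>x\<in>closed_segment a b. g x = p x" "q \<in> polys k" "\<forall>x\<in>closed_segment a b. h x = q x"
        using bspec[OF g(2) ab] bspec[OF h(2) ab] by auto
      then show ?thesis by (intro bexI[of _ "\<lambda>x. p x - q x"] polys_diff) auto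
    qed
    then show ?thesis using has_continuous_trace_diff[OF g(1) h(1)] by blast
  qed
  have "l2_inner ?U (\<lambda>x. (u x - v x) - grad_proj k ?U (P0 P) (\<lambda>x. u x - v x) x) (\<lambda>x. p x *\<^sub>R perp x) = 0"
    if p: "p \<in> hat_polys k P" for p
  proof -
    have sp: "smooth p"
    proof -
      obtain c where c: "p = (\<lambda>x. \<Sum>(i, j)\<in>{(i, j). i + j = k - 2 \<or> i + j = k - 1}. c i j * scaled_monomial P i j x)"
        using p by (auto simp: hat_polys_def)
      have "smooth (scaled_monomial P i j)" for i j
        unfolding scaled_monomial_def[abs_def] Let_def vector_scaleR_component vector_minus_component
        by (intro smooth_mult smooth_power smooth_diff smooth_nth smooth_const smooth_scaleR)
      then show ?thesis unfolding c case_prod_unfold by (intro smooth_sum smooth_mult smooth_const)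
    qed
    have sq: "square_integrable ?U (\<lambda>x. p x *\<^sub>R perp x)" by (intro sqint_smooth smooth_scaleR sp smooth_perp)
    have su: "square_integrable ?U (\<lambda>x. w x - grad_proj k ?U (P0 P) w x)" if "w \<in> H1 ?U" for w
      by (intro square_integrable_diff H1_sqint[OF that] sqint_polys[OF grad_proj_works(1)[OF P0 that]])
    have "l2_inner ?U (\<lambda>x. (u x - v x) - grad_proj k ?U (P0 P) (\<lambda>x. u x - v x) x) (\<lambda>x. p x *\<^sub>R perp x)
      = l2_inner ?U (\<lambda>x. (u x - grad_proj k ?U (P0 P) u x) - (v x - grad_proj k ?U (P0 P) v x)) (\<lambda>x. p x *\<^sub>R perp x)"
      unfolding grad_proj_diff[OF P0 H] by (simp add: algebra_simps)
    also have "\<dots> = 0"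
      unfolding l2_inner_diff_left[OF su[OF H(1)] su[OF H(2)] sq] using u v p by (simp add: Vloc_def)
    finally show ?thesis .
  qed
  then show ?thesis using H1_diff(1)[OF H] stokes div trace by (simp add: Vloc_def)
qed

text \<open>
  A polynomial is its own gradient projection, so the enhancement condition is trivial; the condition
  with content is the Stokes equation.
\<close>

lemma polys_in_Vloc:
  assumes P0: "const_projection (region P) (P0 P)" and p: "p \<in> polys k" and k: "k \<ge> 2"
  shows "p \<in> Vloc k P0 P"
proof -
  note s = polys_smooth[OF p]
  have "\<exists>q\<in>polys (k - 1). AE x in lebesgue_on (region P). trace (weak_grad (region P) p x) = q x"
  proof (rule bexI)
    show "(\<lambda>x. trace (jacobian p (at x))) \<in> polys (k - 1)"
      by (rule polys_bounded_linear[OF bounded_linear_trace jacobian_polys[OF p]])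
    show "AE x in lebesgue_on (region P). trace (weak_grad (region P) p x) = trace (jacobian p (at x))"
      using H1_smooth(2)[OF s] by eventually_elim simp
  qed
  moreover have "\<exists>g. has_continuous_trace P p g \<and> (\<forall>(a, b)\<in>edges P. \<exists>q\<in>polys k. \<forall>x\<in>closed_segment a b. g x = q x)"
    using has_continuous_trace_smooth[OF s] p by blast
  ultimately show ?thesis
    using H1_smooth(1)[OF s] stokes_condition_polys[OF p k]
    by (simp add: Vloc_def grad_proj_of_poly[OF P0 p] l2_inner_zero_left)
qed

text \<open>
  The stabilization is coercive only on members of the local space with vanishing polynomial projection. This
  lemma and the idempotence of the projection allow its use for \<open>v - \<Pi>\<^sub>k v\<close>.
\<close>

lemma residual_in_Vloc:
  assumes P0: "const_projection (region P) (P0 P)" and v: "v \<in> Vloc k P0 P" and k: "k \<ge> 2"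
  shows "residual k P v \<in> Vloc k P0 P"
proof -
  have "v \<in> H1 (region P)" using v by (simp add: Vloc_def)
  then show ?thesis
    unfolding residual_def
    by (intro Vloc_diff P0 v polys_in_Vloc k l2_proj_polys H1_sqint)
qed

end

section \<open>Geometry of mesh elements\<close>

text \<open>
  Only lists with at least two vertices are meant; the other two equations make the function total.
\<close>

fun polygonal_arc :: "(real^2) list \<Rightarrow> real \<Rightarrow> real^2" where
  "polygonal_arc (a # b # c # xs) = linepath a b +++ polygonal_arc (b # c # xs)"
| "polygonal_arc [a, b] = linepath a b"
| "polygonal_arc [a] = linepath a a"
| "polygonal_arc [] = linepath 0 0"

lemma polygonal_arc_ends:
  "xs \<noteq> [] \<Longrightarrow> pathstart (polygonal_arc xs) = hd xs \<and> pathfinish (polygonal_arc xs) = last xs"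
  by (induction xs rule: polygonal_arc.induct) auto

lemma path_image_polygonal_arc:
  "length xs \<ge> 2 \<Longrightarrow> path_image (polygonal_arc xs) = (\<Union>(a, b)\<in>set (zip xs (tl xs)). closed_segment a b)"
proof (induction xs rule: polygonal_arc.induct)
  case (1 a b c xs)
  have "pathfinish (linepath a b) = pathstart (polygonal_arc (b # c # xs))"
    using polygonal_arc_ends[of "b # c # xs"] by simp
  then show ?case using 1 by (simp add: path_image_join)
qed auto

lemma arc_polygonal_arc:
  assumes "length xs \<ge> 2" "distinct xs"
    and "\<And>a b c d. (a, b) \<in> set (zip xs (tl xs)) \<Longrightarrow> (c, d) \<in> set (zip xs (tl xs)) \<Longrightarrow> (a, b) \<noteq> (c, d) \<Longrightarrow>
        closed_segment a b \<inter> closed_segment c d \<subseteq> {a, b} \<inter> {c, d}"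
  shows "arc (polygonal_arc xs)"
  using assms
proof (induction xs rule: polygonal_arc.induct)
  case (1 a b c xs)
  let ?r = "b # c # xs"
  have e: "pathstart (polygonal_arc ?r) = b" using polygonal_arc_ends[of ?r] by simp
  have "arc (polygonal_arc ?r)"
  proof (rule "1.IH")
    show "closed_segment p q \<inter> closed_segment s t \<subseteq> {p, q} \<inter> {s, t}"
      if "(p, q) \<in> set (zip ?r (tl ?r))" "(s, t) \<in> set (zip ?r (tl ?r))" "(p, q) \<noteq> (s, t)" for p q s t
      using that by (intro "1.prems"(3)) auto
  qed (use "1.prems" in auto)
  moreover have "arc (linepath a b)" using "1.prems"(2) by simp
  moreover have "path_image (linepath a b) \<inter> path_image (polygonal_arc ?r) \<subseteq> {b}"
  proof
    fix x assume x: "x \<in> path_image (linepath a b) \<inter> path_image (polygonal_arc ?r)"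
    then obtain s t where st: "(s, t) \<in> set (zip ?r (tl ?r))" "x \<in> closed_segment s t"
      by (auto simp: path_image_polygonal_arc simp del: zip_Cons_Cons)
    have mem: "s \<in> set ?r" "t \<in> set ?r"
      using set_zip_leftD[OF st(1)] set_zip_rightD[OF st(1)] by auto
    then have ne: "s \<noteq> a" "t \<noteq> a" using "1.prems"(2) by auto
    have "closed_segment a b \<inter> closed_segment s t \<subseteq> {a, b} \<inter> {s, t}"
      using st(1) ne by (intro "1.prems"(3)) auto
    then show "x \<in> {b}" using x st(2) ne by auto
  qed
  ultimately show ?case using e by (simp add: arc_join)
qed auto

lemma edges_eq:
  assumes "P \<noteq> []"
  shows "edges P = insert (last P, hd P) (set (zip P (tl P)))"
proof -
  have z: "set (zip (a # xs) (xs @ [y])) = insert (last (a # xs), y) (set (zip (a # xs) xs))" for a y and xs :: element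
    by (induction xs arbitrary: a) auto
  obtain a xs where P: "P = a # xs" using assms by (cases P) auto
  show ?thesis using z[of a xs a] unfolding edges_def P by simp
qed

lemma compact_edge_union: "compact (edge_union P)"
  unfolding edge_union_def by (rule compact_UN) (auto simp: finite_edges)

text \<open>
  The boundary of a simple polygon is the image of a simple closed path, hence homeomorphic to a circle, and
  by the Jordan-Brouwer separation theorem its complement is disconnected. As the outside of a bounded set
  in the plane is connected, it is not the whole complement.
\<close>

lemma simple_polygon_region_nonempty:
  assumes P: "simple_polygon P"
  shows "region P \<noteq> {}"
proof
  assume e: "region P = {}"
  have ne: "P \<noteq> []" and len: "length P \<ge> 3" and dist: "distinct P" using P by (auto simp: simple_polygon_def)
  let ?E = "set (zip P (tl P))"
  have E: "edges P = insert (last P, hd P) ?E" by (rule edges_eq[OF ne])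
  have sep: "closed_segment a b \<inter> closed_segment c d \<subseteq> {a, b} \<inter> {c, d}"
    if "(a, b) \<in> edges P" "(c, d) \<in> edges P" "(a, b) \<noteq> (c, d)" for a b c d
    using bspec[OF bspec[OF conjunct2[OF conjunct2[OF P[unfolded simple_polygon_def]]] that(1), unfolded prod.case] that(2)] that(3)
    by simp
  have a1: "arc (polygonal_arc P)"
    by (rule arc_polygonal_arc) (use len dist sep E in auto)
  have lh: "last P \<noteq> hd P"
    using len dist by (cases P) auto
  have image: "path_image (polygonal_arc P) = (\<Union>(a, b)\<in>?E. closed_segment a b)"
    using len by (intro path_image_polygonal_arc) simp
  have "simple_path (polygonal_arc P +++ linepath (last P) (hd P))"
  proof (rule simple_path_join_loop[OF a1])
    show "path_image (polygonal_arc P) \<inter> path_image (linepath (last P) (hd P))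
        \<subseteq> {pathstart (polygonal_arc P), pathstart (linepath (last P) (hd P))}"
    proof
      fix x assume x: "x \<in> path_image (polygonal_arc P) \<inter> path_image (linepath (last P) (hd P))"
      then obtain s t where st: "(s, t) \<in> ?E" "x \<in> closed_segment s t" by (auto simp: image)
      have "t \<in> set (tl P)" using set_zip_rightD[OF st(1)] .
      then have "t \<noteq> hd P" using dist by (cases P) auto
      then have "closed_segment s t \<inter> closed_segment (last P) (hd P) \<subseteq> {s, t} \<inter> {last P, hd P}"
        using st(1) E by (intro sep) auto
      then show "x \<in> {pathstart (polygonal_arc P), pathstart (linepath (last P) (hd P))}"
        using x st(2) polygonal_arc_ends[OF ne] by auto
    qed
  qed (use lh polygonal_arc_ends[OF ne] in auto)
  moreover have "pathfinish (polygonal_arc P +++ linepath (last P) (hd P)) = pathstart (polygonal_arc P +++ linepath (last P) (hd P))"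
    using polygonal_arc_ends[OF ne] by simp
  moreover have "path_image (polygonal_arc P +++ linepath (last P) (hd P)) = edge_union P"
    using polygonal_arc_ends[OF ne] by (subst path_image_join) (auto simp: image edge_union_def E)
  ultimately have "edge_union P homeomorphic sphere (0::complex) 1"
    using homeomorphic_simple_path_image_circle[of "polygonal_arc P +++ linepath (last P) (hd P)" 1 0] by simp
  moreover have "sphere (0::complex) 1 homeomorphic sphere (0::real^2) 1"
    by (rule homeomorphic_spheres_gen) auto
  ultimately have "\<not> connected (- edge_union P)"
    using Jordan_Brouwer_separation[of "edge_union P" 0 1] homeomorphic_trans by auto
  moreover have "outside (edge_union P) = - edge_union P"
    using e union_with_outside[of "edge_union P"] by (auto simp: region_def outside_def)
  moreover have "connected (outside (edge_union P))"
    by (rule connected_outside) (auto simp: compact_imp_bounded compact_edge_union)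
  ultimately show False by simp
qed

lemma open_region: "open (region P)"
  unfolding region_def by (rule open_inside[OF compact_imp_closed[OF compact_edge_union]])

lemma simple_polygon_element_region:
  assumes "simple_polygon P" shows "element_region P"
  by unfold_locales
     (use simple_polygon_region_nonempty[OF assms] open_region bounded_inside[OF compact_imp_bounded[OF compact_edge_union]]
       in \<open>auto simp: region_def\<close>)

lemma negligible_frontier_region: "negligible (frontier (region P))"
proof (rule negligible_subset)
  show "frontier (region P) \<subseteq> edge_union P"
    unfolding region_def by (rule frontier_inside_subset[OF compact_imp_closed[OF compact_edge_union]])
  have "negligible (closed_segment a b)" for a b :: "real^2"
    by (simp add: negligible_convex_interior interior_closed_segment)
  then show "negligible (edge_union P)"
    unfolding edge_union_def by (intro negligible_Union) (auto simp: finite_edges)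
qed

section \<open>The Poincare inequality on star-shaped elements\<close>

lemma norm_matrix_vector_mult_le:
  fixes A :: "real^2^2"
  shows "(norm (A *v x))\<^sup>2 \<le> (norm A)\<^sup>2 * (norm x)\<^sup>2"
proof -
  have "(norm (A *v x))\<^sup>2 = (\<Sum>i\<in>UNIV. (A $ i \<bullet> x)\<^sup>2)"
    unfolding power2_norm_eq_inner by (subst inner_vec_def) (simp add: matrix_vector_mul_component power2_eq_square)
  also have "\<dots> \<le> (\<Sum>i\<in>UNIV. (A $ i \<bullet> A $ i) * (x \<bullet> x))"
    by (intro sum_mono Cauchy_Schwarz_ineq)
  also have "\<dots> = (norm A)\<^sup>2 * (norm x)\<^sup>2"
    by (simp add: power2_norm_eq_inner inner_vec_def[of A] sum_distrib_right)
  finally show ?thesis .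
qed

lemma inner_le_half_squares: "(a::'a::real_inner) \<bullet> b \<le> ((norm a)\<^sup>2 + (norm b)\<^sup>2) / 2"
proof -
  have "0 \<le> (norm (a - b))\<^sup>2" by simp
  then show ?thesis unfolding power2_norm_eq_inner by (simp add: algebra_simps inner_commute)
qed

text \<open>
  With \<open>D = \<phi> x - \<phi> y\<close>, the fundamental theorem of calculus along the segment expresses \<open>\<bar>D\<bar>\<^sup>2 = D \<cdot> D\<close> as the
  integral of \<open>\<phi>' \<cdot> D \<le> (\<bar>\<phi>'\<bar>\<^sup>2 + \<bar>D\<bar>\<^sup>2) / 2\<close>, and half of \<open>\<bar>D\<bar>\<^sup>2\<close> is absorbed on the left.
\<close>

lemma increment_bound:
  assumes \<phi>: "smooth (\<phi> :: real^2 \<Rightarrow> real^2)"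
  shows "(norm (\<phi> x - \<phi> y))\<^sup>2 \<le> (norm (x - y))\<^sup>2 * integral {0..1} (\<lambda>t. (norm (jacobian \<phi> (at (y + t *\<^sub>R (x - y)))))\<^sup>2)"
proof -
  let ?g = "\<lambda>t. jacobian \<phi> (at (y + t *\<^sub>R (x - y))) *v (x - y)"
  let ?D = "\<phi> x - \<phi> y"
  have cl: "continuous_on S (\<lambda>t. y + t *\<^sub>R (x - y))" for S by (intro continuous_intros)
  have cj: "continuous_on {0..1} (\<lambda>t. jacobian \<phi> (at (y + t *\<^sub>R (x - y))))"
    by (rule continuous_on_compose2[OF continuous_jacobian[OF \<phi>, of UNIV] cl]) auto
  have "((\<lambda>t. \<phi> (y + t *\<^sub>R (x - y))) has_vector_derivative ?g t) (at t within {0..1})" for t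
  proof -
    have l: "((\<lambda>t. y + t *\<^sub>R (x - y)) has_derivative (\<lambda>h. h *\<^sub>R (x - y))) (at t within {0..1})"
      by (auto intro!: derivative_eq_intros)
    have "(\<phi> has_derivative (\<lambda>h. jacobian \<phi> (at (y + t *\<^sub>R (x - y))) *v h)) (at (y + t *\<^sub>R (x - y)))"
      using smooth_differentiable[OF \<phi>] by (simp add: jacobian_works)
    from has_derivative_compose[OF l this] show ?thesis
      by (simp add: has_vector_derivative_def matrix_vector_mult_scaleR)
  qed
  then have "(?g has_integral (\<phi> (y + 1 *\<^sub>R (x - y)) - \<phi> (y + 0 *\<^sub>R (x - y)))) {0..1}"
    by (intro fundamental_theorem_of_calculus) auto
  then have i: "((\<lambda>t. ?g t \<bullet> ?D) has_integral ?D \<bullet> ?D) {0..1}"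
    using has_integral_linear[OF _ bounded_linear_inner_left[of ?D]] by (force simp: o_def)
  have ii: "(\<lambda>t. (norm (jacobian \<phi> (at (y + t *\<^sub>R (x - y)))))\<^sup>2) integrable_on {0..1}"
    by (intro integrable_continuous_interval continuous_intros cj)
  let ?I = "integral {0..1} (\<lambda>t. (norm (jacobian \<phi> (at (y + t *\<^sub>R (x - y)))))\<^sup>2)"
  let ?N = "\<lambda>t. (norm (jacobian \<phi> (at (y + t *\<^sub>R (x - y)))))\<^sup>2 * ((norm (x - y))\<^sup>2 / 2) + (norm ?D)\<^sup>2 / 2"
  have N: "(?N has_integral ?I * ((norm (x - y))\<^sup>2 / 2) + (1 - 0) *\<^sub>R ((norm ?D)\<^sup>2 / 2)) {0..1}"
    by (intro has_integral_add has_integral_mult_left integrable_integral[OF ii])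
       (use has_integral_const_real[of "(norm ?D)\<^sup>2 / 2" 0 1] in simp)
  have "?g t \<bullet> ?D \<le> ?N t" for t
    using inner_le_half_squares[of "?g t" ?D] norm_matrix_vector_mult_le[of "jacobian \<phi> (at (y + t *\<^sub>R (x - y)))" "x - y"]
    by simp
  then have "?D \<bullet> ?D \<le> ?I * ((norm (x - y))\<^sup>2 / 2) + (norm ?D)\<^sup>2 / 2"
    using has_integral_le[OF i N] by simp
  then show ?thesis by (simp add: power2_norm_eq_inner mult.commute)
qed

text \<open>
  The substitution \<open>x \<mapsto> a + s x\<close> has Jacobian determinant \<open>s\<^sup>2 \<ge> 1/4\<close>.
\<close>

lemma nn_integral_affine_le:
  fixes f :: "real^2 \<Rightarrow> ennreal"
  assumes f: "f \<in> borel_measurable borel" and s: "s \<ge> 1/2"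
  shows "(\<integral>\<^sup>+x. f (a + s *\<^sub>R x) \<partial>lborel) \<le> 4 * (\<integral>\<^sup>+x. f x \<partial>lborel)"
proof -
  have s0: "s \<noteq> 0" using s by auto
  have "(\<integral>\<^sup>+x. f x \<partial>lborel) = ennreal (\<bar>s\<bar>^2) * (\<integral>\<^sup>+x. f (a + s *\<^sub>R x) \<partial>lborel)"
  proof -
    have "(\<integral>\<^sup>+x. f x \<partial>lborel) = (\<integral>\<^sup>+x. f x \<partial>(density (distr lborel borel (\<lambda>x. a + s *\<^sub>R x)) (\<lambda>_. \<bar>s\<bar>^DIM(real^2))))"
      using lborel_affine[OF s0, of a] by simp
    also have "\<dots> = (\<integral>\<^sup>+x. ennreal (\<bar>s\<bar>^2) * f (a + s *\<^sub>R x) \<partial>lborel)"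
      using f by (simp add: nn_integral_density nn_integral_distr)
    also have "\<dots> = ennreal (\<bar>s\<bar>^2) * (\<integral>\<^sup>+x. f (a + s *\<^sub>R x) \<partial>lborel)"
      using f by (intro nn_integral_cmult) simp
    finally show ?thesis .
  qed
  then have "4 * (\<integral>\<^sup>+x. f x \<partial>lborel) = ennreal (4 * \<bar>s\<bar>^2) * (\<integral>\<^sup>+x. f (a + s *\<^sub>R x) \<partial>lborel)"
    by (simp add: ennreal_mult mult.assoc)
  moreover have "1 \<le> ennreal (4 * \<bar>s\<bar>^2)"
  proof -
    have "(1/2)^2 \<le> \<bar>s\<bar>^2" using s by (intro power_mono) auto
    then show ?thesis by (simp add: power2_eq_square)
  qed
  ultimately show ?thesis using mult_right_mono[of 1 "ennreal (4 * \<bar>s\<bar>^2)" "\<integral>\<^sup>+x. f (a + s *\<^sub>R x) \<partial>lborel"] by simp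
qed

text \<open>
  The point \<open>y + t (x - y) = (1 - t) y + t x\<close> depends on \<open>y\<close> with factor at least one half if \<open>t \<le> 1/2\<close>, and on
  \<open>x\<close> otherwise. For fixed \<open>t\<close> one integrates first over that variable, where the substitution costs
  at most a factor of four, and then over the other one, which contributes at most the area of \<open>U\<close>.
\<close>

lemma nn_integral_segments_le:
  fixes f :: "real^2 \<Rightarrow> ennreal"
  assumes f: "f \<in> borel_measurable borel" and U: "U \<in> sets borel" and B: "B \<in> sets borel" "B \<subseteq> U"
  shows "(\<integral>\<^sup>+x. \<integral>\<^sup>+y. (\<integral>\<^sup>+t. indicator U x * indicator B y * (indicator {0..1} t * f (y + t *\<^sub>R (x - y))) \<partial>lborel) \<partial>lborel \<partial>lborel)
    \<le> 4 * emeasure lborel U * (\<integral>\<^sup>+x. f x \<partial>lborel)"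
proof -
  let ?h = "\<lambda>x y t. indicator U x * indicator B y * (indicator {0..1} t * f (y + t *\<^sub>R (x - y))) :: ennreal"
  let ?I = "\<integral>\<^sup>+x. f x \<partial>lborel"
  note [measurable] = f U B
  have [measurable]: "{0..1::real} \<in> sets borel" by simp
  have slice: "(\<integral>\<^sup>+x. \<integral>\<^sup>+y. ?h x y t \<partial>lborel \<partial>lborel) \<le> indicator {0..1} t * (4 * emeasure lborel U * ?I)" for t :: real
  proof (cases "t \<in> {0..1}")
    case False
    then show ?thesis by simp
  next
    case True
    show ?thesis
    proof (cases "t \<le> 1/2")
      case t: True
      have "(\<integral>\<^sup>+y. ?h x y t \<partial>lborel) \<le> indicator U x * (4 * ?I)" for x
      proof -
        have "(\<integral>\<^sup>+y. ?h x y t \<partial>lborel) \<le> (\<integral>\<^sup>+y. indicator U x * f (t *\<^sub>R x + (1 - t) *\<^sub>R y) \<partial>lborel)"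
          by (intro nn_integral_mono) (auto simp: indicator_def algebra_simps)
        also have "\<dots> = indicator U x * (\<integral>\<^sup>+y. f (t *\<^sub>R x + (1 - t) *\<^sub>R y) \<partial>lborel)"
          by (intro nn_integral_cmult) simp
        also have "\<dots> \<le> indicator U x * (4 * ?I)"
          using t by (intro mult_left_mono nn_integral_affine_le f) auto
        finally show ?thesis .
      qed
      then have "(\<integral>\<^sup>+x. \<integral>\<^sup>+y. ?h x y t \<partial>lborel \<partial>lborel) \<le> (\<integral>\<^sup>+x. (4 * ?I) * indicator U x \<partial>lborel)"
        by (intro nn_integral_mono) (simp add: mult.commute)
      also have "\<dots> = 4 * ?I * emeasure lborel U" by (rule nn_integral_cmult_indicator) simp
      finally show ?thesis using True by (simp add: ac_simps)
    next
      case t: False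
      have swap: "(\<integral>\<^sup>+x. \<integral>\<^sup>+y. ?h x y t \<partial>lborel \<partial>lborel) = (\<integral>\<^sup>+y. \<integral>\<^sup>+x. ?h x y t \<partial>lborel \<partial>lborel)"
        by (rule lborel_pair.Fubini') measurable
      have "(\<integral>\<^sup>+x. ?h x y t \<partial>lborel) \<le> indicator B y * (4 * ?I)" for y
      proof -
        have "(\<integral>\<^sup>+x. ?h x y t \<partial>lborel) \<le> (\<integral>\<^sup>+x. indicator B y * f ((1 - t) *\<^sub>R y + t *\<^sub>R x) \<partial>lborel)"
          by (intro nn_integral_mono) (auto simp: indicator_def algebra_simps)
        also have "\<dots> = indicator B y * (\<integral>\<^sup>+x. f ((1 - t) *\<^sub>R y + t *\<^sub>R x) \<partial>lborel)"
          by (intro nn_integral_cmult) simp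
        also have "\<dots> \<le> indicator B y * (4 * ?I)"
          using t by (intro mult_left_mono nn_integral_affine_le f) auto
        finally show ?thesis .
      qed
      then have "(\<integral>\<^sup>+y. \<integral>\<^sup>+x. ?h x y t \<partial>lborel \<partial>lborel) \<le> (\<integral>\<^sup>+y. (4 * ?I) * indicator B y \<partial>lborel)"
        by (intro nn_integral_mono) (simp add: mult.commute)
      also have "\<dots> = 4 * ?I * emeasure lborel B" by (rule nn_integral_cmult_indicator) simp
      also have "\<dots> \<le> 4 * ?I * emeasure lborel U"
        using B by (intro mult_left_mono emeasure_mono) auto
      finally have "(\<integral>\<^sup>+y. \<integral>\<^sup>+x. ?h x y t \<partial>lborel \<partial>lborel) \<le> 4 * ?I * emeasure lborel U" .
      then show ?thesis using True unfolding swap by (simp add: ac_simps)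
    qed
  qed
  have "(\<integral>\<^sup>+x. \<integral>\<^sup>+y. \<integral>\<^sup>+t. ?h x y t \<partial>lborel \<partial>lborel \<partial>lborel)
      = (\<integral>\<^sup>+x. \<integral>\<^sup>+t. \<integral>\<^sup>+y. ?h x y t \<partial>lborel \<partial>lborel \<partial>lborel)"
    by (intro nn_integral_cong lborel_pair.Fubini') measurable
  also have "\<dots> = (\<integral>\<^sup>+t. \<integral>\<^sup>+x. \<integral>\<^sup>+y. ?h x y t \<partial>lborel \<partial>lborel \<partial>lborel)"
    by (rule lborel_pair.Fubini') measurable
  also have "\<dots> \<le> (\<integral>\<^sup>+t. (4 * emeasure lborel U * ?I) * indicator {0..1::real} t \<partial>lborel)"
    using slice by (intro nn_integral_mono) (simp add: mult.commute)
  also have "\<dots> = 4 * emeasure lborel U * ?I" by (subst nn_integral_cmult_indicator) auto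
  finally show ?thesis .
qed

lemma ennreal_l2_inner:
  fixes f :: "real^2 \<Rightarrow> 'a::euclidean_space"
  assumes U: "open U" "bounded U" and f: "continuous_on UNIV f"
  shows "ennreal (l2_sq U f) = (\<integral>\<^sup>+x. indicator U x * ennreal ((norm (f x))\<^sup>2) \<partial>lborel)"
proof -
  have Us: "U \<in> sets lebesgue" using U by simp
  have "integrable (lebesgue_on U) (\<lambda>x. f x \<bullet> f x)"
    using continuous_square_integrable[OF U(2) Us f] by (intro inner_integrable)
  then have i: "integrable lebesgue (\<lambda>x. indicator U x *\<^sub>R (f x \<bullet> f x))" by (simp add: integrable_on_eq[OF Us])
  have "ennreal (l2_sq U f) = ennreal (\<integral>x. indicator U x *\<^sub>R (f x \<bullet> f x) \<partial>lebesgue)"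
    unfolding l2_inner_def integral_on_eq[OF Us] ..
  also have "\<dots> = (\<integral>\<^sup>+x. ennreal (indicator U x *\<^sub>R (f x \<bullet> f x)) \<partial>lebesgue)"
    by (rule nn_integral_eq_integral[OF i, symmetric]) (simp add: indicator_def)
  also have "\<dots> = (\<integral>\<^sup>+x. ennreal (indicator U x *\<^sub>R (f x \<bullet> f x)) \<partial>lborel)"
    by (rule nn_integral_completion)
  also have "\<dots> = (\<integral>\<^sup>+x. indicator U x * ennreal ((norm (f x))\<^sup>2) \<partial>lborel)"
    by (intro nn_integral_cong) (auto simp: indicator_def power2_norm_eq_inner)
  finally show ?thesis .
qed

text \<open>
  Jensen's inequality for the mean value \<open>m\<close> over \<open>B\<close>: integrating
  \<open>(z - f y) \<cdot> (z - m) \<le> (\<bar>z - f y\<bar>\<^sup>2 + \<bar>z - m\<bar>\<^sup>2) / 2\<close> over \<open>y\<close> turns the left side into \<open>\<bar>B\<bar> \<bar>z - m\<bar>\<^sup>2\<close>.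
\<close>

lemma mean_square_deviation:
  fixes f :: "real^2 \<Rightarrow> 'a::euclidean_space" and z :: 'a
  assumes B: "open B" "bounded B" "B \<noteq> {}" and f: "continuous_on UNIV f"
  defines "m \<equiv> (1 / measure lborel B) *\<^sub>R (\<integral>y. f y \<partial>(lebesgue_on B))"
  shows "emeasure lborel B * ennreal ((norm (z - m))\<^sup>2) \<le> (\<integral>\<^sup>+y. indicator B y * ennreal ((norm (z - f y))\<^sup>2) \<partial>lborel)"
proof -
  interpret bounded_open_set B by unfold_locales (use B in auto)
  have fin: "emeasure lborel B < \<infinity>" using B(2) by (rule emeasure_bounded_finite)
  have M: "measure lebesgue B = measure lborel B" using B(1) by simp
  have "\<not> negligible B" using open_not_negligible[OF B(1,3)] .
  moreover have "B \<in> lmeasurable" using B by (simp add: lmeasurable_open)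
  ultimately have pos: "measure lborel B > 0" using M
    by (metis negligible_iff_measure0 zero_less_measure_iff)
  have one: "square_integrable B (\<lambda>x. 1::real)" by (rule sqint_smooth[OF smooth_const])
  let ?D = "z - m"
  have c: "continuous_on UNIV (\<lambda>y. z - f y)" by (intro continuous_intros f)
  have D: "square_integrable B (\<lambda>y. ?D)" by (rule sqint_smooth[OF smooth_const])
  have fi: "integrable (lebesgue_on B) f"
  proof -
    have "integrable (lebesgue_on (closure B)) f"
      using continuous_locally_integrable[OF f, of UNIV] B(2) by (simp add: locally_integrable_def compact_closure)
    then show ?thesis by (rule integrable_on_subset_lebesgue) (auto simp: B(1) closure_subset)
  qed
  have const: "l2_sq B (\<lambda>y. ?D) = measure lborel B * (?D \<bullet> ?D)"
    using M U_sets by (simp add: l2_inner_def measure_restrict_space)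
  have "(\<integral>y. z - f y \<partial>(lebesgue_on B)) = measure lborel B *\<^sub>R ?D"
  proof -
    have ci: "integrable (lebesgue_on B) (\<lambda>y. z)"
      using continuous_locally_integrable[of "\<lambda>y. z" UNIV] B integrable_on_subset_lebesgue[of "closure B" "\<lambda>y. z" B]
      by (auto simp: locally_integrable_def compact_closure closure_subset)
    have "(\<integral>y. z - f y \<partial>(lebesgue_on B)) = measure lborel B *\<^sub>R z - (\<integral>y. f y \<partial>(lebesgue_on B))"
      using ci fi M U_sets by (simp add: measure_restrict_space)
    also have "(\<integral>y. f y \<partial>(lebesgue_on B)) = measure lborel B *\<^sub>R m" using pos by (simp add: m_def)
    finally show ?thesis by (simp add: scaleR_diff_right)
  qed
  moreover have "integrable (lebesgue_on B) (\<lambda>y. z - f y)"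
    using continuous_locally_integrable[OF c, of UNIV] B integrable_on_subset_lebesgue[of "closure B" "\<lambda>y. z - f y" B]
    by (auto simp: locally_integrable_def compact_closure closure_subset)
  ultimately have cross: "l2_inner B (\<lambda>y. z - f y) (\<lambda>y. ?D) = measure lborel B * (?D \<bullet> ?D)"
    by (simp add: l2_inner_def)
  have "l2_inner B (\<lambda>y. z - f y) (\<lambda>y. ?D) \<le> (l2_sq B (\<lambda>y. z - f y) + l2_sq B (\<lambda>y. ?D)) / 2"
  proof -
    note s = sqint_continuous[OF c]
    have "(\<integral>y. (z - f y) \<bullet> ?D \<partial>(lebesgue_on B)) \<le> (\<integral>y. ((z - f y) \<bullet> (z - f y) + ?D \<bullet> ?D) / 2 \<partial>(lebesgue_on B))"
      using inner_le_half_squares unfolding power2_norm_eq_inner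
      by (intro integral_mono inner_integrable[OF s D] Bochner_Integration.integrable_divide
          Bochner_Integration.integrable_add inner_integrable[OF s s] inner_integrable[OF D D]) 
    also have "\<dots> = ((\<integral>y. (z - f y) \<bullet> (z - f y) \<partial>(lebesgue_on B)) + (\<integral>y. ?D \<bullet> ?D \<partial>(lebesgue_on B))) / 2"
      by (subst Bochner_Integration.integral_add[OF inner_integrable[OF s s] inner_integrable[OF D D], symmetric]) simp
    finally show ?thesis by (simp only: l2_inner_def)
  qed
  then have "measure lborel B * (?D \<bullet> ?D) \<le> l2_sq B (\<lambda>y. z - f y)"
    unfolding cross const by simp
  then have "ennreal (measure lborel B * (?D \<bullet> ?D)) \<le> ennreal (l2_sq B (\<lambda>y. z - f y))"
    by (rule ennreal_leI)
  then show ?thesis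
    using fin unfolding ennreal_l2_inner[OF B(1,2) c]
    by (simp add: ennreal_mult power2_norm_eq_inner emeasure_eq_ennreal_measure less_top)
qed

text \<open>
  Let \<open>m\<close> be the mean over the ball \<open>B\<close>. Then \<open>\<bar>B\<bar> \<parallel>\<phi> - m\<parallel>\<^sup>2\<close> is at most the double integral of
  \<open>\<bar>\<phi> x - \<phi> y\<bar>\<^sup>2\<close> over \<open>x \<in> U\<close> and \<open>y \<in> B\<close>. Each such pair is joined by a segment within \<open>U\<close>, so that
  the increment is controlled by the gradient along it, and the resulting triple integral by
  \<open>4 h\<^sup>2 \<bar>U\<bar> \<parallel>\<nabla>\<phi>\<parallel>\<^sup>2\<close>. Unlike a compactness argument this gives an explicit constant.
\<close>

lemma poincare_smooth:
  fixes \<phi> :: "real^2 \<Rightarrow> real^2"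
  assumes U: "open U" "bounded U" and star: "star_shaped_wrt_ball U c r" and r: "r > 0"
    and h: "\<And>x y. x \<in> U \<Longrightarrow> y \<in> U \<Longrightarrow> norm (x - y) \<le> h" and \<phi>: "smooth \<phi>"
  obtains m where "measure lborel (ball c r) * l2_sq U (\<lambda>x. \<phi> x - m)
      \<le> 4 * h\<^sup>2 * measure lborel U * l2_sq U (\<lambda>x. jacobian \<phi> (at x))"
proof -
  let ?B = "ball c r"
  have B: "open ?B" "bounded ?B" "?B \<noteq> {}" "?B \<subseteq> U" using r star by (auto simp: star_shaped_wrt_ball_def)
  define m where "m = (1 / measure lborel ?B) *\<^sub>R (\<integral>y. \<phi> y \<partial>(lebesgue_on ?B))"
  define F where "F = (\<lambda>z. indicator U z * ennreal ((norm (jacobian \<phi> (at z)))\<^sup>2))"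
  have c\<phi>: "continuous_on UNIV \<phi>" by (rule smooth_continuous_on[OF \<phi>])
  have cj: "continuous_on UNIV (\<lambda>x. jacobian \<phi> (at x))" by (rule continuous_jacobian[OF \<phi>])
  have [measurable]: "(\<lambda>x. (norm (jacobian \<phi> (at x)))\<^sup>2) \<in> borel_measurable borel"
    by (intro borel_measurable_continuous_onI continuous_intros cj)
  have [measurable]: "\<phi> \<in> borel_measurable borel" by (rule borel_measurable_continuous_onI[OF c\<phi>])
  have Ub[measurable]: "U \<in> sets borel" using U(1) by simp
  have F: "F \<in> borel_measurable borel" unfolding F_def by measurable
  note [measurable] = F
  have seg: "ennreal ((norm (\<phi> x - \<phi> y))\<^sup>2) \<le> ennreal (h\<^sup>2) * (\<integral>\<^sup>+t. indicator {0..1} t * F (y + t *\<^sub>R (x - y)) \<partial>lborel)"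
    if x: "x \<in> U" and y: "y \<in> ?B" for x y
  proof -
    let ?g = "\<lambda>t. (norm (jacobian \<phi> (at (y + t *\<^sub>R (x - y)))))\<^sup>2"
    have cl: "continuous_on S (\<lambda>t. y + t *\<^sub>R (x - y))" for S by (intro continuous_intros)
    have cg: "continuous_on S ?g" for S
      by (intro continuous_intros continuous_on_compose2[OF cj cl]) auto
    have yU: "y \<in> U" using y B(4) by blast
    have seg: "closed_segment y x \<subseteq> U" using star x y by (simp add: star_shaped_wrt_ball_def)
    have inU: "y + t *\<^sub>R (x - y) \<in> U" if "t \<in> {0..1}" for t
    proof -
      have "y + t *\<^sub>R (x - y) = (1 - t) *\<^sub>R y + t *\<^sub>R x" by (simp add: algebra_simps)
      then have "y + t *\<^sub>R (x - y) \<in> closed_segment y x" using that by (auto simp: closed_segment_def)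
      then show ?thesis using seg by blast
    qed
    have "(?g has_integral integral {0..1} ?g) {0..1}"
      by (intro integrable_integral integrable_continuous_interval cg)
    then have "(\<integral>\<^sup>+t. ennreal (indicator {0..1} t * ?g t) \<partial>lborel) = ennreal (integral {0..1} ?g)"
      by (intro nn_integral_has_integral_lebesgue) auto
    moreover have "ennreal (indicator {0..1} t * ?g t) = indicator {0..1} t * F (y + t *\<^sub>R (x - y))" for t
      using inU[of t] by (auto simp: F_def indicator_def)
    ultimately have I: "(\<integral>\<^sup>+t. indicator {0..1} t * F (y + t *\<^sub>R (x - y)) \<partial>lborel) = ennreal (integral {0..1} ?g)"
      by simp
    have "integral {0..1} ?g \<ge> 0" by (rule integral_nonneg) (auto intro!: integrable_continuous_interval cg)
    moreover have "(norm (x - y))\<^sup>2 \<le> h\<^sup>2" using h[OF x yU] by (intro power_mono) auto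
    ultimately have "(norm (x - y))\<^sup>2 * integral {0..1} ?g \<le> h\<^sup>2 * integral {0..1} ?g"
      by (rule mult_right_mono[rotated])
    then have "(norm (\<phi> x - \<phi> y))\<^sup>2 \<le> h\<^sup>2 * integral {0..1} ?g"
      using increment_bound[OF \<phi>, of x y] by linarith
    then have "ennreal ((norm (\<phi> x - \<phi> y))\<^sup>2) \<le> ennreal (h\<^sup>2 * integral {0..1} ?g)" by (rule ennreal_leI)
    also have "\<dots> = ennreal (h\<^sup>2) * ennreal (integral {0..1} ?g)" by (rule ennreal_mult') simp
    finally show ?thesis unfolding I .
  qed
  let ?h = "\<lambda>x y t. indicator U x * indicator ?B y * (indicator {0..1} t * F (y + t *\<^sub>R (x - y)))"
  have "emeasure lborel ?B * ennreal (l2_sq U (\<lambda>x. \<phi> x - m))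
      = (\<integral>\<^sup>+x. emeasure lborel ?B * (indicator U x * ennreal ((norm (\<phi> x - m))\<^sup>2)) \<partial>lborel)"
    by (subst ennreal_l2_inner[OF U]) (auto intro!: continuous_intros c\<phi> nn_integral_cmult[symmetric])
  also have "\<dots> \<le> (\<integral>\<^sup>+x. \<integral>\<^sup>+y. indicator U x * (indicator ?B y * ennreal ((norm (\<phi> x - \<phi> y))\<^sup>2)) \<partial>lborel \<partial>lborel)"
  proof (rule nn_integral_mono)
    fix x
    have "emeasure lborel ?B * (indicator U x * ennreal ((norm (\<phi> x - m))\<^sup>2))
       = indicator U x * (emeasure lborel ?B * ennreal ((norm (\<phi> x - m))\<^sup>2))" by (simp add: ac_simps)
    also have "\<dots> \<le> indicator U x * (\<integral>\<^sup>+y. indicator ?B y * ennreal ((norm (\<phi> x - \<phi> y))\<^sup>2) \<partial>lborel)"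
      unfolding m_def by (intro mult_left_mono mean_square_deviation B c\<phi>) auto
    also have "\<dots> = (\<integral>\<^sup>+y. indicator U x * (indicator ?B y * ennreal ((norm (\<phi> x - \<phi> y))\<^sup>2)) \<partial>lborel)"
    proof (rule nn_integral_cmult[symmetric])
      have [measurable]: "(\<lambda>y. (norm (\<phi> x - \<phi> y))\<^sup>2) \<in> borel_measurable borel"
        by (intro borel_measurable_continuous_onI continuous_intros c\<phi>)
      have [measurable]: "?B \<in> sets borel" by simp
      show "(\<lambda>y. indicator ?B y * ennreal ((norm (\<phi> x - \<phi> y))\<^sup>2)) \<in> borel_measurable lborel"
        unfolding measurable_lborel1 by measurable
    qed
    finally show "emeasure lborel ?B * (indicator U x * ennreal ((norm (\<phi> x - m))\<^sup>2))
       \<le> (\<integral>\<^sup>+y. indicator U x * (indicator ?B y * ennreal ((norm (\<phi> x - \<phi> y))\<^sup>2)) \<partial>lborel)" .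
  qed
  also have "\<dots> \<le> (\<integral>\<^sup>+x. \<integral>\<^sup>+y. ennreal (h\<^sup>2) * (\<integral>\<^sup>+t. ?h x y t \<partial>lborel) \<partial>lborel \<partial>lborel)"
  proof (intro nn_integral_mono)
    fix x y
    show "indicator U x * (indicator ?B y * ennreal ((norm (\<phi> x - \<phi> y))\<^sup>2)) \<le> ennreal (h\<^sup>2) * (\<integral>\<^sup>+t. ?h x y t \<partial>lborel)"
      using seg[of x y] by (cases "x \<in> U \<and> y \<in> ?B") (auto simp: indicator_def)
  qed
  also have "\<dots> = ennreal (h\<^sup>2) * (\<integral>\<^sup>+x. \<integral>\<^sup>+y. \<integral>\<^sup>+t. ?h x y t \<partial>lborel \<partial>lborel \<partial>lborel)"
  proof -
    have [measurable]: "?B \<in> sets borel" by simp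
    have 1: "(\<integral>\<^sup>+y. ennreal (h\<^sup>2) * (\<integral>\<^sup>+t. ?h x y t \<partial>lborel) \<partial>lborel)
        = ennreal (h\<^sup>2) * (\<integral>\<^sup>+y. \<integral>\<^sup>+t. ?h x y t \<partial>lborel \<partial>lborel)" for x
      by (rule nn_integral_cmult) measurable
    have 2: "(\<integral>\<^sup>+x. ennreal (h\<^sup>2) * (\<integral>\<^sup>+y. \<integral>\<^sup>+t. ?h x y t \<partial>lborel \<partial>lborel) \<partial>lborel)
        = ennreal (h\<^sup>2) * (\<integral>\<^sup>+x. \<integral>\<^sup>+y. \<integral>\<^sup>+t. ?h x y t \<partial>lborel \<partial>lborel \<partial>lborel)"
      by (rule nn_integral_cmult) measurable
    show ?thesis unfolding 1 by (rule 2)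
  qed
  also have "\<dots> \<le> ennreal (h\<^sup>2) * (4 * emeasure lborel U * (\<integral>\<^sup>+x. F x \<partial>lborel))"
    by (intro mult_left_mono nn_integral_segments_le F Ub) (use B in auto)
  also have "(\<integral>\<^sup>+x. F x \<partial>lborel) = ennreal (l2_sq U (\<lambda>x. jacobian \<phi> (at x)))"
    unfolding ennreal_l2_inner[OF U cj] F_def ..
  finally have "emeasure lborel ?B * ennreal (l2_sq U (\<lambda>x. \<phi> x - m))
      \<le> ennreal (h\<^sup>2) * (4 * emeasure lborel U * ennreal (l2_sq U (\<lambda>x. jacobian \<phi> (at x))))" .
  moreover have "emeasure lborel ?B = ennreal (measure lborel ?B)" "emeasure lborel U = ennreal (measure lborel U)"
    using emeasure_bounded_finite[OF U(2)] emeasure_bounded_finite[OF B(2)] by (simp_all add: emeasure_eq_ennreal_measure less_top)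
  ultimately have "ennreal (measure lborel ?B * l2_sq U (\<lambda>x. \<phi> x - m))
      \<le> ennreal (4 * h\<^sup>2 * measure lborel U * l2_sq U (\<lambda>x. jacobian \<phi> (at x)))"
    by (simp add: ennreal_mult l2_inner_nonneg ac_simps)
  then have "measure lborel ?B * l2_sq U (\<lambda>x. \<phi> x - m)
      \<le> 4 * h\<^sup>2 * measure lborel U * l2_sq U (\<lambda>x. jacobian \<phi> (at x))"
    by (subst (asm) ennreal_le_iff) (auto intro!: mult_nonneg_nonneg l2_inner_nonneg)
  then show ?thesis by (rule that)
qed

context element_region begin

text \<open>
  The element lies in a disc of radius \<open>h\<close> and contains one of radius \<open>\<rho> h\<close>, so \<open>\<bar>U\<bar> / \<bar>B\<bar> \<le> 1 / \<rho>\<^sup>2\<close>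
  and for smooth functions the constant is \<open>4 h\<^sup>2 / \<rho>\<^sup>2\<close>. The trace condition supplies functions that are smooth up to the boundary and converge to \<open>v\<close> in \<open>H\<^sup>1\<close>. Since \<open>v\<close> has mean zero,
  subtracting a constant only increases its norm; the limit costs a further factor of four.
\<close>

lemma poincare_mean_zero:
  assumes star: "star_shaped_wrt_ball (region P) c r" and r: "r \<ge> \<rho> * elem_diam P" and \<rho>: "\<rho> > 0"
    and v: "v \<in> H1 (region P)" and tr: "has_continuous_trace P v g"
    and mean: "\<And>m. l2_inner (region P) v (\<lambda>x. m) = 0"
  shows "l2_sq (region P) v
    \<le> 16 / \<rho>\<^sup>2 * (elem_diam P)\<^sup>2 * l2_sq (region P) (weak_grad (region P) v)"
proof -
  let ?U = "region P"
  let ?h = "elem_diam P"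
  let ?G = "weak_grad ?U v"
  have h: "norm (x - y) \<le> ?h" if "x \<in> ?U" "y \<in> ?U" for x y
    using diameter_bounded_bound[OF U(2) that] by (simp add: elem_diam_def dist_norm)
  have h0: "?h > 0"
  proof -
    have "diameter ?U \<noteq> 0"
    proof
      assume d0: "diameter ?U = 0"
      obtain a e where a: "e > 0" "ball a e \<subseteq> ?U" using U(1,3) open_contains_ball by blast
      have "a + (e / 2) *\<^sub>R axis 1 1 \<in> ball a e" "a \<in> ball a e" using a(1) by (simp_all add: dist_norm)
      then have "norm ((a + (e / 2) *\<^sub>R axis 1 1) - a) \<le> ?h" using a(2) by (intro h) blast+
      then show False using a(1) d0 by (simp add: elem_diam_def)
    qed
    then show ?thesis using diameter_ge_0[OF U(2)] by (simp add: elem_diam_def)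
  qed
  then have \<rho>h: "\<rho> * ?h > 0" using \<rho> by simp
  then have r0: "r > 0" using r by linarith
  obtain x0 where x0: "x0 \<in> ?U" using U(3) by blast
  define w where "w = unit_ball_vol (real DIM(real^2))"
  have w: "w > 0" by (simp add: w_def)
  have volU: "measure lborel ?U \<le> w * ?h\<^sup>2"
  proof -
    have "?U \<subseteq> cball x0 ?h" using h[OF x0] by (auto simp: dist_norm)
    then have "measure lborel ?U \<le> measure lborel (cball x0 ?h)"
      using U(1) by (intro measure_mono_fmeasurable) (auto simp: fmeasurable_compact)
    then show ?thesis using content_cball[of ?h x0] h0 by (simp add: w_def)
  qed
  have volB: "measure lborel (ball c r) \<ge> w * (\<rho> * ?h)\<^sup>2"
  proof -
    have "(\<rho> * ?h)\<^sup>2 \<le> r\<^sup>2" using r \<rho>h by (intro power_mono) auto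
    then show ?thesis using content_ball[of r c] r0 w by (simp add: w_def)
  qed
  have sm: "\<exists>m. l2_sq ?U (\<lambda>x. \<phi> x - m)
      \<le> 4 / \<rho>\<^sup>2 * ?h\<^sup>2 * l2_sq ?U (\<lambda>x. jacobian \<phi> (at x))"
    if \<phi>: "smooth \<phi>" for \<phi> :: "real^2 \<Rightarrow> real^2"
  proof -
    let ?J = "l2_sq ?U (\<lambda>x. jacobian \<phi> (at x))"
    obtain m where m: "measure lborel (ball c r) * l2_sq ?U (\<lambda>x. \<phi> x - m)
      \<le> 4 * ?h\<^sup>2 * measure lborel ?U * ?J"
      by (rule poincare_smooth[OF U(1,2) star r0 h \<phi>])
    have J: "?J \<ge> 0" by (rule l2_inner_nonneg)
    have "(w * (\<rho> * ?h)\<^sup>2) * l2_sq ?U (\<lambda>x. \<phi> x - m)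
        \<le> measure lborel (ball c r) * l2_sq ?U (\<lambda>x. \<phi> x - m)"
      by (rule mult_right_mono[OF volB l2_inner_nonneg])
    also note m
    also have "4 * ?h\<^sup>2 * measure lborel ?U * ?J \<le> 4 * ?h\<^sup>2 * (w * ?h\<^sup>2) * ?J"
      using volU J by (intro mult_right_mono mult_left_mono) auto
    also have "\<dots> = (w * (\<rho> * ?h)\<^sup>2) * (4 / \<rho>\<^sup>2 * ?h\<^sup>2 * ?J)"
      using \<rho> by (simp add: field_simps power_mult_distrib)
    finally have "l2_sq ?U (\<lambda>x. \<phi> x - m) \<le> 4 / \<rho>\<^sup>2 * ?h\<^sup>2 * ?J"
      by (rule mult_le_cancel_left_pos[OF mult_pos_pos[OF w zero_less_power[OF \<rho>h]], THEN iffD1])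
    then show ?thesis by blast
  qed
  obtain \<phi> where \<phi>: "\<And>n. smooth (\<phi> n)" "H1_converges ?U \<phi> v" using tr by (auto simp: has_continuous_trace_def)
  let ?A = "\<lambda>n. l2_sq ?U (\<lambda>x. \<phi> n x - v x)"
  let ?B = "\<lambda>n. l2_sq ?U (\<lambda>x. jacobian (\<phi> n) (at x) - ?G x)"
  let ?K = "4 / \<rho>\<^sup>2 * ?h\<^sup>2"
  have lim: "?A \<longlonglongrightarrow> 0" "?B \<longlonglongrightarrow> 0"
    using \<phi>(2) by (simp_all add: H1_converges_def l2_norm_tendsto_0_iff)
  have sv: "square_integrable ?U v" and sG: "square_integrable ?U ?G"
    using v by (auto intro: H1_sqint H1_weak_grad_sqint)
  have bound: "l2_sq ?U v \<le> 2 * ?A n + 2 * (?K * (2 * ?B n + 2 * l2_sq ?U ?G))" for n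
  proof -
    obtain m where m: "l2_sq ?U (\<lambda>x. \<phi> n x - m)
      \<le> ?K * l2_sq ?U (\<lambda>x. jacobian (\<phi> n) (at x))"
      using sm[OF \<phi>(1)] by blast
    have c: "square_integrable ?U (\<lambda>x. - m)" by (rule sqint_smooth[OF smooth_const])
    have s1: "square_integrable ?U (\<lambda>x. - (\<phi> n x - v x))"
      using square_integrable_diff[OF sv sqint_smooth[OF \<phi>(1)]] by simp
    have s2: "square_integrable ?U (\<lambda>x. \<phi> n x - m)" by (intro sqint_smooth smooth_diff \<phi>(1) smooth_const)
    have s3: "square_integrable ?U (\<lambda>x. jacobian (\<phi> n) (at x) - ?G x)"
      by (intro square_integrable_diff sqint_jacobian \<phi>(1) sG)
    have "l2_sq ?U v \<le> l2_sq ?U (\<lambda>x. v x + - m)"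
      using l2_orthogonal_add[OF sv c mean] l2_inner_nonneg[of ?U "\<lambda>x. - m"] by linarith
    also have "\<dots> = l2_sq ?U (\<lambda>x. - (\<phi> n x - v x) + (\<phi> n x - m))"
      by (simp add: algebra_simps)
    also have "\<dots> \<le> 2 * l2_sq ?U (\<lambda>x. - (\<phi> n x - v x)) + 2 * l2_sq ?U (\<lambda>x. \<phi> n x - m)"
      by (rule l2_inner_add_le[OF s1 s2])
    also have "l2_sq ?U (\<lambda>x. - (\<phi> n x - v x)) = ?A n"
      by (simp only: l2_inner_def inner_minus_left inner_minus_right minus_minus)
    finally have 1: "l2_sq ?U v \<le> 2 * ?A n + 2 * l2_sq ?U (\<lambda>x. \<phi> n x - m)" .
    have "l2_sq ?U (\<lambda>x. jacobian (\<phi> n) (at x)) \<le> 2 * ?B n + 2 * l2_sq ?U ?G"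
      using l2_inner_add_le[OF s3 sG] by simp
    then have "?K * l2_sq ?U (\<lambda>x. jacobian (\<phi> n) (at x)) \<le> ?K * (2 * ?B n + 2 * l2_sq ?U ?G)"
      by (rule mult_left_mono) simp
    then show ?thesis using 1 m by linarith
  qed
  have "(\<lambda>n. 2 * ?A n + 2 * (?K * (2 * ?B n + 2 * l2_sq ?U ?G)))
      \<longlonglongrightarrow> 2 * 0 + 2 * (?K * (2 * 0 + 2 * l2_sq ?U ?G))"
    by (intro tendsto_intros lim)
  then have "l2_sq ?U v \<le> 2 * 0 + 2 * (?K * (2 * 0 + 2 * l2_sq ?U ?G))"
    by (rule LIMSEQ_le_const) (use bound in blast)
  then show ?thesis by simp
qed

end

section \<open>Korn's inequality\<close>

definition sym_part :: "real^2^2 \<Rightarrow> real^2^2" where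
  "sym_part A = (1 / 2) *\<^sub>R (A + Finite_Cartesian_Product.transpose A)"

lemma sym_part_nth: "sym_part A $ i $ j = (A $ i $ j + A $ j $ i) / 2"
  by (simp add: sym_part_def Finite_Cartesian_Product.transpose_def)

lemma bounded_linear_sym_part: "bounded_linear sym_part"
  unfolding linear_conv_bounded_linear[symmetric]
  by (rule linearI) (simp_all add: vec_eq_iff sym_part_nth algebra_simps add_divide_distrib)

lemma sym_grad_eq: "sym_grad U u x = sym_part (weak_grad U u x)"
  by (simp add: sym_grad_def sym_part_def)

lemma inner_matrix2: "(A::real^2^2) \<bullet> B = A$1$1 * B$1$1 + A$1$2 * B$1$2 + A$2$1 * B$2$1 + A$2$2 * B$2$2"
  by (simp add: inner_vec_def sum_2)

lemma sym_part_inner_le: "sym_part A \<bullet> sym_part A \<le> A \<bullet> A"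
proof -
  have "A \<bullet> A - sym_part A \<bullet> sym_part A = (A$1$2 - A$2$1)\<^sup>2 / 2"
    by (simp add: inner_matrix2 sym_part_nth power2_eq_square field_simps)
  then show ?thesis by (smt (verit) zero_le_power2 divide_nonneg_pos)
qed

context bounded_open_set begin

lemma l2_sym_part_le:
  assumes "square_integrable U G"
  shows "l2_sq U (\<lambda>x. sym_part (G x)) \<le> l2_sq U G"
  unfolding l2_inner_def
  by (intro integral_mono inner_integrable square_integrable_bounded_linear[OF bounded_linear_sym_part] assms sym_part_inner_le)

text \<open>
  Pointwise \<open>2 \<bar>\<epsilon>\<bar>\<^sup>2 = \<bar>\<nabla>\<phi>\<bar>\<^sup>2 + (div \<phi>)\<^sup>2 + 2 (\<partial>\<^sub>2\<phi>\<^sub>1 \<partial>\<^sub>1\<phi>\<^sub>2 - \<partial>\<^sub>1\<phi>\<^sub>1 \<partial>\<^sub>2\<phi>\<^sub>2)\<close>, and the last term integrates to zero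
  because both products have the same integral.
\<close>

lemma korn_test_function:
  fixes \<phi> :: "real^2 \<Rightarrow> real^2"
  assumes \<phi>: "test_function U \<phi>"
  shows "l2_sq U (\<lambda>x. jacobian \<phi> (at x))
    \<le> 2 * l2_sq U (\<lambda>x. sym_part (jacobian \<phi> (at x)))"
proof -
  have s: "smooth \<phi>" using \<phi> by (simp add: test_function_def)
  note sJ = sqint_jacobian[OF s]
  have sS: "square_integrable U (\<lambda>x. sym_part (jacobian \<phi> (at x)))"
    by (rule square_integrable_bounded_linear[OF bounded_linear_sym_part sJ])
  let ?p = "\<lambda>i j x. partial_deriv j (\<lambda>x. \<phi> x $ i) x"
  have sn: "smooth (\<lambda>x. \<phi> x $ i)" for i by (rule smooth_bounded_linear[OF bounded_linear_vec_nth s])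
  have J: "jacobian \<phi> (at x) $ i $ j = ?p i j x" for x i j
    using smooth_differentiable[OF s] by (simp add: jacobian_nth partial_deriv_nth)
  have b: "bounded {x. \<phi> x $ i \<noteq> 0}" for i
  proof (rule bounded_subset[OF U(2)])
    show "{x. \<phi> x $ i \<noteq> 0} \<subseteq> U" using test_function_support[OF test_function_nth[OF \<phi>]] by blast
  qed
  have z: "?p i j x = 0" if "x \<notin> U" for i j x
    using test_function_nth[OF \<phi>, of i] that by (intro partial_deriv_support[of _ U]) (auto simp: test_function_def)
  have on_U: "(\<integral>x. ?p i j x * ?p k l x \<partial>(lebesgue_on U)) = (\<integral>x. ?p i j x * ?p k l x \<partial>lborel)" for i j k l
    by (rule integral_on_lborel[OF U(1)]) (use z in \<open>auto intro!: continuous_intros smooth_continuous_on smooth_partial sn\<close>)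
  have pi: "integrable (lebesgue_on U) (\<lambda>x. ?p i j x * ?p k l x)" for i j k l
    using inner_integrable[OF sqint_smooth[OF smooth_partial[OF sn]] sqint_smooth[OF smooth_partial[OF sn]]] by simp
  have swap: "(\<integral>x. ?p 1 2 x * ?p 2 1 x \<partial>(lebesgue_on U)) = (\<integral>x. ?p 1 1 x * ?p 2 2 x \<partial>(lebesgue_on U))"
    unfolding on_U by (rule integral_mixed_partials[OF smooth_C_diff[OF sn] b smooth_C_diff[OF sn] b])
  have eq: "2 * (sym_part (jacobian \<phi> (at x)) \<bullet> sym_part (jacobian \<phi> (at x))) - jacobian \<phi> (at x) \<bullet> jacobian \<phi> (at x)
      = (?p 1 1 x + ?p 2 2 x)\<^sup>2 + 2 * (?p 1 2 x * ?p 2 1 x - ?p 1 1 x * ?p 2 2 x)" for x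
    by (simp add: inner_matrix2 sym_part_nth J power2_eq_square field_simps)
  have "0 \<le> (\<integral>x. (?p 1 1 x + ?p 2 2 x)\<^sup>2 \<partial>(lebesgue_on U))" by simp
  also have "\<dots> = (\<integral>x. (?p 1 1 x + ?p 2 2 x)\<^sup>2 \<partial>(lebesgue_on U))
      + 2 * ((\<integral>x. ?p 1 2 x * ?p 2 1 x \<partial>(lebesgue_on U)) - (\<integral>x. ?p 1 1 x * ?p 2 2 x \<partial>(lebesgue_on U)))"
    by (simp add: swap)
  also have "\<dots> = (\<integral>x. (?p 1 1 x + ?p 2 2 x)\<^sup>2 + 2 * (?p 1 2 x * ?p 2 1 x - ?p 1 1 x * ?p 2 2 x) \<partial>(lebesgue_on U))"
    using pi by (simp add: power2_eq_square algebra_simps)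
  also have "\<dots> = 2 * l2_sq U (\<lambda>x. sym_part (jacobian \<phi> (at x)))
      - l2_sq U (\<lambda>x. jacobian \<phi> (at x))"
    unfolding eq[symmetric] using inner_integrable[OF sS sS] inner_integrable[OF sJ sJ] by (simp add: l2_inner_def)
  finally show ?thesis by simp
qed

text \<open>
  Approximation by test functions; the strain of the difference is bounded by its gradient. Taking the limit
  with \<open>norm_sq_add_le\<close> twice turns the factor two into eight.
\<close>

lemma korn_H10:
  assumes v: "v \<in> H10 U"
  shows "l2_sq U (weak_grad U v) \<le> 8 * l2_sq U (sym_grad U v)"
proof -
  let ?G = "weak_grad U v"
  obtain \<phi> where \<phi>: "\<And>n. test_function U (\<phi> n)" "H1_converges U \<phi> v" using v by (auto simp: H10_def)
  have s: "smooth (\<phi> n)" for n using \<phi>(1) by (simp add: test_function_def)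
  have vH: "v \<in> H1 U" using \<phi>(2) by (simp add: H1_converges_def)
  let ?J = "\<lambda>n x. jacobian (\<phi> n) (at x)"
  let ?B = "\<lambda>n. l2_sq U (\<lambda>x. ?J n x - ?G x)"
  let ?E = "l2_sq U (\<lambda>x. sym_part (?G x))"
  have lim: "?B \<longlonglongrightarrow> 0" using \<phi>(2) by (simp add: H1_converges_def l2_norm_tendsto_0_iff)
  note sG = H1_weak_grad_sqint[OF vH]
  note sp = square_integrable_bounded_linear[OF bounded_linear_sym_part]
  have bound: "l2_sq U ?G \<le> 10 * ?B n + 8 * ?E" for n
  proof -
    note sJ = sqint_jacobian[OF s[of n]]
    note sD = square_integrable_diff[OF sJ sG]
    have "l2_sq U (\<lambda>x. (-1) *\<^sub>R (?J n x - ?G x) + ?J n x)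
        \<le> 2 * l2_sq U (\<lambda>x. (-1) *\<^sub>R (?J n x - ?G x)) + 2 * l2_sq U (?J n)"
      by (rule l2_inner_add_le[OF square_integrable_scaleR[OF sD] sJ])
    moreover have "l2_sq U (\<lambda>x. (-1) *\<^sub>R (?J n x - ?G x)) = ?B n"
      by (simp only: l2_inner_scaleR_left l2_inner_commute[of U _ "\<lambda>x. (-1) *\<^sub>R (?J n x - ?G x)"])
    moreover have "(\<lambda>x. (-1) *\<^sub>R (?J n x - ?G x) + ?J n x) = ?G" by (simp add: fun_eq_iff)
    ultimately have 1: "l2_sq U ?G \<le> 2 * ?B n + 2 * l2_sq U (?J n)" by simp
    have 2: "l2_sq U (?J n) \<le> 2 * l2_sq U (\<lambda>x. sym_part (?J n x))"
      by (rule korn_test_function[OF \<phi>(1)])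
    have "sym_part (?J n x) = sym_part (?J n x - ?G x) + sym_part (?G x)" for x
      by (simp add: linear_simps(1)[OF bounded_linear_sym_part, symmetric])
    then have "l2_sq U (\<lambda>x. sym_part (?J n x))
       = l2_sq U (\<lambda>x. sym_part (?J n x - ?G x) + sym_part (?G x))"
      by simp
    also have "\<dots> \<le> 2 * l2_sq U (\<lambda>x. sym_part (?J n x - ?G x)) + 2 * ?E"
      by (rule l2_inner_add_le[OF sp[OF sD] sp[OF sG]])
    also have "l2_sq U (\<lambda>x. sym_part (?J n x - ?G x)) \<le> ?B n"
      by (rule l2_sym_part_le[OF sD])
    finally show ?thesis using 1 2 by simp
  qed
  have "(\<lambda>n. 10 * ?B n + 8 * ?E) \<longlonglongrightarrow> 10 * 0 + 8 * ?E" by (intro tendsto_intros lim)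
  then have "l2_sq U ?G \<le> 10 * 0 + 8 * ?E"
    by (rule LIMSEQ_le_const) (use bound in blast)
  then show ?thesis by (simp add: sym_grad_eq[abs_def])
qed

end

section \<open>Integrals over the mesh\<close>

text \<open>
  The regions are disjoint, and the points of the domain outside all of them lie on element boundaries, a null set.
\<close>

lemma mesh_integral:
  fixes f :: "real^2 \<Rightarrow> real"
  assumes M: "polygonal_mesh \<Omega> M" and \<Omega>: "open \<Omega>" and f: "integrable (lebesgue_on \<Omega>) f"
  shows "(\<integral>x. f x \<partial>(lebesgue_on \<Omega>)) = (\<Sum>P\<in>M. \<integral>x. f x \<partial>(lebesgue_on (region P)))"
proof -
  have fin: "finite M" and sub: "\<And>P. P \<in> M \<Longrightarrow> region P \<subseteq> \<Omega>"
    and disj: "\<And>P Q. P \<in> M \<Longrightarrow> Q \<in> M \<Longrightarrow> P \<noteq> Q \<Longrightarrow> region P \<inter> region Q = {}"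
    and cov: "closure \<Omega> = (\<Union>P\<in>M. closure (region P))"
    using M by (auto simp: polygonal_mesh_def)
  have \<Omega>s: "\<Omega> \<in> sets lebesgue" using \<Omega> by simp
  have Ps: "region P \<in> sets lebesgue" for P using open_region by simp
  let ?N = "\<Union>P\<in>M. frontier (region P)"
  have "negligible ?N" using fin negligible_frontier_region by (intro negligible_Union) auto
  then have "AE x in lebesgue. x \<notin> ?N" unfolding negligible_iff_null_sets by (rule AE_not_in)
  then have ae: "AE x in lebesgue. indicator \<Omega> x *\<^sub>R f x = (\<Sum>P\<in>M. indicator (region P) x *\<^sub>R f x)"
  proof eventually_elim
    case (elim x)
    show "indicator \<Omega> x *\<^sub>R f x = (\<Sum>P\<in>M. indicator (region P) x *\<^sub>R f x)"
    proof (cases "x \<in> \<Omega>")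
      case True
      then have "x \<in> closure \<Omega>" using closure_subset by blast
      then obtain P where P: "P \<in> M" "x \<in> closure (region P)" using cov by blast
      then have xP: "x \<in> region P"
        using elim open_region[of P] by (auto simp: frontier_def interior_open)
      have "(\<Sum>Q\<in>M. indicator (region Q) x *\<^sub>R f x) = indicator (region P) x *\<^sub>R f x + (\<Sum>Q\<in>M - {P}. indicator (region Q) x *\<^sub>R f x)"
        by (rule sum.remove[OF fin P(1)])
      also have "(\<Sum>Q\<in>M - {P}. indicator (region Q) x *\<^sub>R f x) = 0"
        using disj[OF P(1)] xP by (intro sum.neutral) (auto simp: indicator_def)
      finally show ?thesis using True xP by simp
    next
      case False
      then have "x \<notin> region P" if "P \<in> M" for P using sub[OF that] by blast
      then show ?thesis using False by simp
    qed
  qed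
  have i: "integrable lebesgue (\<lambda>x. indicator (region P) x *\<^sub>R f x)" if "P \<in> M" for P
    using integrable_on_subset_lebesgue[OF f \<Omega>s Ps sub[OF that]] unfolding integrable_on_eq[OF Ps] .
  have i\<Omega>: "integrable lebesgue (\<lambda>x. indicator \<Omega> x *\<^sub>R f x)" using f unfolding integrable_on_eq[OF \<Omega>s] .
  have "(\<integral>x. f x \<partial>(lebesgue_on \<Omega>)) = (\<integral>x. (\<Sum>P\<in>M. indicator (region P) x *\<^sub>R f x) \<partial>lebesgue)"
    unfolding integral_on_eq[OF \<Omega>s]
    by (rule integral_cong_AE[OF _ _ ae])
       (use borel_measurable_integrable[OF i\<Omega>] borel_measurable_integrable[OF i] in \<open>auto intro!: borel_measurable_sum\<close>)
  also have "\<dots> = (\<Sum>P\<in>M. \<integral>x. f x \<partial>(lebesgue_on (region P)))"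
    unfolding integral_on_eq[OF Ps] by (rule Bochner_Integration.integral_sum[OF i])
  finally show ?thesis .
qed

section \<open>Coercivity\<close>

lemma interior_bdry_integral_nonneg:
  "(\<And>t x. f t x \<ge> 0) \<Longrightarrow> interior_bdry_integral \<Gamma> P f \<ge> 0"
  unfolding interior_bdry_integral_def by (intro sum_nonneg) (auto intro!: edge_integral_nonneg)

text \<open>
  On the diagonal every jump integrand is a square, and a Bochner integral of a nonnegative function is
  nonnegative whether or not the function is integrable.
\<close>

lemma J_loc_nonneg:
  assumes "\<delta>1 \<ge> 0" "\<delta>2 \<ge> 0" "\<delta>3 \<ge> 0" and S: "S P (residual k P v) (residual k P v) \<ge> 0" and d: "elem_diam P \<ge> 0"
  shows "J_loc k \<Omega> M \<beta> \<delta>1 \<delta>2 \<delta>3 S P v v \<ge> 0"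
proof -
  have "J1_loc k \<Omega> M \<beta> P v v \<ge> 0" "J2_loc k \<Omega> M \<beta> P v v \<ge> 0" "J3_loc k \<Omega> M \<beta> P v v \<ge> 0"
    unfolding J1_loc_def J2_loc_def J3_loc_def
    by (intro mult_nonneg_nonneg interior_bdry_integral_nonneg zero_le_power d inner_ge_zero zero_le_square; simp)+
  moreover have "Max {\<delta>1, \<delta>2, \<delta>3} \<ge> 0" using assms(1) by (simp add: max_def)
  ultimately show ?thesis
    unfolding J_loc_def using assms by (intro add_nonneg_nonneg mult_nonneg_nonneg) auto
qed

context element_region begin

lemma elem_diam_nonneg: "elem_diam P \<ge> 0"
  unfolding elem_diam_def by (rule diameter_ge_0[OF U(2)])

lemma residual_proj_zero:
  "v \<in> H1 (region P) \<Longrightarrow> l2_proj k (region P) (residual k P v) = (\<lambda>x. 0)"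
  unfolding residual_def by (rule l2_proj_residual[OF H1_sqint])

lemma stabilization_coercive:
  assumes S: "stabilization k P0 alo ahi P S" and P0: "const_projection (region P) (P0 P)"
    and k: "k \<ge> 2" and v: "v \<in> Vloc k P0 P"
  shows "alo * l2_sq (region P) (weak_grad (region P) (residual k P v))
    \<le> S (residual k P v) (residual k P v)"
proof -
  have "v \<in> H1 (region P)" using v by (simp add: Vloc_def)
  then have "l2_proj k (region P) (residual k P v) = (\<lambda>x. 0)" by (rule residual_proj_zero)
  moreover have "\<forall>v\<in>Vloc k P0 P. l2_proj k (region P) v = (\<lambda>x. 0) \<longrightarrow>
      alo * (l2_norm (region P) (weak_grad (region P) v))\<^sup>2 \<le> S v v"
    using S unfolding stabilization_def by blast
  ultimately show ?thesis
    using residual_in_Vloc[OF P0 v k] unfolding l2_norm_sq by blast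
qed

text \<open>
  As \<open>\<Pi>\<^sub>k v\<close> is a polynomial of degree \<open>k\<close>, its strain competes in the best approximation of \<open>\<epsilon>(v)\<close> by
  polynomials of degree \<open>k - 1\<close>. What the projection misses is therefore at most
  \<open>\<epsilon>(v - \<Pi>\<^sub>k v)\<close>, which the gradient of the residual bounds.
\<close>

lemma strain_projection_estimate:
  assumes v: "v \<in> H1 (region P)"
  shows "l2_sq (region P) (sym_grad (region P) v)
    \<le> l2_sq (region P) (l2_proj (k - 1) (region P) (sym_grad (region P) v))
      + l2_sq (region P) (weak_grad (region P) (residual k P v))"
proof -
  let ?U = "region P"
  let ?p = "l2_proj k ?U v"
  have p: "?p \<in> polys k" by (rule l2_proj_polys[OF H1_sqint[OF v]])
  note sp = polys_smooth[OF p]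
  have eq: "sym_grad ?U v = (\<lambda>x. sym_part (weak_grad ?U v x))" by (rule ext) (rule sym_grad_eq)
  have s: "square_integrable ?U (sym_grad ?U v)"
    unfolding eq by (rule square_integrable_bounded_linear[OF bounded_linear_sym_part H1_weak_grad_sqint[OF v]])
  have q: "(\<lambda>x. sym_part (jacobian ?p (at x))) \<in> polys (k - 1)"
    by (rule polys_bounded_linear[OF bounded_linear_sym_part jacobian_polys[OF p]])
  have sD: "square_integrable ?U (\<lambda>x. weak_grad ?U v x - jacobian ?p (at x))"
    by (rule square_integrable_diff[OF H1_weak_grad_sqint[OF v] sqint_jacobian[OF sp]])
  have r: "residual k P v \<in> H1 ?U" unfolding residual_def by (rule H1_diff(1)[OF v H1_smooth(1)[OF sp]])
  have ae: "AE x in lebesgue_on ?U. weak_grad ?U v x - jacobian ?p (at x) = weak_grad ?U (residual k P v) x"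
    unfolding residual_def using H1_diff(2)[OF v H1_smooth(1)[OF sp]] H1_smooth(2)[OF sp] by eventually_elim simp
  have "l2_sq ?U (\<lambda>x. sym_grad ?U v x - l2_proj (k - 1) ?U (sym_grad ?U v) x)
     \<le> l2_sq ?U (\<lambda>x. sym_grad ?U v x - sym_part (jacobian ?p (at x)))"
    by (rule l2_proj_best[OF s q])
  also have "\<dots> = l2_sq ?U (\<lambda>x. sym_part (weak_grad ?U v x - jacobian ?p (at x)))"
    by (simp add: sym_grad_eq linear_simps(2)[OF bounded_linear_sym_part])
  also have "\<dots> \<le> l2_sq ?U (\<lambda>x. weak_grad ?U v x - jacobian ?p (at x))"
    by (rule l2_sym_part_le[OF sD])
  also have "\<dots> = l2_sq ?U (weak_grad ?U (residual k P v))"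
    by (rule l2_inner_cong_AE[OF ae ae sD H1_weak_grad_sqint[OF r] sD H1_weak_grad_sqint[OF r]])
  finally show ?thesis using l2_proj_pythagoras[OF s, of "k - 1"] by simp
qed

text \<open>
  Constants are polynomials of degree \<open>k\<close>, so the residual has mean zero.
\<close>

lemma residual_poincare:
  assumes star: "star_shaped_wrt_ball (region P) c r" and r: "r \<ge> \<rho> * elem_diam P" and \<rho>: "\<rho> > 0"
    and P0: "const_projection (region P) (P0 P)" and k: "k \<ge> 2" and v: "v \<in> Vloc k P0 P"
  shows "l2_sq (region P) v \<le> l2_sq (region P) (l2_proj k (region P) v)
    + 16 / \<rho>\<^sup>2 * (elem_diam P)\<^sup>2 * l2_sq (region P) (weak_grad (region P) (residual k P v))"
proof -
  have vH: "v \<in> H1 (region P)" using v by (simp add: Vloc_def)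
  have rV: "residual k P v \<in> Vloc k P0 P" by (rule residual_in_Vloc[OF _ v k]) (rule P0)
  then have rH: "residual k P v \<in> H1 (region P)" by (simp add: Vloc_def)
  obtain g where g: "has_continuous_trace P (residual k P v) g" using rV unfolding Vloc_def by blast
  have "l2_inner (region P) (residual k P v) (\<lambda>x. m) = 0" for m
    unfolding residual_def by (rule l2_proj_orthogonal[OF H1_sqint[OF vH] polys_const])
  from poincare_mean_zero[OF star r \<rho> rH g this] show ?thesis
    using l2_proj_pythagoras[OF H1_sqint[OF vH], of k] by (simp add: residual_def[abs_def])
qed

end

theorem proposition4p7:
  fixes \<Omega> :: "(real^2) set" and k :: nat and \<rho> alo ahi :: real
  assumes "polygonal_domain \<Omega>" and "simply_connected \<Omega>"
    and "k \<ge> 2" and "\<rho> > 0" and "alo > 0" and "ahi > 0"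
  shows "\<exists>C>0. \<forall>(M :: element set) (\<nu> :: real) (\<sigma> :: real) (\<beta> :: real^2 \<Rightarrow> real^2)
            (\<delta>1 :: real) (\<delta>2 :: real) (\<delta>3 :: real)
            (P0 :: element \<Rightarrow> (real^2 \<Rightarrow> real^2) \<Rightarrow> real^2) (S :: element \<Rightarrow> local_form).
          polygonal_mesh \<Omega> M \<longrightarrow> mesh_regular \<rho> M \<longrightarrow>
          \<nu> > 0 \<longrightarrow> \<sigma> > 0 \<longrightarrow> advection_field \<Omega> \<beta> \<longrightarrow>
          \<delta>1 > 0 \<longrightarrow> \<delta>2 > 0 \<longrightarrow> \<delta>3 > 0 \<longrightarrow>
          (\<forall>P\<in>M. const_projection (region P) (P0 P)) \<longrightarrow>
          (\<forall>P\<in>M. stabilization k P0 alo ahi P (S P)) \<longrightarrow>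
          (\<forall>v\<in>Vh k P0 \<Omega> M.
             (K_norm k \<Omega> M \<nu> \<sigma> \<beta> \<delta>1 \<delta>2 \<delta>3 S v)\<^sup>2 \<le> C * Kh k \<Omega> M \<nu> \<sigma> \<beta> \<delta>1 \<delta>2 \<delta>3 S v v)"
proof -
  \<comment> \<open>The summands pay for the strain, for its residual, and for the residual of the mass term.\<close>
  define C where "C = 8 + 8 / alo + 16 / (\<rho>\<^sup>2 * alo)"
  have alo: "alo > 0" and \<rho>: "\<rho> > 0" and k: "k \<ge> 2" by fact+
  have Cpos: "C > 0" unfolding C_def using alo by (intro add_pos_nonneg) auto
  interpret dom: bounded_open_set \<Omega>
    using \<open>polygonal_domain \<Omega>\<close> by unfold_locales (auto simp: polygonal_domain_def)
  show ?thesis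
  proof (rule exI[of _ C], intro conjI Cpos allI impI ballI)
    fix M :: "element set" and \<nu> \<sigma> :: real and \<beta> :: "real^2 \<Rightarrow> real^2" and \<delta>1 \<delta>2 \<delta>3 :: real
      and P0 :: "element \<Rightarrow> (real^2 \<Rightarrow> real^2) \<Rightarrow> real^2" and S :: "element \<Rightarrow> local_form" and v :: "real^2 \<Rightarrow> real^2"
    assume M: "polygonal_mesh \<Omega> M" and reg: "mesh_regular \<rho> M" and \<nu>: "\<nu> > 0" and \<sigma>: "\<sigma> > 0"
      and \<delta>: "\<delta>1 > 0" "\<delta>2 > 0" "\<delta>3 > 0"
      and P0: "\<forall>P\<in>M. const_projection (region P) (P0 P)"
      and S: "\<forall>P\<in>M. stabilization k P0 alo ahi P (S P)" and v: "v \<in> Vh k P0 \<Omega> M"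
    have v10: "v \<in> H10 \<Omega>" and vloc: "\<And>P. P \<in> M \<Longrightarrow> v \<in> Vloc k P0 P" using v by (auto simp: Vh_def)
    have vH: "v \<in> H1 \<Omega>" using v10 by (auto simp: H10_def H1_converges_def)
    have vHP: "v \<in> H1 (region P)" if "P \<in> M" for P using vloc[OF that] by (simp add: Vloc_def)
    have sub: "region P \<subseteq> \<Omega>" if "P \<in> M" for P using M that by (simp add: polygonal_mesh_def)
    have el: "element_region P" if "P \<in> M" for P
      using M that by (intro simple_polygon_element_region) (simp add: polygonal_mesh_def)
    define g where "g P = l2_inner (region P) (weak_grad (region P) v) (weak_grad (region P) v)" for P
    define n where "n P = l2_inner (region P) v v" for P
    define \<epsilon> where "\<epsilon> P = l2_inner (region P) (sym_grad (region P) v) (sym_grad (region P) v)" for P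
    define e where "e P = l2_inner (region P) (l2_proj (k - 1) (region P) (sym_grad (region P) v))
        (l2_proj (k - 1) (region P) (sym_grad (region P) v))" for P
    define p where "p P = l2_inner (region P) (l2_proj k (region P) v) (l2_proj k (region P) v)" for P
    define s where "s P = S P (residual k P v) (residual k P v)" for P
    define j where "j P = J_loc k \<Omega> M \<beta> \<delta>1 \<delta>2 \<delta>3 S P v v" for P
    let ?r = "\<lambda>P. l2_inner (region P) (weak_grad (region P) (residual k P v)) (weak_grad (region P) (residual k P v))"
    have r: "?r P \<le> s P / alo" "?r P \<ge> 0" "s P \<ge> 0" if "P \<in> M" for P
    proof -
      interpret element_region P by (rule el[OF that])
      have *: "alo * ?r P \<le> s P"
        unfolding s_def
        by (rule stabilization_coercive[OF bspec[OF S that] _ k vloc[OF that]]) (rule bspec[OF P0 that])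
      show r0: "?r P \<ge> 0" by (rule l2_inner_nonneg)
      show "?r P \<le> s P / alo" using * alo by (simp add: field_simps)
      show "s P \<ge> 0" using * mult_nonneg_nonneg[OF less_imp_le[OF alo] r0] by linarith
    qed
    have nonneg: "g P \<ge> 0" "n P \<ge> 0" "e P \<ge> 0" "p P \<ge> 0" for P
      by (simp_all add: g_def n_def e_def p_def l2_inner_nonneg)
    have h: "elem_diam P \<ge> 0" if "P \<in> M" for P using element_region.elem_diam_nonneg[OF el[OF that]] .
    have j: "j P \<ge> 0" if "P \<in> M" for P
      unfolding j_def using \<delta> r(3)[OF that] h[OF that] by (intro J_loc_nonneg) (auto simp: s_def)
    have strain: "\<epsilon> P \<le> e P + s P / alo" if "P \<in> M" for P
      using element_region.strain_projection_estimate[OF el[OF that] vHP[OF that], of k] r(1)[OF that]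
      by (simp add: \<epsilon>_def e_def)
    have mass: "n P \<le> p P + 16 / \<rho>\<^sup>2 * (elem_diam P)\<^sup>2 * (s P / alo)" if PM: "P \<in> M" for P
    proof -
      obtain c rad where "star_shaped_wrt_ball (region P) c rad" "rad \<ge> \<rho> * elem_diam P"
        using reg PM unfolding mesh_regular_def by blast
      from element_region.residual_poincare[OF el[OF PM] this \<rho> _ k vloc[OF PM], OF bspec[OF P0 PM]]
      have "n P \<le> p P + 16 / \<rho>\<^sup>2 * (elem_diam P)\<^sup>2 * ?r P" by (simp add: n_def p_def)
      also have "\<dots> \<le> p P + 16 / \<rho>\<^sup>2 * (elem_diam P)\<^sup>2 * (s P / alo)"
        by (intro add_left_mono mult_left_mono r(1)[OF PM]) simp
      finally show ?thesis .
    qed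
    have korn: "(\<Sum>P\<in>M. g P) \<le> 8 * (\<Sum>P\<in>M. \<epsilon> P)"
    proof -
      let ?G = "weak_grad \<Omega> v"
      note sG = dom.H1_weak_grad_sqint[OF vH]
      have eq: "sym_grad U v = (\<lambda>x. sym_part (weak_grad U v x))" for U by (rule ext) (rule sym_grad_eq)
      have sE: "square_integrable \<Omega> (sym_grad \<Omega> v)"
        unfolding eq by (rule square_integrable_bounded_linear[OF bounded_linear_sym_part sG])
      have loc: "g P = l2_inner (region P) ?G ?G" "\<epsilon> P = l2_inner (region P) (sym_grad \<Omega> v) (sym_grad \<Omega> v)"
        if PM: "P \<in> M" for P
      proof -
        interpret element_region P by (rule el[OF PM])
        have ae: "AE x in lebesgue_on (region P). weak_grad (region P) v x = ?G x"
          by (rule weak_grad_eqI[OF has_weak_grad_subset[OF dom.U(1) U(1) sub[OF PM] dom.H1_has_weak_grad[OF vH]]])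
        have sGP: "square_integrable (region P) ?G"
          by (rule square_integrable_subset[OF sG sub[OF PM] dom.U_sets U_sets])
        note sg = H1_weak_grad_sqint[OF vHP[OF PM]]
        note sp = square_integrable_bounded_linear[OF bounded_linear_sym_part]
        show "g P = l2_inner (region P) ?G ?G"
          unfolding g_def by (rule l2_inner_cong_AE[OF ae ae sg sGP sg sGP])
        have ae': "AE x in lebesgue_on (region P). sym_part (weak_grad (region P) v x) = sym_part (?G x)"
          using ae by eventually_elim simp
        show "\<epsilon> P = l2_inner (region P) (sym_grad \<Omega> v) (sym_grad \<Omega> v)"
          unfolding \<epsilon>_def eq by (rule l2_inner_cong_AE[OF ae' ae' sp[OF sg] sp[OF sGP] sp[OF sg] sp[OF sGP]])
      qed
      have "(\<Sum>P\<in>M. g P) = l2_inner \<Omega> ?G ?G"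
        using mesh_integral[OF M dom.U(1) inner_integrable[OF sG sG]] loc(1) by (simp add: l2_inner_def)
      also have "\<dots> \<le> 8 * l2_inner \<Omega> (sym_grad \<Omega> v) (sym_grad \<Omega> v)" by (rule dom.korn_H10[OF v10])
      also have "l2_inner \<Omega> (sym_grad \<Omega> v) (sym_grad \<Omega> v) = (\<Sum>P\<in>M. \<epsilon> P)"
        using mesh_integral[OF M dom.U(1) inner_integrable[OF sE sE]] loc(2) by (simp add: l2_inner_def)
      finally show ?thesis .
    qed
    have "(K_norm k \<Omega> M \<nu> \<sigma> \<beta> \<delta>1 \<delta>2 \<delta>3 S v)\<^sup>2 = (\<Sum>P\<in>M. \<nu> * g P + \<sigma> * n P + j P)"
      unfolding K_norm_def using \<nu> \<sigma> nonneg j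
      by (subst real_sqrt_pow2) (auto intro!: sum_nonneg add_nonneg_nonneg mult_nonneg_nonneg simp: l2_norm_sq g_def n_def j_def)
    also have "\<dots> = \<nu> * (\<Sum>P\<in>M. g P) + (\<Sum>P\<in>M. \<sigma> * n P + j P)"
      by (simp add: sum.distrib sum_distrib_left)
    also have "\<dots> \<le> \<nu> * (8 * (\<Sum>P\<in>M. \<epsilon> P)) + (\<Sum>P\<in>M. \<sigma> * n P + j P)"
      using korn \<nu> by (intro add_right_mono mult_left_mono) auto
    also have "\<dots> = (\<Sum>P\<in>M. 8 * \<nu> * \<epsilon> P + \<sigma> * n P + j P)"
      by (simp add: sum.distrib sum_distrib_left mult.assoc mult.left_commute)
    also have "\<dots> \<le> (\<Sum>P\<in>M. C * (\<nu> * e P + \<sigma> * p P + (\<nu> + \<sigma> * (elem_diam P)\<^sup>2) * s P + j P))"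
    proof (rule sum_mono)
      fix P assume PM: "P \<in> M"
      let ?d = "(elem_diam P)\<^sup>2"
      have c: "C \<ge> 8" "C \<ge> 8 / alo" "C \<ge> 16 / \<rho>\<^sup>2 / alo" "C \<ge> 1"
        using alo \<rho> by (simp_all add: C_def field_simps add_nonneg_nonneg)
      have "8 * \<nu> * \<epsilon> P \<le> 8 * \<nu> * (e P + s P / alo)"
        using strain[OF PM] \<nu> by (intro mult_left_mono) auto
      moreover have "\<sigma> * n P \<le> \<sigma> * (p P + 16 / \<rho>\<^sup>2 * ?d * (s P / alo))"
        using mass[OF PM] \<sigma> by (intro mult_left_mono) auto
      moreover have "8 * (\<nu> * e P) \<le> C * (\<nu> * e P)" "8 / alo * (\<nu> * s P) \<le> C * (\<nu> * s P)"
        "1 * (\<sigma> * p P) \<le> C * (\<sigma> * p P)" "16 / \<rho>\<^sup>2 / alo * (\<sigma> * ?d * s P) \<le> C * (\<sigma> * ?d * s P)" "1 * j P \<le> C * j P"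
        using c \<nu> \<sigma> nonneg r(3)[OF PM] j[OF PM] by (intro mult_right_mono mult_nonneg_nonneg; simp)+
      ultimately show "8 * \<nu> * \<epsilon> P + \<sigma> * n P + j P
          \<le> C * (\<nu> * e P + \<sigma> * p P + (\<nu> + \<sigma> * ?d) * s P + j P)"
        by (simp add: algebra_simps)
    qed
    also have "\<dots> = C * Kh k \<Omega> M \<nu> \<sigma> \<beta> \<delta>1 \<delta>2 \<delta>3 S v v"
      unfolding Kh_def sum_distrib_left
      by (intro sum.cong) (simp_all add: A_loc_def c_skew_loc_def e_def p_def s_def j_def)
    finally show "(K_norm k \<Omega> M \<nu> \<sigma> \<beta> \<delta>1 \<delta>2 \<delta>3 S v)\<^sup>2 \<le> C * Kh k \<Omega> M \<nu> \<sigma> \<beta> \<delta>1 \<delta>2 \<delta>3 S v v" .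
  qed
qed

end
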